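(* Let $d\geq 2$ and $1\leq i\leq d-1$. Let $P_1$ and $P_2$ be $(d-i)$-simplicial $i$-simple $d$-polytopes such that $P_1$ has a simplex facet $F=\mathrm{conv}(u_1,\dots,u_d)$ and $P_2$ has a simple vertex $v$ whose neighbors are $u'_1,\dots,u'_d$. Then the poset $\mathcal{L}$ is (isomorphic to) the face lattice $\mathcal{L}(P_1\triangleright P_2)$ of the merge of $P_1$ and $P_2$ along $F$ and $v$ (with these orderings of vertices).
   Context: A $d$-polytope is $j$-simplicial if all its $j$-faces are simplices, and $i$-simple if every $(d-i-1)$-face is contained in exactly $i+1$ facets; a vertex is simple if it lies in exactly $d$ facets. $[d]=\{1,\dots,d\}$. For $1\leq j\leq d$, $H_j$ is the facet of $P_1$ meeting $F$ in the ridge $\mathrm{conv}(u_k:k\neq j)$, and $H'_j$ is the facet of $P_2$ containing all edges of $P_2$ at $v$ except $vu'_j$. Merge: after a projective transformation of $P_1$, the hyperplanes $\mathrm{aff}(F),\mathrm{aff}(H_1),\dots,\mathrm{aff}(H_d)$ bound a $d$-simplex $\Sigma\supseteq P_1$; let $u$ be its vertex not in $F$. After the affine map on $P_2$ sending $v\mapsto u$, $u'_k\mapsto u_k$, one has $P_1\subseteq\Sigma=\mathrm{conv}(v,u'_1,\dots,u'_d)\subseteq P_2$; the merge $P_1\triangleright P_2$ is $P_1\cup\mathrm{conv}(V(P_2)\setminus\{v\})$. The face lattice $\mathcal{L}(P)$ is the set of faces of $P$ (including $\emptyset$ and $P$) ordered by inclusion; intersection over $S=\emptyset$ is the whole polytope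 and $\mathrm{conv}(\emptyset)=\emptyset$. Let $\mathcal{L}(P_1)^-=\mathcal{L}(P_1)\setminus\{\sigma:\sigma\subseteq F,\ \dim\sigma\geq d-i\}$ and $\mathcal{L}(P_2)^-=\mathcal{L}(P_2)\setminus\{\sigma:v\in\sigma,\ \dim\sigma<d-i\}$. $\mathcal{L}$ is the quotient of the disjoint union $\mathcal{L}(P_1)^-\sqcup\mathcal{L}(P_2)^-$ (original orders on each part, no other comparabilities) by $\mathrm{conv}(u_k:k\in S)\sim\mathrm{conv}(u'_k:k\in S)$ for $S\subseteq[d]$, $|S|\leq d-i$, and $\bigcap_{k\in S}H_k\sim\bigcap_{k\in S}H'_k$ for $S\subseteq[d]$, $|S|\leq i$, ordered by $[\tau]<[\sigma]$ if some representatives satisfy $\tau'<\sigma'$. *)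

theory Defs
  imports "HOL-Analysis.Analysis"
begin

definition d_polytope :: "nat \<Rightarrow> 'a::euclidean_space set \<Rightarrow> bool" where
  "d_polytope d P \<longleftrightarrow> polytope P \<and> aff_dim P = int d"

definition j_simplicial :: "nat \<Rightarrow> 'a::euclidean_space set \<Rightarrow> bool" where
  "j_simplicial j P \<longleftrightarrow> (\<forall>\<sigma>. \<sigma> face_of P \<and> aff_dim \<sigma> = int j \<longrightarrow> int j simplex \<sigma>)"

definition i_simple :: "nat \<Rightarrow> 'a::euclidean_space set \<Rightarrow> bool" where
  "i_simple i P \<longleftrightarrow>
     (\<forall>\<sigma>. \<sigma> face_of P \<and> aff_dim \<sigma> = aff_dim P - int i - 1 \<longrightarrow>
          card {G. G facet_of P \<and> \<sigma> \<subseteq> G} = i + 1)"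

definition vertices :: "'a::euclidean_space set \<Rightarrow> 'a set" where
  "vertices P = {x. x extreme_point_of P}"

definition neighbours :: "'a::euclidean_space set \<Rightarrow> 'a \<Rightarrow> 'a set" where
  "neighbours P v = {w \<in> vertices P. closed_segment v w edge_of P}"

definition simple_vertex :: "nat \<Rightarrow> 'a::euclidean_space set \<Rightarrow> 'a \<Rightarrow> bool" where
  "simple_vertex d P v \<longleftrightarrow> v \<in> vertices P \<and> card {G. G facet_of P \<and> v \<in> G} = d"

definition face_lattice :: "'a::euclidean_space set \<Rightarrow> 'a set set" where
  "face_lattice P = {\<sigma>. \<sigma> face_of P}"

text \<open>The facets \<open>H\<^sub>j\<close> of \<open>P\<^sub>1\<close> and \<open>H'\<^sub>j\<close> of \<open>P\<^sub>2\<close>; here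
  \<open>F = convex hull (u ` {1..d})\<close>.\<close>

definition ridge_facet :: "nat \<Rightarrow> 'a::euclidean_space set \<Rightarrow> (nat \<Rightarrow> 'a) \<Rightarrow> nat \<Rightarrow> 'a set" where
  "ridge_facet d P u j =
     (THE H. H facet_of P \<and>
             H \<inter> convex hull (u ` {1..d}) = convex hull (u ` ({1..d} - {j})))"

definition vertex_facet :: "'a::euclidean_space set \<Rightarrow> 'a \<Rightarrow> (nat \<Rightarrow> 'a) \<Rightarrow> nat \<Rightarrow> 'a set" where
  "vertex_facet P v u' j =
     (THE H. H facet_of P \<and>
             (\<forall>e. e edge_of P \<and> v \<in> e \<longrightarrow> (e \<subseteq> H \<longleftrightarrow> e \<noteq> closed_segment v (u' j))))"

text \<open>In homogeneous coordinates, a projective transformation is a linear automorphism \<open>L\<close> of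
  \<open>'a \<times> real\<close>, with \<open>x\<close> represented by \<open>(x, 1)\<close>. It is admissible for \<open>P\<close> if no point of \<open>P\<close>
  is sent to infinity.\<close>

definition proj_map :: "('a::euclidean_space \<times> real \<Rightarrow> 'a \<times> real) \<Rightarrow> 'a \<Rightarrow> 'a" where
  "proj_map L x = fst (L (x, 1)) /\<^sub>R snd (L (x, 1))"

definition projective_on :: "'a::euclidean_space set \<Rightarrow> ('a \<Rightarrow> 'a) \<Rightarrow> bool" where
  "projective_on P \<phi> \<longleftrightarrow>
     (\<exists>L. linear L \<and> bij L \<and> (\<forall>x\<in>P. snd (L (x, 1)) \<noteq> 0) \<and> \<phi> = proj_map L)"

definition affine_map :: "('a::euclidean_space \<Rightarrow> 'a) \<Rightarrow> bool" where
  "affine_map \<alpha> \<longleftrightarrow> (\<exists>h b. linear h \<and> \<alpha> = (\<lambda>x. h x + b))"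

text \<open>\<open>Q\<close> is a merge of \<open>P\<^sub>1\<close> and \<open>P\<^sub>2\<close> along \<open>F = convex hull (u ` {1..d})\<close> and \<open>v\<close>. This is a
  relation, since \<open>Q\<close> depends on the chosen projective transformation \<open>\<phi>\<close>. The simplex \<open>\<Sigma>\<close> is
  bounded by the given \<open>d + 1\<close> hyperplanes: they are exactly the affine hulls of its facets.\<close>

definition is_merge ::
  "nat \<Rightarrow> 'a::euclidean_space set \<Rightarrow> (nat \<Rightarrow> 'a) \<Rightarrow> 'a set \<Rightarrow> 'a \<Rightarrow> (nat \<Rightarrow> 'a) \<Rightarrow> 'a set \<Rightarrow> bool"
where
  "is_merge d P1 u P2 v u' Q \<longleftrightarrow>
     (\<exists>\<phi> \<Sigma> w \<alpha>.
        projective_on P1 \<phi> \<and>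
        int d simplex \<Sigma> \<and>
        {affine hull G | G. G facet_of \<Sigma>} =
          insert (affine hull (\<phi> ` (convex hull (u ` {1..d}))))
                 {affine hull (\<phi> ` ridge_facet d P1 u j) | j. j \<in> {1..d}} \<and>
        \<phi> ` P1 \<subseteq> \<Sigma> \<and>
        w \<in> vertices \<Sigma> \<and> w \<notin> \<phi> ` (convex hull (u ` {1..d})) \<and>
        affine_map \<alpha> \<and> \<alpha> v = w \<and> (\<forall>k\<in>{1..d}. \<alpha> (u' k) = \<phi> (u k)) \<and>
        Q = \<phi> ` P1 \<union> convex hull (vertices (\<alpha> ` P2) - {w}))"

definition lattice1_minus ::
  "nat \<Rightarrow> nat \<Rightarrow> 'a::euclidean_space set \<Rightarrow> (nat \<Rightarrow> 'a) \<Rightarrow> 'a set set" where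
  "lattice1_minus d i P1 u =
     face_lattice P1 - {\<sigma>. \<sigma> \<subseteq> convex hull (u ` {1..d}) \<and> aff_dim \<sigma> \<ge> int d - int i}"

definition lattice2_minus ::
  "nat \<Rightarrow> nat \<Rightarrow> 'a::euclidean_space set \<Rightarrow> 'a \<Rightarrow> 'a set set" where
  "lattice2_minus d i P2 v =
     face_lattice P2 - {\<sigma>. v \<in> \<sigma> \<and> aff_dim \<sigma> < int d - int i}"

text \<open>The intersection with \<open>P1\<close>, \<open>P2\<close> makes the intersection over \<open>S = {}\<close> the whole polytope.\<close>

definition glue ::
  "nat \<Rightarrow> nat \<Rightarrow> 'a::euclidean_space set \<Rightarrow> (nat \<Rightarrow> 'a) \<Rightarrow> 'a set \<Rightarrow> 'a \<Rightarrow> (nat \<Rightarrow> 'a) \<Rightarrow>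
   ('a set + 'a set) rel"
where
  "glue d i P1 u P2 v u' =
     {(Inl (convex hull (u ` S)), Inr (convex hull (u' ` S))) | S. S \<subseteq> {1..d} \<and> card S \<le> d - i} \<union>
     {(Inl (P1 \<inter> (\<Inter>k\<in>S. ridge_facet d P1 u k)), Inr (P2 \<inter> (\<Inter>k\<in>S. vertex_facet P2 v u' k)))
        | S. S \<subseteq> {1..d} \<and> card S \<le> i}"

text \<open>The carrier of the quotient poset: the disjoint union modulo the equivalence relation
  generated by \<open>glue\<close>.\<close>

definition merge_poset ::
  "nat \<Rightarrow> nat \<Rightarrow> 'a::euclidean_space set \<Rightarrow> (nat \<Rightarrow> 'a) \<Rightarrow> 'a set \<Rightarrow> 'a \<Rightarrow> (nat \<Rightarrow> 'a) \<Rightarrow>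
   ('a set + 'a set) set set"
where
  "merge_poset d i P1 u P2 v u' =
     (let A = lattice1_minus d i P1 u <+> lattice2_minus d i P2 v;
          g = glue d i P1 u P2 v u'
      in A // Restr ((g \<union> g\<inverse>)\<^sup>*) A)"

text \<open>\<open>rel_sum\<close> compares only elements of the same summand.\<close>

definition class_less :: "('a set + 'a set) set \<Rightarrow> ('a set + 'a set) set \<Rightarrow> bool" where
  "class_less X Y \<longleftrightarrow> (\<exists>\<tau>\<in>X. \<exists>\<sigma>\<in>Y. rel_sum (\<subset>) (\<subset>) \<tau> \<sigma>)"

definition order_isomorphic ::
  "'b set \<Rightarrow> ('b \<Rightarrow> 'b \<Rightarrow> bool) \<Rightarrow> 'c set \<Rightarrow> ('c \<Rightarrow> 'c \<Rightarrow> bool) \<Rightarrow> bool" where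
  "order_isomorphic A lessA B lessB \<longleftrightarrow>
     (\<exists>f. bij_betw f A B \<and> (\<forall>x\<in>A. \<forall>y\<in>A. lessA x y \<longleftrightarrow> lessB (f x) (f y)))"

end

theory Submission
  imports Defs
begin

text \<open>
  In barycentric coordinates \<open>c\<^sub>k\<close> with respect to the simplex \<open>\<Sigma> = conv (w, y\<^sub>1, \<dots>, y\<^sub>d)\<close>, put
  \<open>s = c\<^sub>1 + \<dots> + c\<^sub>d\<close>. After the normalization, \<open>R\<^sub>1 \<subseteq> \<Sigma> \<subseteq> R\<^sub>2 \<subseteq> {c\<^sub>k \<ge> 0}\<close> and the merge is
  \<open>Q = R\<^sub>1 \<union> (R\<^sub>2 \<inter> {s \<ge> 1})\<close>, which is convex with \<open>R\<^sub>1 \<subseteq> Q \<subseteq> R\<^sub>2\<close>. A face \<open>\<sigma>\<close> of \<open>R\<^sub>1\<close> is sent to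
  the smallest face of \<open>Q\<close> that contains it, with left inverse \<open>E \<mapsto> E \<inter> R\<^sub>1\<close>, and a face \<open>\<tau>\<close> of
  \<open>R\<^sub>2\<close> is sent to \<open>\<tau> \<inter> Q\<close>; on the elements that remain after the deletions both maps are order
  embeddings. The reason on the first side is that a linear functional that is maximal on \<open>\<sigma>\<close> over
  \<open>R\<^sub>1\<close>, where \<open>\<sigma>\<close> is not contained in \<open>F\<close>, is at \<open>w\<close> at least as large as on \<open>\<sigma>\<close>, hence does not
  exceed its maximum anywhere on \<open>Q\<close>. Simplicity of \<open>P\<^sub>1\<close> says that near the barycenter of a face of
  \<open>F\<close> of dimension at least \<open>d - i - 1\<close>, \<open>R\<^sub>1\<close> is cut out by \<open>F\<close> and the \<open>H\<^sub>k\<close> only; simpliciality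
  of \<open>P\<^sub>2\<close> says that \<open>s \<le> 1\<close> on the faces at \<open>w\<close> of dimension at most \<open>d - i\<close>. These two facts
  determine which images coincide and show that every comparable pair of faces of \<open>Q\<close> comes from
  one of the two polytopes.
\<close>

text \<open>\<open>Q\<close> is handled as a convex set, not through facet inequalities of its own;
  its faces are sorted by the level \<open>s\<close>. A face with a point at \<open>s < 1\<close> is
  recovered from its trace on \<open>R1\<close>, since segments going up cross \<open>s = 1\<close>
  inside \<open>R1\<close>. A face on which \<open>s \<ge> 1\<close> turns out to be a face of
  \<open>R2\<close> already. The order on the quotient compares representatives within one summand,
  so a pair \<open>D \<subseteq> E\<close> of faces of \<open>Q\<close> has to be lifted to one side
  simultaneously. The delicate case is \<open>D\<close> above and \<open>E\<close> reaching below
  level 1. The functional exposing \<open>E\<close> decides it: if it is larger at \<open>w\<close>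
  than on \<open>E\<close>, then \<open>D\<close> lies in \<open>F\<close>; if it is equal there,
  \<open>E\<close> is the trace of a corner of \<open>R2\<close> at \<open>w\<close>. The thresholds
  fit together: a hull of at most \<open>d - i\<close> of the \<open>y k\<close> is still a face of
  \<open>R2\<close>, and a corner satisfying at most \<open>i\<close> coordinate equations dips
  below \<open>F\<close> within \<open>R1\<close>. Coordinates exist only after the projective
  normalization. What is carried across it is betweenness, and with it everything that can be
  phrased by faces alone; facets are therefore treated as maximal proper faces.\<close>

declare One_nat_def [simp del]

section \<open>Affine coordinates and corners\<close>

lemma face_of_hull_image:
  fixes u :: "'b \<Rightarrow> 'a::euclidean_space"
  assumes "\<not> affine_dependent (u ` I)"
  shows "T face_of convex hull (u ` I) \<longleftrightarrow> (\<exists>S\<subseteq>I. T = convex hull (u ` S))"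
  unfolding face_of_convex_hull_affine_independent[OF assms] subset_image_iff by blast

lemma aff_dim_hull_image:
  fixes u :: "'b \<Rightarrow> 'a::euclidean_space"
  assumes "\<not> affine_dependent (u ` I)" "inj_on u I" "S \<subseteq> I"
  shows "aff_dim (convex hull (u ` S)) = int (card S) - 1"
proof -
  have "\<not> affine_dependent (u ` S)"
    by (rule affine_independent_subset[OF assms(1) image_mono[OF assms(3)]])
  then have "aff_dim (u ` S) = int (card (u ` S)) - 1" by (simp only: affine_independent_iff_card)
  then show ?thesis using card_image[OF inj_on_subset[OF assms(2,3)]] by (simp add: aff_dim_convex_hull)
qed

text \<open>The vectors \<open>a k\<close> form the basis dual to \<open>y k - w\<close>.
  Barycentric coordinates thus become inner products, and their level sets are the hyperplanes that
  the face lemmas ask for. The weight of \<open>w\<close> itself is \<open>1 - s x\<close>.\<close>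

locale frame =
  fixes d :: nat and w :: "'a::euclidean_space" and y a :: "nat \<Rightarrow> 'a"
  assumes expand: "\<And>x. x = w + (\<Sum>k\<in>{1..d}. (a k \<bullet> (x - w)) *\<^sub>R (y k - w))"
    and dual: "\<And>j k. j \<in> {1..d} \<Longrightarrow> k \<in> {1..d} \<Longrightarrow> a j \<bullet> (y k - w) = (if j = k then 1 else 0)"
begin

definition c :: "nat \<Rightarrow> 'a \<Rightarrow> real" where "c k x = a k \<bullet> (x - w)"

definition s :: "'a \<Rightarrow> real" where "s x = (\<Sum>k\<in>{1..d}. c k x)"

lemma c_w [simp]: "c k w = 0" and s_w [simp]: "s w = 0"
  by (simp_all add: c_def s_def)

lemma c_y: "j \<in> {1..d} \<Longrightarrow> k \<in> {1..d} \<Longrightarrow> c j (y k) = (if j = k then 1 else 0)"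
  using dual by (simp add: c_def)

lemma s_y: "k \<in> {1..d} \<Longrightarrow> s (y k) = 1"
  unfolding s_def by (subst sum.cong[OF refl c_y]) auto

lemma c_line: "c k (p + e *\<^sub>R (q - r)) = c k p + e * (c k q - c k r)"
  by (simp add: c_def inner_diff_right inner_add_right algebra_simps)

lemma s_line: "s (p + e *\<^sub>R (q - r)) = s p + e * (s q - s r)"
  by (simp add: s_def c_line sum.distrib sum_subtractf flip: sum_distrib_left)

lemma c_convex:
  assumes "e + f = 1"
  shows "c k (e *\<^sub>R p + f *\<^sub>R q) = e * c k p + f * c k q"
proof -
  have "f = 1 - e" using assms by simp
  then have "e *\<^sub>R p + f *\<^sub>R q - w = e *\<^sub>R (p - w) + f *\<^sub>R (q - w)"
    unfolding \<open>f = 1 - e\<close> by (simp add: algebra_simps)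
  then show ?thesis by (simp add: c_def inner_add_right)
qed

lemma s_convex: "e + f = 1 \<Longrightarrow> s (e *\<^sub>R p + f *\<^sub>R q) = e * s p + f * s q"
  by (simp add: s_def c_convex sum.distrib sum_distrib_left)

lemma bary: "x = (1 - s x) *\<^sub>R w + (\<Sum>k\<in>{1..d}. c k x *\<^sub>R y k)"
proof -
  have "x = w + (\<Sum>k\<in>{1..d}. c k x *\<^sub>R (y k - w))"
    using expand unfolding c_def .
  also have "\<dots> = (1 - s x) *\<^sub>R w + (\<Sum>k\<in>{1..d}. c k x *\<^sub>R y k)"
    by (simp add: s_def scaleR_diff_right sum_subtractf scaleR_sum_left scaleR_diff_left)
  finally show ?thesis .
qed

lemma inner_bary: "n \<bullet> x = (1 - s x) * (n \<bullet> w) + (\<Sum>k\<in>{1..d}. c k x * (n \<bullet> y k))"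
  using arg_cong[OF bary, of "\<lambda>z. n \<bullet> z" x] by (simp add: inner_add_right inner_sum_right)

text \<open>Beyond \<open>s = 1\<close> the weight of \<open>w\<close> is negative, so the value at
  \<open>w\<close> acts there with the opposite sign. The later arguments about supporting
  functionals rest on this.\<close>

lemma affine_bary: "n \<bullet> x - b = (1 - s x) * (n \<bullet> w - b) + (\<Sum>k\<in>{1..d}. c k x * (n \<bullet> y k - b))"
proof -
  have "(\<Sum>k\<in>{1..d}. c k x * (n \<bullet> y k - b)) = (\<Sum>k\<in>{1..d}. c k x * (n \<bullet> y k)) - s x * b"
    by (simp add: right_diff_distrib sum_subtractf s_def sum_distrib_right)
  with inner_bary[of n x] show ?thesis by (simp add: algebra_simps)
qed

lemma c_inner: "c k x = a k \<bullet> x - a k \<bullet> w"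
  by (simp add: c_def inner_diff_right)

lemma s_inner: "s x = (\<Sum>k\<in>{1..d}. a k) \<bullet> x - (\<Sum>k\<in>{1..d}. a k) \<bullet> w"
  by (simp add: s_def c_def inner_diff_right inner_sum_left sum_subtractf)

lemma eq_if_coords:
  assumes "\<And>k. k \<in> {1..d} \<Longrightarrow> c k x = c k z"
  shows "x = z"
proof -
  have "s x = s z" unfolding s_def by (rule sum.cong) (use assms in auto)
  moreover have "(\<Sum>k\<in>{1..d}. c k x *\<^sub>R y k) = (\<Sum>k\<in>{1..d}. c k z *\<^sub>R y k)"
    by (rule sum.cong) (use assms in auto)
  ultimately show ?thesis using bary[of x] bary[of z] by metis
qed

text \<open>Only vertices of positive weight have to lie in \<open>C\<close>, which makes the rule
  usable for a face that contains just some of the \<open>y k\<close>.\<close>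

lemma in_convex:
  assumes "convex C" "w \<in> C" "\<And>k. k \<in> {1..d} \<Longrightarrow> 0 < c k x \<Longrightarrow> y k \<in> C"
    "\<And>k. k \<in> {1..d} \<Longrightarrow> 0 \<le> c k x" "s x \<le> 1"
  shows "x \<in> C"
proof -
  let ?T = "{k\<in>{1..d}. 0 < c k x}"
  have sum: "(\<Sum>k\<in>{1..d}. c k x *\<^sub>R y k) = (\<Sum>k\<in>?T. c k x *\<^sub>R y k)"
    by (rule sum.mono_neutral_right) (use assms(4) in \<open>force+\<close>)
  have sx: "s x = (\<Sum>k\<in>?T. c k x)"
    unfolding s_def by (rule sum.mono_neutral_right) (use assms(4) in \<open>force+\<close>)
  \<comment> \<open>Index 0 is free, since the frame is indexed from 1; it stands for
    \<open>w\<close> with its weight \<open>1 - s x\<close>.\<close>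
  let ?f = "\<lambda>k. if k = 0 then w else y k" and ?g = "\<lambda>k. if k = 0 then 1 - s x else c k x"
  have z: "0 \<notin> ?T" by simp
  have eqT: "(\<Sum>k\<in>?T. ?g k *\<^sub>R ?f k) = (\<Sum>k\<in>?T. c k x *\<^sub>R y k)" "(\<Sum>k\<in>?T. ?g k) = (\<Sum>k\<in>?T. c k x)"
    by (auto intro: sum.cong)
  have "(\<Sum>k\<in>insert 0 ?T. ?g k *\<^sub>R ?f k) \<in> C"
    by (rule convex_sum[OF _ assms(1)]) (use assms z sx eqT in auto)
  also have "(\<Sum>k\<in>insert 0 ?T. ?g k *\<^sub>R ?f k) = (1 - s x) *\<^sub>R w + (\<Sum>k\<in>?T. c k x *\<^sub>R y k)"
    using z eqT by simp
  also have "\<dots> = x" using bary[of x] sum by simp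
  finally show ?thesis .
qed

lemma hull_y:
  assumes "S \<subseteq> {1..d}"
  shows "convex hull (y ` S) = {x. (\<forall>k\<in>{1..d}. 0 \<le> c k x) \<and> (\<forall>k\<in>{1..d} - S. c k x = 0) \<and> s x = 1}"
    (is "_ = ?R")
proof
  have "convex ?R"
    unfolding convex_def by (auto simp: c_convex s_convex)
  moreover have "y ` S \<subseteq> ?R"
    using assms by (auto simp: c_y s_y subset_iff)
  ultimately show "convex hull (y ` S) \<subseteq> ?R" by (rule hull_minimal[rotated])
  show "?R \<subseteq> convex hull (y ` S)"
  proof
    fix x assume x: "x \<in> ?R"
    have fin: "finite S" using assms finite_subset by blast
    have eq: "(\<Sum>k\<in>{1..d}. c k x *\<^sub>R y k) = (\<Sum>k\<in>S. c k x *\<^sub>R y k)" "s x = (\<Sum>k\<in>S. c k x)"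
      unfolding s_def using x assms by (auto intro!: sum.mono_neutral_right)
    have "(\<Sum>k\<in>S. c k x *\<^sub>R y k) \<in> convex hull (y ` S)"
      by (rule convex_sum) (use fin x eq assms in \<open>auto intro: hull_inc\<close>)
    then show "x \<in> convex hull (y ` S)" using bary[of x] eq x by simp
  qed
qed

lemma inj_y: "inj_on y {1..d}"
proof (rule inj_onI)
  fix j k assume "j \<in> {1..d}" "k \<in> {1..d}" "y j = y k"
  then show "j = k" using c_y[of j j] c_y[of j k] by (simp split: if_splits)
qed

lemma w_notin_y: "k \<in> {1..d} \<Longrightarrow> y k \<noteq> w"
  using s_y[of k] s_w by (metis zero_neq_one)

lemma w_notin: "S \<subseteq> {1..d} \<Longrightarrow> w \<notin> y ` S"
  using w_notin_y by blast

lemma affine_independent: "\<not> affine_dependent (insert w (y ` {1..d}))"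
proof -
  have "independent ((\<lambda>k. y k - w) ` {1..d})"
  proof (rule independent_if_scalars_zero)
    show "finite ((\<lambda>k. y k - w) ` {1..d})" by simp
    fix f x assume 0: "(\<Sum>x\<in>(\<lambda>k. y k - w) ` {1..d}. f x *\<^sub>R x) = 0" and "x \<in> (\<lambda>k. y k - w) ` {1..d}"
    then obtain j where j: "j \<in> {1..d}" "x = y j - w" by auto
    have inj: "inj_on (\<lambda>k. y k - w) {1..d}" using inj_y unfolding inj_on_def by (metis diff_add_cancel)
    have "0 = a j \<bullet> (\<Sum>k\<in>{1..d}. f (y k - w) *\<^sub>R (y k - w))"
      using 0 by (simp add: sum.reindex[OF inj] o_def)
    also have "\<dots> = (\<Sum>k\<in>{1..d}. f (y k - w) * (if j = k then 1 else 0))"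
      using j by (simp add: inner_sum_right dual)
    also have "\<dots> = f (y j - w)" using j by (simp add: if_distrib cong: if_cong)
    finally show "f x = 0" using j by simp
  qed
  moreover have "(\<lambda>x. - w + x) ` (y ` {1..d}) = (\<lambda>k. y k - w) ` {1..d}" by auto
  ultimately show ?thesis
    using w_notin[OF order_refl] by (subst affine_dependent_iff_dependent) simp_all
qed

lemma affine_hull_omit:
  assumes "j \<in> {1..d}"
  shows "affine hull (insert w (y ` {1..d}) - {y j}) \<subseteq> {x. c j x = 0}"
proof (rule hull_minimal)
  show "insert w (y ` {1..d}) - {y j} \<subseteq> {x. c j x = 0}"
    using c_y[OF assms] by auto
  show "affine {x. c j x = 0}"
    unfolding affine_def by (auto simp: c_convex)
qed

lemma affine_hull_omit_w: "affine hull (insert w (y ` {1..d}) - {w}) \<subseteq> {x. s x = 1}"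
proof (rule hull_minimal)
  show "insert w (y ` {1..d}) - {w} \<subseteq> {x. s x = 1}"
    using s_y by auto
  show "affine {x. s x = 1}"
    unfolding affine_def by (auto simp: s_convex)
qed

lemma affine_independent_y: "\<not> affine_dependent (y ` {1..d})"
  by (rule affine_independent_subset[OF affine_independent subset_insertI])

end

text \<open>The linear functional extending \<open>f\<close> is represented by the vector of its
  values on the standard basis.\<close>

lemma dual_vector:
  fixes B :: "'a::euclidean_space set"
  assumes "independent B"
  obtains e where "\<And>b. b \<in> B \<Longrightarrow> e \<bullet> b = f b"
proof -
  obtain g :: "'a \<Rightarrow> real" where g: "linear g" "\<forall>x\<in>B. g x = f x"
    using linear_independent_extend[OF assms] by blast
  have "(\<Sum>b\<in>Basis. g b *\<^sub>R b) \<bullet> x = g x" for x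
  proof -
    have "g x = g (\<Sum>b\<in>Basis. (x \<bullet> b) *\<^sub>R b)" by (simp add: euclidean_representation)
    also have "\<dots> = (\<Sum>b\<in>Basis. (x \<bullet> b) * g b)"
      using g(1) by (simp add: linear_sum linear_scale)
    also have "\<dots> = (\<Sum>b\<in>Basis. g b *\<^sub>R b) \<bullet> x"
      by (simp add: inner_sum_left inner_commute[of x] mult.commute)
    finally show ?thesis by simp
  qed
  with g show ?thesis using that by metis
qed

lemma frame_exists:
  fixes w :: "'a::euclidean_space"
  assumes "DIM('a) = d" "\<not> affine_dependent (insert w (y ` {1..d}))" "inj_on y {1..d}" "w \<notin> y ` {1..d}"
  obtains a where "frame d w y a"
proof -
  let ?B = "(\<lambda>k. y k - w) ` {1..d}"
  have inj: "inj_on (\<lambda>k. y k - w) {1..d}" using assms(3) unfolding inj_on_def by (metis diff_add_cancel)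
  have "(\<lambda>x. - w + x) ` (y ` {1..d}) = ?B" by auto
  with assms have ind: "independent ?B"
    by (subst (asm) affine_dependent_iff_dependent) auto
  have "card ?B = d" using inj by (simp add: card_image)
  then have span: "x \<in> span ?B" for x
    using ind card_ge_dim_independent[of ?B UNIV] assms(1) by auto
  have "\<exists>e. \<forall>k\<in>{1..d}. e \<bullet> (y k - w) = (if j = k then 1 else 0)" if "j \<in> {1..d}" for j
  proof -
    obtain e where "\<And>b. b \<in> ?B \<Longrightarrow> e \<bullet> b = (if b = y j - w then 1 else 0)"
      using dual_vector[OF ind, of "\<lambda>b. if b = y j - w then 1 else 0"] by blast
    then have "e \<bullet> (y k - w) = (if j = k then 1 else 0)" if "k \<in> {1..d}" for k
      using that \<open>j \<in> {1..d}\<close> inj_onD[OF inj, of j k] by fastforce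
    then show ?thesis by blast
  qed
  then obtain a where a: "\<And>j k. j \<in> {1..d} \<Longrightarrow> k \<in> {1..d} \<Longrightarrow> a j \<bullet> (y k - w) = (if j = k then 1 else 0)"
    by metis
  have "x = w + (\<Sum>k\<in>{1..d}. (a k \<bullet> (x - w)) *\<^sub>R (y k - w))" for x
  proof -
    obtain t where "x - w = (\<Sum>b\<in>?B. t b *\<^sub>R b)"
      using span[of "x - w"] by (auto simp: span_finite)
    then have t: "x - w = (\<Sum>k\<in>{1..d}. t (y k - w) *\<^sub>R (y k - w))"
      by (simp add: sum.reindex[OF inj])
    have "a j \<bullet> (x - w) = t (y j - w)" if "j \<in> {1..d}" for j
      using that unfolding t by (simp add: inner_sum_right a if_distrib cong: if_cong)
    then have "(\<Sum>k\<in>{1..d}. (a k \<bullet> (x - w)) *\<^sub>R (y k - w)) = x - w"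
      using t by simp
    then show ?thesis by simp
  qed
  with a have "frame d w y a" by (intro frame.intro)
  then show ?thesis by (rule that)
qed

text \<open>Abstracts a polytope near a simple vertex \<open>w\<close> with neighbours
  \<open>y k\<close>: it contains the simplex on these points and lies in the cone spanned from
  \<open>w\<close>. Used both for the second polytope and for its affine image.\<close>

locale corner = frame +
  fixes P :: "'a set"
  assumes convex: "convex P" and w_in: "w \<in> P" and y_in: "\<And>k. k \<in> {1..d} \<Longrightarrow> y k \<in> P"
    and nonneg: "\<And>k x. k \<in> {1..d} \<Longrightarrow> x \<in> P \<Longrightarrow> 0 \<le> c k x"
begin

text \<open>\<open>S\<close> lists the equations that hold on the face, so larger \<open>S\<close>
  means smaller face: among the neighbours, it contains those with index outside \<open>S\<close>.
  It will be identified with the intersection of the facets \<open>vertex_facet\<close> over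
  \<open>S\<close>.\<close>

definition corner_face :: "nat set \<Rightarrow> 'a set" where
  "corner_face S = {x\<in>P. \<forall>k\<in>S. c k x = 0}"

lemma face_of_corner_face:
  assumes "S \<subseteq> {1..d}"
  shows "corner_face S face_of P"
proof -
  have "P \<inter> {x. a k \<bullet> x = a k \<bullet> w} face_of P" if "k \<in> S" for k
  proof (rule face_of_Int_supporting_hyperplane_ge[OF convex])
    show "a k \<bullet> w \<le> a k \<bullet> x" if "x \<in> P" for x
      using nonneg[OF _ that, of k] \<open>k \<in> S\<close> assms c_inner[of k x] by auto
  qed
  then have "\<Inter>(insert P ((\<lambda>k. P \<inter> {x. a k \<bullet> x = a k \<bullet> w}) ` S)) face_of P"
    using face_of_refl[OF convex] by (intro face_of_Inter) auto
  moreover have "\<Inter>(insert P ((\<lambda>k. P \<inter> {x. a k \<bullet> x = a k \<bullet> w}) ` S)) = corner_face S"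
    by (auto simp: corner_face_def c_inner)
  ultimately show ?thesis by simp
qed

lemma w_in_corner_face: "w \<in> corner_face S"
  by (simp add: corner_face_def w_in)

lemma y_in_corner_face:
  assumes "k \<in> {1..d}" "S \<subseteq> {1..d}"
  shows "y k \<in> corner_face S \<longleftrightarrow> k \<notin> S"
proof -
  have "c j (y k) = (if j = k then 1 else 0)" if "j \<in> S" for j
    using that assms c_y by blast
  then show ?thesis using assms y_in by (auto simp: corner_face_def)
qed

text \<open>Shrinking towards \<open>w\<close> moves \<open>x\<close> into the simplex, where the
  positive weights decide membership in \<open>T\<close>. The shrunk point lies strictly between
  \<open>w\<close> and \<open>x\<close>, so the face property brings \<open>x\<close> back.\<close>

lemma in_face_if_support:
  assumes "T face_of P" "w \<in> T" "x \<in> P" "\<And>k. k \<in> {1..d} \<Longrightarrow> 0 < c k x \<Longrightarrow> y k \<in> T"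
  shows "x \<in> T"
proof (cases "x = w")
  case False
  \<comment> \<open>The second bound gives \<open>e * s x \<le> 1\<close>, the first keeps
    \<open>e\<close> below 1.\<close>
  define e where "e = min (1/2) (1 / (1 + \<bar>s x\<bar>))"
  define z where "z = w + e *\<^sub>R (x - w)"
  have e: "0 < e" "e < 1" by (auto simp: e_def min_def field_simps)
  have c: "c k z = e * c k x" "s z = e * s x" for k
    by (auto simp: z_def c_line s_line)
  have "s z \<le> 1"
  proof -
    have "s z \<le> e * (1 + \<bar>s x\<bar>)" using e by (simp add: c)
    also have "\<dots> \<le> (1 / (1 + \<bar>s x\<bar>)) * (1 + \<bar>s x\<bar>)"
      by (rule mult_right_mono) (auto simp: e_def)
    also have "\<dots> = 1" by (simp add: add_nonneg_eq_0_iff)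
    finally show ?thesis .
  qed
  have "z \<in> T"
  proof (rule in_convex[OF face_of_imp_convex[OF assms(1)] assms(2)])
    show "y k \<in> T" if "k \<in> {1..d}" "0 < c k z" for k
      using that e assms(4) by (simp add: c zero_less_mult_iff)
    show "0 \<le> c k z" if "k \<in> {1..d}" for k
      using that e nonneg[OF _ assms(3)] by (simp add: c)
  qed fact
  moreover have "z \<in> open_segment w x"
    using e False by (auto simp: in_segment z_def algebra_simps intro!: exI[of _ e])
  ultimately show ?thesis using face_ofD[OF assms(1)] w_in assms(3) by blast
qed (use assms in simp)

text \<open>A face of \<open>P\<close> cuts the simplex on \<open>w\<close> and the
  \<open>y k\<close> in a face of that simplex, and faces of a simplex are hulls of subsets of its
  vertices.\<close>

lemma face_simplex:
  assumes "T face_of P" "z \<in> T" "s z \<le> 1"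
  obtains C where "C \<subseteq> insert w (y ` {1..d})" "C \<subseteq> T" "z \<in> convex hull C"
proof -
  let ?V = "insert w (y ` {1..d})"
  have zP: "z \<in> P" using assms face_of_imp_subset by blast
  have "?V \<subseteq> P" using w_in y_in by blast
  then have "convex hull ?V \<subseteq> P" using convex by (rule hull_minimal)
  then have "P \<inter> convex hull ?V = convex hull ?V" by blast
  then have "T \<inter> convex hull ?V face_of convex hull ?V"
    using face_of_slice[OF assms(1) convex_convex_hull, of ?V] by simp
  then obtain C where C: "C \<subseteq> ?V" "T \<inter> convex hull ?V = convex hull C"
    unfolding face_of_convex_hull_affine_independent[OF affine_independent] by blast
  have "z \<in> convex hull ?V"
    by (rule in_convex) (simp_all add: hull_inc nonneg[OF _ zP] assms(3))
  then have "z \<in> convex hull C" using C(2) assms(2) by blast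
  moreover have "C \<subseteq> T" using C(2) hull_subset[of C convex] by blast
  ultimately show ?thesis using that C(1) by blast
qed

text \<open>After shrinking towards \<open>w\<close> inside \<open>T\<close>, the point lies in the
  simplex and still has positive \<open>c k\<close>. All other vertices of the simplex have
  \<open>c k = 0\<close>, so \<open>y k\<close> must be among those in \<open>T\<close>.\<close>

lemma support_in_face:
  assumes "T face_of P" "w \<in> T" "x \<in> T" "k \<in> {1..d}" "0 < c k x"
  shows "y k \<in> T"
proof -
  have xP: "x \<in> P" using assms face_of_imp_subset by blast
  have sx: "0 < s x"
    unfolding s_def using assms(4,5) nonneg xP by (intro sum_pos2) auto
  define e where "e = min 1 (1 / s x)"
  define z where "z = w + e *\<^sub>R (x - w)"
  have e: "0 < e" "e \<le> 1" "e * s x \<le> 1" using sx by (auto simp: e_def min_def field_simps)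
  have "z = (1 - e) *\<^sub>R w + e *\<^sub>R x" by (simp add: z_def algebra_simps)
  then have zT: "z \<in> T" using convexD_alt[OF face_of_imp_convex[OF assms(1)] assms(2,3)] e by simp
  have "s z \<le> 1" using e by (simp add: z_def s_line)
  then obtain C where C: "C \<subseteq> insert w (y ` {1..d})" "C \<subseteq> T" "z \<in> convex hull C"
    using face_simplex[OF assms(1) zT] by blast
  show ?thesis
  proof (rule ccontr)
    assume "y k \<notin> T"
    then have "C \<subseteq> insert w (y ` {1..d}) - {y k}" using C by blast
    then have "convex hull C \<subseteq> {x. c k x = 0}"
      using convex_hull_subset_affine_hull[of C] affine_hull_omit[OF assms(4)] hull_mono by blast
    then have "c k z = 0" using C(3) by blast
    then show False using e assms(5) by (simp add: z_def c_line)
  qed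
qed

text \<open>Membership in a face at \<open>w\<close> depends only on which coordinates are positive,
  so the face is cut out by the coordinates of the neighbours that it misses.\<close>

lemma face_at_w:
  assumes "T face_of P" "w \<in> T"
  obtains S where "S \<subseteq> {1..d}" "T = corner_face S"
proof
  let ?S = "{k\<in>{1..d}. y k \<notin> T}"
  show "?S \<subseteq> {1..d}" by auto
  show "T = corner_face ?S"
  proof (intro equalityI subsetI)
    fix x assume "x \<in> T"
    then show "x \<in> corner_face ?S"
      using support_in_face[OF assms \<open>x \<in> T\<close>] nonneg face_of_imp_subset[OF assms(1)]
      unfolding corner_face_def by (smt (verit) mem_Collect_eq subsetD)
  next
    fix x assume "x \<in> corner_face ?S"
    then show "x \<in> T"
      using in_face_if_support[OF assms, of x] unfolding corner_face_def by fastforce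
  qed
qed

text \<open>Hulls of the \<open>y k\<close> alone stay in \<open>s = 1\<close>; below that level
  \<open>w\<close> must carry positive weight.\<close>

lemma w_in_face:
  assumes "T face_of P" "p \<in> T" "s p < 1"
  shows "w \<in> T"
proof (rule ccontr)
  assume "w \<notin> T"
  obtain C where C: "C \<subseteq> insert w (y ` {1..d})" "C \<subseteq> T" "p \<in> convex hull C"
    using face_simplex[OF assms(1,2)] assms(3) by auto
  then have "C \<subseteq> insert w (y ` {1..d}) - {w}" using \<open>w \<notin> T\<close> by blast
  then have "convex hull C \<subseteq> {x. s x = 1}"
    using convex_hull_subset_affine_hull[of C] affine_hull_omit_w hull_mono by blast
  then show False using C(3) assms(3) by auto
qed

lemma aff_dim_corner_face:
  assumes "S \<subseteq> {1..d}"
  shows "aff_dim (corner_face S) = int d - int (card S)"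
proof -
  let ?T = "insert w (y ` ({1..d} - S))"
  have "?T \<subseteq> corner_face S" using w_in_corner_face y_in_corner_face assms by auto
  then have 1: "aff_dim ?T \<le> aff_dim (corner_face S)" by (rule aff_dim_subset)
  have "corner_face S \<subseteq> affine hull ?T"
  proof
    fix x assume "x \<in> corner_face S"
    then have "\<And>k. k \<in> S \<Longrightarrow> c k x = 0" by (simp add: corner_face_def)
    then have "(\<Sum>k\<in>{1..d}. c k x *\<^sub>R (y k - w)) = (\<Sum>k\<in>{1..d} - S. c k x *\<^sub>R (y k - w))"
      using assms by (intro sum.mono_neutral_right) auto
    then have "x = w + (\<Sum>k\<in>{1..d} - S. c k x *\<^sub>R (y k - w))"
      using expand[of x] by (simp add: c_def)
    moreover have "(\<Sum>k\<in>{1..d} - S. c k x *\<^sub>R (y k - w)) \<in> span ((\<lambda>x. x - w) ` (?T - {w}))"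
      using w_notin_y by (intro span_sum span_scale span_base) auto
    ultimately show "x \<in> affine hull ?T"
      by (subst affine_hull_span2[of w]) auto
  qed
  then have 2: "aff_dim (corner_face S) \<le> aff_dim ?T"
    by (metis aff_dim_affine_hull aff_dim_subset)
  have "\<not> affine_dependent ?T"
    by (rule affine_independent_subset[OF affine_independent]) blast
  then have "aff_dim ?T = int (card ?T) - 1" by (simp only: affine_independent_iff_card)
  also have "card ?T = Suc (card (y ` ({1..d} - S)))"
    using w_notin[of "{1..d} - S"] by (subst card_insert_disjoint) auto
  also have "card (y ` ({1..d} - S)) = d - card S"
    using inj_y inj_on_diff[of y "{1..d}" S] assms by (simp add: card_image card_Diff_subset finite_subset)
  also have "int (Suc (d - card S)) - 1 = int d - int (card S)"
    using card_mono[OF _ assms] by (simp add: of_nat_diff)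
  finally show ?thesis using 1 2 by simp
qed

end

section \<open>Local structure at facets and the merged set\<close>

lemma affine_hull_eq_hyperplane:
  fixes X :: "'a::euclidean_space set"
  assumes "n \<noteq> 0" "X \<subseteq> {x. n \<bullet> x = b}" "aff_dim X = int DIM('a) - 1" "X \<noteq> {}"
  shows "affine hull X = {x. n \<bullet> x = b}"
proof (rule affine_dim_equal)
  show "affine (affine hull X)" "affine {x. n \<bullet> x = b}" by (simp_all add: affine_hyperplane)
  show "affine hull X \<noteq> {}" using assms by simp
  show "affine hull X \<subseteq> {x. n \<bullet> x = b}" using assms by (simp add: hull_minimal affine_hyperplane)
  have "int (DIM('a) - 1) = int DIM('a) - 1" using DIM_positive[where 'a='a] by linarith
  then show "aff_dim (affine hull X) = aff_dim {x. n \<bullet> x = b}" using assms by simp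
qed

text \<open>Both hyperplanes are the affine hull of the facet. If a point satisfied the first
  inequality but not the second, the segment from a point of \<open>P\<close> off the facet would
  cross the common hyperplane where the first functional is still strictly below its bound.\<close>

lemma facet_halfspace_unique:
  fixes P :: "'a::euclidean_space set"
  assumes G: "G facet_of P" and full: "aff_dim P = DIM('a)"
    and n: "n \<noteq> 0" "P \<subseteq> {x. n \<bullet> x \<le> b}" "G \<subseteq> {x. n \<bullet> x = b}"
    and m: "m \<noteq> 0" "P \<subseteq> {x. m \<bullet> x \<le> c}" "G \<subseteq> {x. m \<bullet> x = c}"
  shows "{x. n \<bullet> x \<le> b} \<subseteq> {x. m \<bullet> x \<le> c}"
proof -
  have dimG: "aff_dim G = int DIM('a) - 1" and "G \<noteq> {}" using G full by (auto simp: facet_of_def)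
  have hyp: "affine hull G = {x. k \<bullet> x = e}" if "k \<noteq> 0" "G \<subseteq> {x. k \<bullet> x = e}" for k e
    by (rule affine_hull_eq_hyperplane[OF that dimG \<open>G \<noteq> {}\<close>])
  then have eq: "{x. n \<bullet> x = b} = {x. m \<bullet> x = c}" using n m by metis
  obtain p where p: "p \<in> P" "n \<bullet> p \<noteq> b"
  proof (rule ccontr)
    assume "\<not> thesis"
    then have "P \<subseteq> {x. n \<bullet> x = b}" using that by blast
    then have "aff_dim P \<le> aff_dim {x. n \<bullet> x = b}" by (rule aff_dim_subset)
    then show False using full n DIM_positive[where 'a='a] by simp
  qed
  then have np: "n \<bullet> p < b" using n by force
  have "m \<bullet> p \<noteq> c" using p eq by blast
  then have mp: "m \<bullet> p < c" using p m by force
  show ?thesis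
  proof (rule subsetI, rule ccontr)
    fix x assume x: "x \<in> {x. n \<bullet> x \<le> b}" "x \<notin> {x. m \<bullet> x \<le> c}"
    define t where "t = (c - m \<bullet> p) / (m \<bullet> x - m \<bullet> p)"
    have t: "0 < t" "t < 1" using mp x by (auto simp: t_def field_simps)
    have "m \<bullet> (p + t *\<^sub>R (x - p)) = c"
      using mp x by (simp add: inner_add_right inner_diff_right t_def)
    then have "n \<bullet> (p + t *\<^sub>R (x - p)) = b" using eq by blast
    then have "(1 - t) * (n \<bullet> p - b) + t * (n \<bullet> x - b) = 0"
      by (simp add: inner_add_right inner_diff_right algebra_simps)
    moreover have "(1 - t) * (n \<bullet> p - b) < 0" using t np by (simp add: mult_pos_neg)
    moreover have "t * (n \<bullet> x - b) \<le> 0" using t x by (simp add: mult_nonneg_nonpos)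
    ultimately show False by linarith
  qed
qed

text \<open>In an irredundant description every inequality defines a facet. Inequalities strict at
  \<open>x\<close> survive a short move. For a tight one the hypothesis supplies some supporting
  functional of the same facet, which defines the same halfspace; this freedom allows coordinate
  functionals to be used later.\<close>

lemma facet_local:
  fixes P :: "'a::euclidean_space set"
  assumes "polyhedron P" and full: "aff_dim P = DIM('a)" and x: "x \<in> P"
    and dir: "\<And>G. G facet_of P \<Longrightarrow> x \<in> G \<Longrightarrow>
      \<exists>n b. n \<noteq> 0 \<and> P \<subseteq> {x. n \<bullet> x \<le> b} \<and> G \<subseteq> {x. n \<bullet> x = b} \<and> n \<bullet> v \<le> 0"
  obtains e where "0 < e" "x + e *\<^sub>R v \<in> P"
proof -
  obtain F where fin: "finite F" and seq: "P = affine hull P \<inter> \<Inter>F"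
     and faces: "\<And>h. h \<in> F \<Longrightarrow> \<exists>a b. a \<noteq> 0 \<and> h = {x. a \<bullet> x \<le> b}"
     and min: "\<And>F'. F' \<subset> F \<Longrightarrow> P \<subset> (affine hull P) \<inter> \<Inter>F'"
    using assms(1) by (simp add: polyhedron_Int_affine_minimal) meson
  then obtain a b where ab: "\<And>h. h \<in> F \<Longrightarrow> a h \<noteq> 0 \<and> h = {x. a h \<bullet> x \<le> b h}"
    by metis
  have hull: "affine hull P = UNIV" using full by (simp add: aff_dim_eq_full)
  have "\<forall>\<^sub>F e in at_right 0. x + e *\<^sub>R v \<in> h" if h: "h \<in> F" for h
  proof (cases "a h \<bullet> x = b h")
    case True
    have G: "P \<inter> {x. a h \<bullet> x = b h} facet_of P"
      using facet_of_polyhedron_explicit[OF fin seq ab min, of "P \<inter> {x. a h \<bullet> x = b h}"] h by blast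
    have Ph: "P \<subseteq> {x. a h \<bullet> x \<le> b h}" using seq h ab by blast
    obtain n e where n: "n \<noteq> 0" "P \<subseteq> {x. n \<bullet> x \<le> e}" "P \<inter> {x. a h \<bullet> x = b h} \<subseteq> {x. n \<bullet> x = e}" "n \<bullet> v \<le> 0"
      using dir[OF G] x True by blast
    have sub: "{x. n \<bullet> x \<le> e} \<subseteq> {x. a h \<bullet> x \<le> b h}"
      using ab[OF h] by (intro facet_halfspace_unique[OF G full n(1-3) _ Ph]) auto
    have "x + r *\<^sub>R v \<in> h" if "0 < r" for r
    proof -
      have "n \<bullet> x \<le> e" using n x by blast
      moreover have "r * (n \<bullet> v) \<le> 0" using n that by (simp add: mult_nonneg_nonpos)
      ultimately have "n \<bullet> (x + r *\<^sub>R v) \<le> e" by (simp add: inner_add_right)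
      then have "x + r *\<^sub>R v \<in> {x. a h \<bullet> x \<le> b h}" using sub by blast
      then show ?thesis using ab[OF h] by simp
    qed
    then show ?thesis using eventually_at_right_less[of "0::real"] by (auto elim: eventually_mono)
  next
    case False
    have "x \<in> h" using x seq h by blast
    then have "x \<in> {x. a h \<bullet> x \<le> b h}" using ab[OF h] by simp
    then have "a h \<bullet> x < b h" using False by simp
    moreover have "((\<lambda>e. a h \<bullet> (x + e *\<^sub>R v)) \<longlongrightarrow> a h \<bullet> (x + 0 *\<^sub>R v)) (at_right 0)"
      by (intro tendsto_intros)
    ultimately have "\<forall>\<^sub>F e in at_right 0. a h \<bullet> (x + e *\<^sub>R v) < b h"
      by (auto dest: order_tendstoD(2))
    then have "\<forall>\<^sub>F e in at_right 0. x + e *\<^sub>R v \<in> {x. a h \<bullet> x \<le> b h}"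
      by (rule eventually_mono) simp
    then show ?thesis using ab[OF h] by simp
  qed
  then have "\<forall>\<^sub>F e in at_right 0. \<forall>h\<in>F. x + e *\<^sub>R v \<in> h" by (simp add: eventually_ball_finite fin)
  then have "\<forall>\<^sub>F e in at_right 0. 0 < e \<and> (\<forall>h\<in>F. x + e *\<^sub>R v \<in> h)"
    using eventually_at_right_less[of "0::real"] by eventually_elim simp
  then obtain e where "0 < e" "\<forall>h\<in>F. x + e *\<^sub>R v \<in> h"
    using eventually_happens[of _ "at_right (0::real)"] by auto
  then show ?thesis using that seq hull by blast
qed

lemma (in frame) coords_exist:
  obtains x where "\<And>k. k \<in> {1..d} \<Longrightarrow> c k x = t k"
proof
  fix j assume j: "j \<in> {1..d}"
  have "c j (w + (\<Sum>k\<in>{1..d}. t k *\<^sub>R (y k - w))) = (\<Sum>k\<in>{1..d}. t k * (if j = k then 1 else 0))"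
    using j by (simp add: c_def inner_sum_right dual)
  also have "\<dots> = t j" using j by (simp add: if_distrib cong: if_cong)
  finally show "c j (w + (\<Sum>k\<in>{1..d}. t k *\<^sub>R (y k - w))) = t j" .
qed

text \<open>The situation after normalization. \<open>facets1\<close> and \<open>simplicial2\<close>
  restate in coordinates the simplicity of the first and the simpliciality of the second polytope,
  so that the study of faces below needs no dimension count.\<close>

locale core = corner d w y a R2
  for d :: nat and w :: "'a::euclidean_space" and y a :: "nat \<Rightarrow> 'a" and R2 :: "'a set" +
  fixes R1 :: "'a set" and i :: nat
  assumes dim: "DIM('a) = d" and i: "i < d"
    and poly2: "polytope R2" and y_ext: "\<And>k. k \<in> {1..d} \<Longrightarrow> y k extreme_point_of R2"
    and poly1: "polytope R1" and full1: "aff_dim R1 = int d"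
    and nonneg1: "\<And>k x. k \<in> {1..d} \<Longrightarrow> x \<in> R1 \<Longrightarrow> 0 \<le> c k x"
    and s_le1: "\<And>x. x \<in> R1 \<Longrightarrow> s x \<le> 1"
    and y_in1: "\<And>k. k \<in> {1..d} \<Longrightarrow> y k \<in> R1"
    and facets1: "\<And>S G. S \<subseteq> {1..d} \<Longrightarrow> card S \<le> i \<Longrightarrow> G facet_of R1 \<Longrightarrow> \<forall>k\<in>{1..d} - S. y k \<in> G \<Longrightarrow>
      G = {x\<in>R1. s x = 1} \<or> (\<exists>k\<in>S. G = {x\<in>R1. c k x = 0})"
    and simplicial2: "\<And>S x. S \<subseteq> {1..d} \<Longrightarrow> i \<le> card S \<Longrightarrow> x \<in> corner_face S \<Longrightarrow> s x \<le> 1"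
begin

definition Q :: "'a set" where "Q = R1 \<union> convex hull (vertices R2 - {w})"

abbreviation F :: "'a set" where "F \<equiv> convex hull (y ` {1..d})"

lemma d_pos: "1 \<le> d" using i by simp

lemma convex1: "convex R1" using poly1 polytope_imp_convex by blast

lemma F_iff: "x \<in> F \<longleftrightarrow> (\<forall>k\<in>{1..d}. 0 \<le> c k x) \<and> s x = 1"
  using hull_y[OF order_refl] by auto

lemma F_sub1: "F \<subseteq> R1"
  by (rule hull_minimal) (use y_in1 convex1 in auto)

lemma F_iff1: "x \<in> R1 \<Longrightarrow> x \<in> F \<longleftrightarrow> s x = 1"
  using F_iff nonneg1 by blast

lemma F_iff2: "x \<in> R2 \<Longrightarrow> x \<in> F \<longleftrightarrow> s x = 1"
  using F_iff nonneg by blast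

lemma sub12: "R1 \<subseteq> R2"
  by (rule subsetI, rule in_convex[OF convex w_in]) (auto simp: y_in nonneg1 s_le1)

lemma s_ge_if_face: "T face_of R2 \<Longrightarrow> w \<notin> T \<Longrightarrow> x \<in> T \<Longrightarrow> 1 \<le> s x"
  using w_in_face by force

lemma convex_upper: "convex {x\<in>R2. 1 \<le> s x}"
proof -
  have "{x\<in>R2. 1 \<le> s x} = R2 \<inter> {x. (\<Sum>k\<in>{1..d}. a k) \<bullet> x \<ge> 1 + (\<Sum>k\<in>{1..d}. a k) \<bullet> w}"
    by (auto simp: s_inner)
  then show ?thesis using convex_Int[OF convex convex_halfspace_ge] by simp
qed

text \<open>A vertex other than \<open>w\<close> is a face avoiding \<open>w\<close>, hence has
  \<open>s \<ge> 1\<close>. Conversely, a point of \<open>R2\<close> at level at least 1 lies on a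
  segment from \<open>w\<close> to some \<open>b\<close> in the hull, and the part of that segment
  above level 1 starts in \<open>F\<close>, which is in the hull.\<close>

lemma hull_vertices: "convex hull (vertices R2 - {w}) = {x\<in>R2. 1 \<le> s x}" (is "?K = ?U")
proof
  have "vertices R2 - {w} \<subseteq> ?U"
  proof
    fix x assume "x \<in> vertices R2 - {w}"
    then have "{x} face_of R2" "x \<noteq> w" by (simp_all add: vertices_def face_of_singleton)
    then show "x \<in> ?U" using s_ge_if_face[of "{x}" x] face_of_imp_subset by blast
  qed
  then show "?K \<subseteq> ?U" using convex_upper by (rule hull_minimal)
  show "?U \<subseteq> ?K"
  proof
    fix x assume x: "x \<in> ?U"
    have yK: "y k \<in> ?K" if "k \<in> {1..d}" for k
      using y_ext[OF that] w_notin_y[OF that] by (auto simp: vertices_def intro: hull_inc)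
    then have FK: "F \<subseteq> ?K" by (intro hull_minimal) auto
    have "{1..d} \<noteq> {}" using d_pos by simp
    then have ne: "vertices R2 - {w} \<noteq> {}" using yK convex_hull_empty by fastforce
    have "R2 = convex hull (vertices R2)"
      unfolding vertices_def by (rule Krein_Milman_Minkowski) (use poly2 convex polytope_imp_compact in auto)
    also have "\<dots> \<subseteq> convex hull (insert w (vertices R2 - {w}))" by (rule hull_mono) auto
    finally have "x \<in> convex hull (insert w (vertices R2 - {w}))" using x by blast
    then obtain u v b where uv: "0 \<le> u" "0 \<le> v" "u + v = 1" "b \<in> ?K" "x = u *\<^sub>R w + v *\<^sub>R b"
      unfolding convex_hull_insert[OF ne] by blast
    have sb: "1 \<le> s b" "b \<in> R2" using uv(4) \<open>?K \<subseteq> ?U\<close> by auto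
    have sx: "s x = v * s b" using uv by (simp add: s_convex)
    \<comment> \<open>The point where the segment from \<open>w\<close> to \<open>b\<close> meets
      \<open>s = 1\<close>.\<close>
    define q where "q = w + (1 / s b) *\<^sub>R (b - w)"
    have sq: "s q = 1" using sb by (simp add: q_def s_line)
    have "c k q \<ge> 0" if "k \<in> {1..d}" for k
      using sb nonneg[OF that] by (simp add: q_def c_line)
    then have "q \<in> ?K" using sq F_iff FK by blast
    have v1: "1 / s b \<le> v" using sx x sb by (simp add: field_simps)
    have v2: "v \<le> 1" using uv by simp
    show "x \<in> ?K"
    proof (cases "s b = 1")
      case True
      then have "v = 1" "u = 0" using v1 v2 uv by auto
      then show ?thesis using uv by simp
    next
      case False
      \<comment> \<open>Position of \<open>x\<close> between \<open>b\<close> (parameter 1) and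
        \<open>q\<close> (parameter \<open>1 / s b\<close>): \<open>t\<close> solves
        \<open>v = (1 - t) + t / s b\<close>.\<close>
      define t where "t = (1 - v) / (1 - 1 / s b)"
      have pos: "0 < 1 - 1 / s b" using False sb by (simp add: field_simps)
      have t: "0 \<le> t" "t \<le> 1" using pos v1 v2 unfolding t_def by (intro divide_nonneg_pos, simp_all add: divide_le_eq_1)
      have tv: "v = (1 - t) + t / s b"
      proof -
        have "1 - 1 / s b \<noteq> 0" using pos by linarith
        then have "t * (1 - 1 / s b) = 1 - v" using nonzero_eq_divide_eq t_def by blast
        then show ?thesis by (simp add: right_diff_distrib)
      qed
      have "x = w + v *\<^sub>R (b - w)"
      proof -
        have "u = 1 - v" using uv by simp
        then show ?thesis unfolding uv(5) \<open>u = 1 - v\<close> by (simp add: algebra_simps)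
      qed
      also have "\<dots> = (1 - t) *\<^sub>R b + t *\<^sub>R q"
        unfolding tv q_def by (simp add: algebra_simps)
      finally show ?thesis
        using convexD_alt[OF convex_convex_hull uv(4) \<open>q \<in> ?K\<close> t] by simp
    qed
  qed
qed

lemma Q_eq: "Q = R1 \<union> {x\<in>R2. 1 \<le> s x}"
  by (simp add: Q_def hull_vertices)

lemma Q_sub2: "Q \<subseteq> R2" and sub1_Q: "R1 \<subseteq> Q"
  using sub12 by (auto simp: Q_eq)

lemma Q_low: "x \<in> Q \<Longrightarrow> s x \<le> 1 \<Longrightarrow> x \<in> R1"
  using F_iff2[of x] F_sub1 by (auto simp: Q_eq)

text \<open>Where the segment crosses \<open>s = 1\<close> it is in \<open>F\<close>, because
  \<open>R2\<close> has no other points at that level. Up to the crossing it stays in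
  \<open>R1\<close> by convexity, afterwards in the upper part of \<open>R2\<close>.\<close>

lemma Q_mixed:
  assumes "x \<in> R1" "z \<in> R2" "1 \<le> s z" "0 \<le> t" "t \<le> 1"
  shows "(1 - t) *\<^sub>R x + t *\<^sub>R z \<in> Q"
proof -
  define p where "p = (1 - t) *\<^sub>R x + t *\<^sub>R z"
  have p2: "p \<in> R2" unfolding p_def using assms sub12 by (intro convexD_alt[OF convex]) auto
  have p: "p = x + t *\<^sub>R (z - x)" by (simp add: p_def algebra_simps)
  have sp: "s p = s x + t * (s z - s x)" by (simp add: p s_line)
  show "(1 - t) *\<^sub>R x + t *\<^sub>R z \<in> Q"
  proof (cases "1 \<le> s p")
    case True
    then show ?thesis using p2 by (simp add: Q_eq flip: p_def)
  next
    case False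
    have "s x < 1"
    proof (rule ccontr)
      assume "\<not> s x < 1"
      then have "(1 - t) * 1 + t * 1 \<le> (1 - t) * s x + t * s z"
        using assms by (intro add_mono mult_left_mono) auto
      then show False using False by (simp add: sp algebra_simps)
    qed
    \<comment> \<open>Parameter of the crossing with \<open>s = 1\<close>.\<close>
    define r where "r = (1 - s x) / (s z - s x)"
    have r: "0 < r" "r \<le> 1" using \<open>s x < 1\<close> assms by (auto simp: r_def field_simps)
    define q where "q = x + r *\<^sub>R (z - x)"
    have "q = (1 - r) *\<^sub>R x + r *\<^sub>R z" by (simp add: q_def algebra_simps)
    then have q2: "q \<in> R2" using assms sub12 r convexD_alt[OF convex, of x z r] by auto
    have "s q = 1" using \<open>s x < 1\<close> assms by (simp add: q_def s_line r_def)
    then have q1: "q \<in> R1" using q2 F_iff2 F_sub1 by blast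
    have "t * (s z - s x) < r * (s z - s x)"
      using False \<open>s x < 1\<close> assms by (simp add: sp r_def)
    then have tr: "t < r" using \<open>s x < 1\<close> assms by (simp add: mult_less_cancel_right)
    have "p = (1 - t / r) *\<^sub>R x + (t / r) *\<^sub>R q"
      using r by (simp add: p q_def algebra_simps)
    then have "p \<in> R1" using convexD_alt[OF convex1 assms(1) q1, of "t / r"] r tr assms by simp
    then show ?thesis using sub1_Q p_def by blast
  qed
qed

lemma convex_Q: "convex Q"
proof -
  have "(1 - t) *\<^sub>R x + t *\<^sub>R z \<in> Q" if xz: "x \<in> Q" "z \<in> Q" and t: "0 \<le> t" "t \<le> 1" for x z t
  proof -
    consider "x \<in> R1 \<and> z \<in> R1" | "x \<in> R1 \<and> z \<in> {x\<in>R2. 1 \<le> s x}" | "z \<in> R1 \<and> x \<in> {x\<in>R2. 1 \<le> s x}"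
      | "x \<in> {x\<in>R2. 1 \<le> s x} \<and> z \<in> {x\<in>R2. 1 \<le> s x}"
      using xz unfolding Q_eq by blast
    then show ?thesis
    proof cases
      case 1 then show ?thesis using convexD_alt[OF convex1 _ _ t] sub1_Q by blast
    next
      case 2 then show ?thesis using Q_mixed t by simp
    next
      case 3 then show ?thesis using Q_mixed[of z x "1 - t"] t by (simp add: add.commute)
    next
      case 4
      then have "(1 - t) *\<^sub>R x + t *\<^sub>R z \<in> {x\<in>R2. 1 \<le> s x}"
        using convexD_alt[OF convex_upper _ _ t] by blast
      then show ?thesis unfolding Q_eq by blast
    qed
  qed
  then show ?thesis unfolding convex_alt by blast
qed

text \<open>As \<open>x\<close> is a combination of the \<open>y k\<close> outside \<open>S\<close>
  with positive weights, a facet through \<open>x\<close> contains all of them. Then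
  \<open>facets1\<close> leaves \<open>s \<le> 1\<close> and \<open>c k \<ge> 0\<close> for
  \<open>k\<close> in \<open>S\<close> as the only constraints near \<open>x\<close>, and a short
  step towards \<open>p\<close> respects them.\<close>

lemma local_cone:
  assumes S: "S \<subseteq> {1..d}" "card S \<le> i" and x: "s x = 1" "\<And>k. k \<in> S \<Longrightarrow> c k x = 0"
      "\<And>k. k \<in> {1..d} - S \<Longrightarrow> 0 < c k x"
    and p: "s p \<le> 1" "\<And>k. k \<in> S \<Longrightarrow> 0 \<le> c k p"
  obtains e where "0 < e" "x + e *\<^sub>R (p - x) \<in> R1"
proof (rule facet_local)
  show "polyhedron R1" using poly1 polytope_imp_polyhedron by blast
  show "aff_dim R1 = DIM('a)" using full1 dim by simp
  have "\<forall>k\<in>{1..d}. 0 \<le> c k x"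
  proof
    fix k assume "k \<in> {1..d}" then show "0 \<le> c k x" using x(2)[of k] x(3)[of k] by (cases "k \<in> S") auto
  qed
  then have "x \<in> F" using x F_iff by blast
  then show xR: "x \<in> R1" using F_sub1 by blast
  fix G assume G: "G facet_of R1" "x \<in> G"
  obtain n b where nb: "n \<noteq> 0" "R1 \<subseteq> {x. n \<bullet> x \<le> b}" "G = R1 \<inter> {x. n \<bullet> x = b}"
    using facet_of_polyhedron[OF \<open>polyhedron R1\<close> G(1)] .
  have "\<forall>k\<in>{1..d} - S. y k \<in> G"
  proof
    fix k assume k: "k \<in> {1..d} - S"
    have le: "n \<bullet> y j - b \<le> 0" if "j \<in> {1..d}" for j using nb(2) y_in1[OF that] by force
    have xb: "n \<bullet> x = b" using nb(3) G(2) by blast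
    have "(\<Sum>j\<in>{1..d}. c j x * (n \<bullet> y j - b)) = 0"
      using affine_bary[of n x b] x(1) xb by simp
    then have "\<forall>j\<in>{1..d}. - (c j x * (n \<bullet> y j - b)) = 0"
      using le \<open>\<forall>k\<in>{1..d}. 0 \<le> c k x\<close>
      by (subst sum_nonneg_eq_0_iff[symmetric]) (auto simp: sum_negf mult_nonneg_nonpos)
    then have "c k x * (n \<bullet> y k - b) = 0" using k by auto
    then have "n \<bullet> y k = b" using x(3)[OF k] by simp
    then show "y k \<in> G" using nb(3) y_in1 k by blast
  qed
  then consider "G = {x\<in>R1. s x = 1}" | k where "k \<in> S" "G = {x\<in>R1. c k x = 0}"
    using facets1[OF S G(1)] by blast
  then show "\<exists>n b. n \<noteq> 0 \<and> R1 \<subseteq> {x. n \<bullet> x \<le> b} \<and> G \<subseteq> {x. n \<bullet> x = b} \<and> n \<bullet> (p - x) \<le> 0"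
  proof cases
    case 1
    let ?n = "\<Sum>k\<in>{1..d}. a k"
    note sn = s_inner
    have "?n \<noteq> 0" using sn[of x] x(1) by auto
    moreover have "R1 \<subseteq> {x. ?n \<bullet> x \<le> 1 + ?n \<bullet> w}" using s_le1 sn by fastforce
    moreover have "G \<subseteq> {x. ?n \<bullet> x = 1 + ?n \<bullet> w}" using 1 sn by auto
    moreover have "?n \<bullet> (p - x) \<le> 0" using sn[of p] sn[of x] p x by (simp add: inner_diff_right)
    ultimately show ?thesis by blast
  next
    case 2
    then have k: "k \<in> {1..d}" using S by blast
    have cn: "c k z = a k \<bullet> z - a k \<bullet> w" for z by (simp add: c_def inner_diff_right)
    have "- a k \<noteq> 0" using cn[of "y k"] c_y[OF k k] by auto
    moreover have "R1 \<subseteq> {x. - a k \<bullet> x \<le> - a k \<bullet> w}" using nonneg1[OF k] cn by fastforce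
    moreover have "G \<subseteq> {x. - a k \<bullet> x = - a k \<bullet> w}" using 2 cn by auto
    moreover have "- a k \<bullet> (p - x) \<le> 0" using cn[of p] cn[of x] p(2)[OF 2(1)] x(2)[OF 2(1)] by (simp add: inner_diff_right)
    ultimately show ?thesis by blast
  qed
qed

end

section \<open>Faces of the merged set\<close>

text \<open>The smallest face through \<open>x\<close> works: if \<open>x\<close> were on its
  relative boundary, one of its facets would be a smaller face through \<open>x\<close>.\<close>

lemma face_rel_interior_exists:
  fixes P :: "'a::euclidean_space set"
  assumes P: "polyhedron P" and x: "x \<in> P"
  obtains T where "T face_of P" "x \<in> rel_interior T"
proof -
  let ?T = "\<Inter>{T. T face_of P \<and> x \<in> T}"
  have face: "?T face_of P"
    using face_of_refl[OF polyhedron_imp_convex[OF P]] x by (intro face_of_Inter) auto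
  have "x \<in> ?T" by blast
  have pT: "polyhedron ?T" using face_of_polyhedron_polyhedron[OF P face] .
  have "x \<in> rel_interior ?T"
  proof (rule ccontr)
    assume "x \<notin> rel_interior ?T"
    then obtain G where G: "G facet_of ?T" "x \<in> G"
      using rel_boundary_of_polyhedron[OF pT] \<open>x \<in> ?T\<close> by blast
    then have "G face_of P" using face_of_trans[OF facet_of_imp_face_of face] by blast
    then have "?T \<subseteq> G" using G by blast
    then have "G = ?T" using facet_of_imp_subset[OF G(1)] by blast
    then show False using G facet_of_irrefl by metis
  qed
  with face show ?thesis by (rule that)
qed

lemma rel_interior_prolong:
  fixes T :: "'a::euclidean_space set"
  assumes "convex T" "x \<in> rel_interior T" "z \<in> T"
  obtains e where "0 < e" "x + e *\<^sub>R (x - z) \<in> T"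
proof -
  obtain e where e: "1 < e" "(1 - e) *\<^sub>R z + e *\<^sub>R x \<in> T"
    using convex_rel_interior_if2[OF assms(1,2)] hull_inc[OF assms(3)] by blast
  have "x + (e - 1) *\<^sub>R (x - z) = (1 - e) *\<^sub>R z + e *\<^sub>R x" by (simp add: algebra_simps)
  then show ?thesis using that[of "e - 1"] e by simp
qed

lemma in_open_segment_opposite:
  fixes x m :: "'a::real_vector"
  assumes "0 < e" "0 < f" "m \<noteq> 0"
  shows "x \<in> open_segment (x + e *\<^sub>R m) (x + f *\<^sub>R (- m))"
proof -
  define t where "t = e / (e + f)"
  have t: "0 < t" "t < 1" using assms by (auto simp: t_def)
  have "t * (e + f) = e" using assms by (simp add: t_def)
  then have "(1 - t) * e - t * f = 0" by (simp add: algebra_simps)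
  moreover have "(1 - t) *\<^sub>R (x + e *\<^sub>R m) + t *\<^sub>R (x + f *\<^sub>R (- m)) = x + ((1 - t) * e - t * f) *\<^sub>R m"
    by (simp only: scaleR_add_right scaleR_left_diff_distrib scaleR_scaleR scaleR_minus_right scaleR_one) simp
  ultimately have "x = (1 - t) *\<^sub>R (x + e *\<^sub>R m) + t *\<^sub>R (x + f *\<^sub>R (- m))" by simp
  moreover have "x + e *\<^sub>R m \<noteq> x + f *\<^sub>R (- m)"
  proof
    assume "x + e *\<^sub>R m = x + f *\<^sub>R (- m)"
    then have "(e + f) *\<^sub>R m = 0" by (simp add: scaleR_add_left eq_neg_iff_add_eq_0)
    then show False using assms by simp
  qed
  ultimately show ?thesis using t unfolding in_segment by blast
qed

lemma open_segment_prolong: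
  fixes x z :: "'a::real_vector"
  assumes "0 < e" "x \<noteq> z"
  shows "x \<in> open_segment z (x + e *\<^sub>R (x - z))"
proof -
  have "x + 1 *\<^sub>R (- (x - z)) = z" by simp
  then show ?thesis
    using in_open_segment_opposite[OF assms(1) zero_less_one, of "x - z" x] assms(2)
    by (simp only: open_segment_commute) simp
qed

context core begin

definition corner1 :: "nat set \<Rightarrow> 'a set" where "corner1 S = {x\<in>R1. \<forall>k\<in>S. c k x = 0}"

text \<open>\<open>M1\<close> and \<open>M2\<close> single out the faces that survive in \<open>\<L>(P\<^sub>1)\<^sup>-\<close> and \<open>\<L>(P\<^sub>2)\<^sup>-\<close>; the
  dimension bounds appear as cardinalities of vertex sets and of sets of facets at \<open>w\<close>.\<close>

definition M1 :: "'a set \<Rightarrow> bool" where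
  "M1 \<sigma> \<longleftrightarrow> \<sigma> face_of R1 \<and> (\<sigma> \<subseteq> F \<longrightarrow> (\<exists>S\<subseteq>{1..d}. card S \<le> d - i \<and> \<sigma> = convex hull (y ` S)))"

definition M2 :: "'a set \<Rightarrow> bool" where
  "M2 \<tau> \<longleftrightarrow> \<tau> face_of R2 \<and> (w \<in> \<tau> \<longrightarrow> (\<exists>S\<subseteq>{1..d}. card S \<le> i \<and> \<tau> = corner_face S))"

definition cl :: "'a set \<Rightarrow> 'a set" where "cl \<sigma> = \<Inter>{E. E face_of Q \<and> \<sigma> \<subseteq> E}"

lemma cl_face: "\<sigma> \<subseteq> Q \<Longrightarrow> cl \<sigma> face_of Q"
  unfolding cl_def using face_of_refl[OF convex_Q] by (intro face_of_Inter) auto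

lemma sub_cl: "\<sigma> \<subseteq> cl \<sigma>"
  unfolding cl_def by blast

lemma cl_least: "E face_of Q \<Longrightarrow> \<sigma> \<subseteq> E \<Longrightarrow> cl \<sigma> \<subseteq> E"
  unfolding cl_def by blast

lemma corner1_eq: "corner1 S = corner_face S \<inter> R1"
  using sub12 by (auto simp: corner1_def corner_face_def)

lemma card_compl: "S \<subseteq> {1..d} \<Longrightarrow> card ({1..d} - S) = d - card S"
  by (simp add: card_Diff_subset finite_subset)

lemma card_le_d: "S \<subseteq> {1..d} \<Longrightarrow> card S \<le> d"
  using card_mono[of "{1..d}" S] by simp

text \<open>A point of \<open>\<sigma>\<close> off \<open>F\<close> gives \<open>w\<close> positive
  weight while all \<open>y k\<close> have value at most \<open>b\<close>; so the value at
  \<open>w\<close> cannot be below \<open>b\<close>. Beyond \<open>s = 1\<close> the weight of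
  \<open>w\<close> is nonpositive, and the excess at \<open>w\<close> only lowers the values
  there.\<close>

lemma exposed_Q:
  assumes "\<sigma> face_of R1" "\<not> \<sigma> \<subseteq> F"
  obtains n b where "\<And>x. x \<in> Q \<Longrightarrow> n \<bullet> x \<le> b" "\<sigma> = R1 \<inter> {x. n \<bullet> x = b}" "b \<le> n \<bullet> w"
proof -
  have "\<sigma> exposed_face_of R1"
    using exposed_face_of_polyhedron[OF polytope_imp_polyhedron[OF poly1]] assms by blast
  then obtain n b where nb: "R1 \<subseteq> {x. n \<bullet> x \<le> b}" "\<sigma> = R1 \<inter> {x. n \<bullet> x = b}"
    unfolding exposed_face_of_def by blast
  have ny: "n \<bullet> y k - b \<le> 0" if "k \<in> {1..d}" for k using nb y_in1[OF that] by force
  obtain x where x: "x \<in> \<sigma>" "x \<notin> F" using assms by blast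
  have xR: "x \<in> R1" "n \<bullet> x = b" using x nb by auto
  have sx: "s x < 1" using s_le1[OF xR(1)] F_iff1[OF xR(1)] x by simp
  have sum_le: "(\<Sum>k\<in>{1..d}. c k z * (n \<bullet> y k - b)) \<le> 0" if "z \<in> R2" for z
    using ny nonneg that by (intro sum_nonpos mult_nonneg_nonpos) auto
  have w: "b \<le> n \<bullet> w"
  proof (rule ccontr)
    assume "\<not> b \<le> n \<bullet> w"
    then have "(1 - s x) * (n \<bullet> w - b) < 0" using sx by (simp add: mult_pos_neg)
    then show False using affine_bary[of n x b] xR sum_le[of x] sub12 by auto
  qed
  have "n \<bullet> x \<le> b" if "x \<in> Q" for x
  proof (cases "x \<in> R1")
    case True then show ?thesis using nb by blast
  next
    case False
    then have x2: "x \<in> R2" "1 \<le> s x" using that by (auto simp: Q_eq)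
    then have "(1 - s x) * (n \<bullet> w - b) \<le> 0" using w by (simp add: mult_nonpos_nonneg)
    then show ?thesis using affine_bary[of n x b] sum_le[OF x2(1)] by simp
  qed
  then show ?thesis using that nb w by blast
qed

text \<open>The corner on the complementary indices satisfies at least \<open>i\<close> equations,
  so simpliciality bounds \<open>s\<close> by 1 on it. The hyperplane \<open>s = 1\<close> then
  supports it and cuts out exactly this hull.\<close>

lemma y_face2:
  assumes "S \<subseteq> {1..d}" "card S \<le> d - i"
  shows "convex hull (y ` S) face_of R2"
proof -
  let ?T = "{1..d} - S"
  have "i \<le> card ?T" using card_compl[OF assms(1)] assms(2) i card_le_d[OF assms(1)] by simp
  then have le: "s x \<le> 1" if "x \<in> corner_face ?T" for x
    using simplicial2[of ?T x] that by simp
  let ?n = "\<Sum>k\<in>{1..d}. a k"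
  note sn = s_inner
  have cf: "corner_face ?T face_of R2" by (rule face_of_corner_face) auto
  have "corner_face ?T \<inter> {x. ?n \<bullet> x = 1 + ?n \<bullet> w} face_of corner_face ?T"
  proof (rule face_of_Int_supporting_hyperplane_le)
    show "convex (corner_face ?T)" using cf face_of_imp_convex by blast
    show "?n \<bullet> x \<le> 1 + ?n \<bullet> w" if "x \<in> corner_face ?T" for x using le[OF that] sn[of x] by simp
  qed
  moreover have "corner_face ?T \<inter> {x. ?n \<bullet> x = 1 + ?n \<bullet> w} = convex hull (y ` S)"
  proof (intro equalityI subsetI)
    fix x assume x: "x \<in> corner_face ?T \<inter> {x. ?n \<bullet> x = 1 + ?n \<bullet> w}"
    then have "s x = 1" using sn[of x] by simp
    then show "x \<in> convex hull (y ` S)"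
      using x nonneg assms by (auto simp: hull_y corner_face_def)
  next
    fix x assume x: "x \<in> convex hull (y ` S)"
    then have "x \<in> F" using hull_mono[of "y ` S" "y ` {1..d}"] assms by blast
    then have "x \<in> R2" using F_sub1 sub12 by blast
    then show "x \<in> corner_face ?T \<inter> {x. ?n \<bullet> x = 1 + ?n \<bullet> w}"
      using x assms sn[of x] by (auto simp: hull_y corner_face_def)
  qed
  ultimately show ?thesis using face_of_trans cf by simp
qed

lemma y_faceQ:
  assumes "S \<subseteq> {1..d}" "card S \<le> d - i"
  shows "convex hull (y ` S) face_of Q"
proof (rule face_of_subset[OF y_face2[OF assms] _ Q_sub2])
  show "convex hull (y ` S) \<subseteq> Q"
    using hull_mono[of "y ` S" "y ` {1..d}"] assms F_sub1 sub1_Q by blast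
qed

lemma F_face1: "F face_of R1"
proof -
  let ?n = "\<Sum>k\<in>{1..d}. a k"
  note sn = s_inner
  have "R1 \<inter> {x. ?n \<bullet> x = 1 + ?n \<bullet> w} face_of R1"
  proof (rule face_of_Int_supporting_hyperplane_le[OF convex1])
    show "?n \<bullet> x \<le> 1 + ?n \<bullet> w" if "x \<in> R1" for x using s_le1[OF that] sn[of x] by simp
  qed
  moreover have "R1 \<inter> {x. ?n \<bullet> x = 1 + ?n \<bullet> w} = F"
  proof (intro equalityI subsetI)
    fix x assume "x \<in> R1 \<inter> {x. ?n \<bullet> x = 1 + ?n \<bullet> w}"
    then show "x \<in> F" using F_iff1[of x] sn[of x] by simp
  next
    fix x assume "x \<in> F"
    then show "x \<in> R1 \<inter> {x. ?n \<bullet> x = 1 + ?n \<bullet> w}" using F_sub1 F_iff1[of x] sn[of x] by auto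
  qed
  ultimately show ?thesis by simp
qed

text \<open>Any face of \<open>Q\<close> with trace \<open>\<sigma>\<close> on \<open>R1\<close> is
  enough: \<open>\<sigma>\<close> itself if it lies in \<open>F\<close>, otherwise the face exposed
  by the functional of \<open>exposed_Q\<close>.\<close>

lemma cl_Int1:
  assumes "M1 \<sigma>"
  shows "cl \<sigma> \<inter> R1 = \<sigma>"
proof -
  have face: "\<sigma> face_of R1" using assms M1_def by blast
  obtain E where E: "E face_of Q" "E \<inter> R1 = \<sigma>"
  proof (cases "\<sigma> \<subseteq> F")
    case True
    then obtain S where S: "S \<subseteq> {1..d}" "card S \<le> d - i" "\<sigma> = convex hull (y ` S)"
      using assms M1_def by blast
    then show ?thesis using that[of \<sigma>] y_faceQ[OF S(1,2)] face_of_imp_subset[OF face] by blast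
  next
    case False
    obtain n b where nb: "\<And>x. x \<in> Q \<Longrightarrow> n \<bullet> x \<le> b" "\<sigma> = R1 \<inter> {x. n \<bullet> x = b}"
      using exposed_Q[OF face False] by blast
    have "Q \<inter> {x. n \<bullet> x = b} face_of Q"
      using nb(1) convex_Q by (intro face_of_Int_supporting_hyperplane_le)
    then show ?thesis using that nb(2) sub1_Q by blast
  qed
  then have "cl \<sigma> \<subseteq> E" using cl_least by blast
  then show ?thesis using E(2) sub_cl[of \<sigma>] face_of_imp_subset[OF face] by blast
qed

lemma cl_mono: "\<sigma> \<subseteq> \<sigma>' \<Longrightarrow> cl \<sigma> \<subseteq> cl \<sigma>'"
  unfolding cl_def by blast

lemma cl_subset_iff: "M1 \<sigma> \<Longrightarrow> M1 \<sigma>' \<Longrightarrow> cl \<sigma> \<subseteq> cl \<sigma>' \<longleftrightarrow> \<sigma> \<subseteq> \<sigma>'"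
  using cl_Int1[of \<sigma>] cl_Int1[of \<sigma>'] cl_mono[of \<sigma> \<sigma>'] by blast

lemma center_exists:
  assumes "S \<subseteq> {1..d}" "card S < d"
  obtains x where "s x = 1" "\<And>k. k \<in> S \<Longrightarrow> c k x = 0" "\<And>k. k \<in> {1..d} - S \<Longrightarrow> 0 < c k x"
    "x \<in> convex hull (y ` ({1..d} - S))"
proof -
  let ?m = "real (d - card S)"
  obtain x where x: "\<And>k. k \<in> {1..d} \<Longrightarrow> c k x = (if k \<in> S then 0 else 1 / ?m)"
    using coords_exist[of "\<lambda>k. if k \<in> S then 0 else 1 / ?m"] by blast
  have m: "?m > 0" using assms by simp
  have "s x = (\<Sum>k\<in>{1..d}. if k \<in> S then 0 else 1 / ?m)"
    unfolding s_def by (rule sum.cong[OF refl x])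
  also have "\<dots> = (\<Sum>k\<in>{1..d} - S. 1 / ?m)"
    using assms by (intro sum.mono_neutral_cong_right) auto
  also have "\<dots> = 1" using m assms card_compl by simp
  finally have sx: "s x = 1" .
  have pos: "0 < c k x" if "k \<in> {1..d} - S" for k using x[of k] that m by simp
  have zero: "c k x = 0" if "k \<in> S" for k using x[of k] that assms by auto
  have "\<forall>k\<in>{1..d}. 0 \<le> c k x" using x m by simp
  moreover have "{1..d} - ({1..d} - S) = S" using assms(1) by blast
  ultimately have "x \<in> convex hull (y ` ({1..d} - S))" using sx zero by (subst hull_y) simp_all
  with sx zero pos show ?thesis using that by blast
qed

text \<open>A short step from the barycenter of the complementary face towards \<open>w\<close> is
  allowed by \<open>local_cone\<close>. The point found witnesses that such a corner is not confined
  to \<open>F\<close>.\<close>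

lemma below_F:
  assumes "S \<subseteq> {1..d}" "card S \<le> i"
  obtains p where "p \<in> corner1 S" "s p < 1"
proof -
  obtain x where x: "s x = 1" "\<And>k. k \<in> S \<Longrightarrow> c k x = 0" "\<And>k. k \<in> {1..d} - S \<Longrightarrow> 0 < c k x"
    using center_exists[OF assms(1)] assms(2) i by (metis le_less_trans)
  obtain e where e: "0 < e" "x + e *\<^sub>R (w - x) \<in> R1"
    using local_cone[OF assms x, of w] by auto
  have "s (x + e *\<^sub>R (w - x)) < 1" using e x by (simp add: s_line)
  moreover have "c k (x + e *\<^sub>R (w - x)) = 0" if "k \<in> S" for k using x(2)[OF that] by (simp add: c_line)
  ultimately show ?thesis using that[of "x + e *\<^sub>R (w - x)"] e by (simp add: corner1_def)
qed

text \<open>A face avoiding \<open>w\<close> lies in \<open>Q\<close>, so intersecting loses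
  nothing. A surviving face at \<open>w\<close> keeps a point with \<open>s < 1\<close>, which
  forces \<open>w\<close> into the larger face as well; two corners are then compared by the
  \<open>y k\<close>, all of which lie in \<open>Q\<close>.\<close>

lemma face2_subset_iff:
  assumes "M2 \<tau>" "M2 \<tau>'"
  shows "\<tau> \<inter> Q \<subseteq> \<tau>' \<inter> Q \<longleftrightarrow> \<tau> \<subseteq> \<tau>'"
proof
  assume sub: "\<tau> \<inter> Q \<subseteq> \<tau>' \<inter> Q"
  have f: "\<tau> face_of R2" "\<tau>' face_of R2" using assms by (auto simp: M2_def)
  show "\<tau> \<subseteq> \<tau>'"
  proof (cases "w \<in> \<tau>")
    case False
    then have "\<tau> \<subseteq> Q" using s_ge_if_face[OF f(1)] face_of_imp_subset[OF f(1)] unfolding Q_eq by blast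
    then show ?thesis using sub by blast
  next
    case True
    then obtain S where S: "S \<subseteq> {1..d}" "card S \<le> i" "\<tau> = corner_face S"
      using assms M2_def by blast
    obtain p where p: "p \<in> corner1 S" "s p < 1" using below_F[OF S(1,2)] .
    then have "p \<in> \<tau>'" using sub S sub1_Q by (auto simp: corner1_eq)
    then have "w \<in> \<tau>'" using w_in_face[OF f(2)] p by blast
    then obtain T where T: "T \<subseteq> {1..d}" "\<tau>' = corner_face T" using face_at_w[OF f(2)] by blast
    have "T \<subseteq> S"
    proof
      fix k assume k: "k \<in> T"
      then have kd: "k \<in> {1..d}" using T by blast
      show "k \<in> S"
      proof (rule ccontr)
        assume "k \<notin> S"
        then have "y k \<in> \<tau> \<inter> Q" using y_in_corner_face[OF kd S(1)] S(3) y_in1[OF kd] sub1_Q by blast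
        then have "y k \<in> corner_face T" using sub T by blast
        then show False using y_in_corner_face[OF kd T(1)] k by blast
      qed
    qed
    then show ?thesis unfolding S(3) T(2) corner_face_def by blast
  qed
qed blast

text \<open>For \<open>z\<close> in the corner, a point \<open>g\<close> of \<open>corner1 S\<close>
  is found such that the segment from \<open>g\<close> to \<open>z\<close> has an inner point
  \<open>q\<close> that is again in \<open>corner1 S\<close>, hence in \<open>E\<close>. The face
  property at \<open>q\<close> gives \<open>z\<close>.\<close>

lemma corner_sub_face:
  assumes S: "S \<subseteq> {1..d}" "card S \<le> i" and E: "E face_of Q" "corner1 S \<subseteq> E"
  shows "corner_face S \<inter> Q \<subseteq> E"
proof
  fix z assume z: "z \<in> corner_face S \<inter> Q"
  then have cz: "c k z = 0" if "k \<in> S" for k using that by (simp add: corner_face_def)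
  obtain x where x: "s x = 1" "\<And>k. k \<in> S \<Longrightarrow> c k x = 0" "\<And>k. k \<in> {1..d} - S \<Longrightarrow> 0 < c k x"
    using center_exists[OF S(1)] S(2) i by (metis le_less_trans)
  \<comment> \<open>Going from the barycenter \<open>x\<close> towards \<open>p\<close> means going
    towards \<open>w\<close> and somewhat away from \<open>z\<close>. The value of \<open>r\<close>
    solves \<open>r + r * |s z| = 1\<close>, which bounds \<open>s p\<close> by 1.\<close>
  define r where "r = 1 / (1 + \<bar>s z\<bar>)"
  have r: "0 < r" "r * \<bar>s z\<bar> \<le> 1" by (auto simp: r_def field_simps)
  define p where "p = w - r *\<^sub>R (z - x)"
  have p': "p = w + (- r) *\<^sub>R (z - x)" by (simp add: p_def)
  have "s p \<le> 1"
  proof -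
    have "s p = r - r * s z" unfolding p' s_line using x by (simp add: right_diff_distrib)
    moreover have "- (r * s z) \<le> r * \<bar>s z\<bar>"
      using r by (simp add: abs_if)
    moreover have "r + r * \<bar>s z\<bar> = 1" by (simp add: r_def field_simps add_nonneg_eq_0_iff)
    ultimately show ?thesis by simp
  qed
  moreover have cp: "c k p = 0" if "k \<in> S" for k unfolding p' c_line using cz[OF that] x(2)[OF that] by simp
  ultimately obtain e where e: "0 < e" "x + e *\<^sub>R (p - x) \<in> R1"
    using local_cone[OF S x, of p] by auto
  define g where "g = x + e *\<^sub>R (p - x)"
  \<comment> \<open>Solves \<open>(1 - t) * (e * r) = t\<close>, so that the components along
    \<open>z - x\<close> cancel and \<open>q\<close> lies on the ray from \<open>x\<close> to
    \<open>w\<close>, with \<open>s q = 1 - (1 - t) * e\<close>.\<close>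
  define t where "t = e * r / (1 + e * r)"
  have er: "0 < e * r" using e r by simp
  then have t: "0 < t" "t < 1" "(1 - t) * (e * r) = t" by (auto simp: t_def field_simps)
  define q where "q = (1 - t) *\<^sub>R g + t *\<^sub>R z"
  have gS: "g \<in> corner1 S" using e cp x(2) by (auto simp: corner1_def g_def c_line)
  have gQ: "g \<in> Q" using e sub1_Q by (auto simp: g_def)
  have zQ: "z \<in> Q" using z by blast
  have qQ: "q \<in> Q" unfolding q_def using convexD_alt[OF convex_Q gQ zQ] t by simp
  have sg: "s g = 1 - e + e * r - e * r * s z"
    unfolding g_def p' s_line using x by (simp add: algebra_simps)
  have "s q = (1 - t) * s g + t * s z" by (simp add: q_def s_convex)
  also have "\<dots> = (1 - t) * (1 - e) + (1 - t) * (e * r) - (1 - t) * (e * r) * s z + t * s z"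
    unfolding sg by (simp add: algebra_simps)
  also have "\<dots> = 1 - (1 - t) * e" unfolding t(3) by (simp add: algebra_simps)
  finally have "s q \<le> 1" using t e by simp
  then have "q \<in> R1" using Q_low[OF qQ] by simp
  moreover have "c k q = 0" if "k \<in> S" for k
    using gS cz[OF that] that by (simp add: q_def c_convex corner1_def)
  ultimately have qE: "q \<in> E" using E(2) by (auto simp: corner1_def)
  show "z \<in> E"
  proof (cases "g = z")
    case True then show ?thesis using gS E by blast
  next
    case False
    then have "q \<in> open_segment g z" unfolding in_segment q_def using t by blast
    then show ?thesis using face_ofD[OF E(1) _ gQ zQ qE] by blast
  qed
qed

lemma corner_face_Q: "S \<subseteq> {1..d} \<Longrightarrow> corner_face S \<inter> Q face_of Q"
  using face_of_slice[OF face_of_corner_face convex_Q] Q_sub2 by (metis Int_absorb1)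

lemma cl_corner1:
  assumes S: "S \<subseteq> {1..d}" "card S \<le> i"
  shows "cl (corner1 S) = corner_face S \<inter> Q"
proof
  show "cl (corner1 S) \<subseteq> corner_face S \<inter> Q"
    using sub1_Q by (intro cl_least[OF corner_face_Q[OF S(1)]]) (auto simp: corner1_eq)
  show "corner_face S \<inter> Q \<subseteq> cl (corner1 S)"
    using corner_sub_face[OF S cl_face sub_cl] sub1_Q by (auto simp: corner1_def)
qed

lemma cl_y: "S \<subseteq> {1..d} \<Longrightarrow> card S \<le> d - i \<Longrightarrow> cl (convex hull (y ` S)) = convex hull (y ` S)"
  using cl_least[OF y_faceQ order_refl] sub_cl by blast

text \<open>Intersecting with \<open>R1\<close> gives \<open>\<sigma> = \<tau> \<inter> R1\<close>.
  If \<open>w\<close> is in \<open>\<tau>\<close>, this is a corner. Otherwise \<open>\<tau>\<close>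
  stays in \<open>s \<ge> 1\<close>, so \<open>\<sigma>\<close> lies in \<open>F\<close> and, being
  small, is already a face of \<open>Q\<close>.\<close>

lemma cl_eq_imp_glued:
  assumes "M1 \<sigma>" "M2 \<tau>" "cl \<sigma> = \<tau> \<inter> Q"
  shows "(\<exists>S\<subseteq>{1..d}. card S \<le> d - i \<and> \<sigma> = convex hull (y ` S) \<and> \<tau> = convex hull (y ` S)) \<or>
    (\<exists>S\<subseteq>{1..d}. card S \<le> i \<and> \<sigma> = corner1 S \<and> \<tau> = corner_face S)"
proof -
  have \<tau>: "\<tau> face_of R2" using assms by (simp add: M2_def)
  have \<sigma>: "\<sigma> = \<tau> \<inter> R1" using cl_Int1[OF assms(1)] assms(3) sub1_Q by blast
  show ?thesis
  proof (cases "w \<in> \<tau>")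
    case True
    then obtain S where "S \<subseteq> {1..d}" "card S \<le> i" "\<tau> = corner_face S" using assms M2_def by blast
    then show ?thesis using \<sigma> corner1_eq by blast
  next
    case False
    have up: "1 \<le> s x" if "x \<in> \<tau>" for x using s_ge_if_face[OF \<tau> False that] .
    then have \<tau>Q: "\<tau> \<subseteq> Q" using face_of_imp_subset[OF \<tau>] unfolding Q_eq by blast
    have "\<sigma> \<subseteq> F"
    proof
      fix x assume "x \<in> \<sigma>"
      then have "x \<in> R1" "1 \<le> s x" using up \<sigma> by auto
      then show "x \<in> F" using F_iff1 s_le1 by force
    qed
    then obtain S where S: "S \<subseteq> {1..d}" "card S \<le> d - i" "\<sigma> = convex hull (y ` S)"
      using assms(1) M1_def by blast
    then have "\<tau> = \<sigma>" using cl_y[OF S(1,2)] assms(3) \<tau>Q by blast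
    then show ?thesis using S by blast
  qed
qed

text \<open>A point \<open>z\<close> of \<open>E\<close> above level 1 is joined to \<open>p\<close>
  by a segment crossing \<open>s = 1\<close> in \<open>E \<inter> R1\<close>. The closure is a face
  containing that inner point, hence also the end \<open>z\<close>.\<close>

lemma cl_of_low:
  assumes E: "E face_of Q" "p \<in> E" "s p < 1"
  shows "E = cl (E \<inter> R1)"
proof
  show "cl (E \<inter> R1) \<subseteq> E" using cl_least[OF E(1)] by blast
  show "E \<subseteq> cl (E \<inter> R1)"
  proof
    fix z assume z: "z \<in> E"
    have sub: "E \<subseteq> Q" using E face_of_imp_subset by blast
    show "z \<in> cl (E \<inter> R1)"
    proof (cases "s z \<le> 1")
      case True
      then show ?thesis using Q_low z sub sub_cl by blast
    next
      case False
      define r where "r = (1 - s p) / (s z - s p)"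
      have r: "0 < r" "r < 1" using E(3) False by (auto simp: r_def field_simps)
      define q where "q = p + r *\<^sub>R (z - p)"
      have q': "q = (1 - r) *\<^sub>R p + r *\<^sub>R z" by (simp add: q_def algebra_simps)
      have "q \<in> E" unfolding q' using face_of_imp_convex[OF E(1)] E(2) z r by (intro convexD_alt) auto
      moreover have "s q = 1" using E(3) False by (simp add: q_def s_line r_def)
      ultimately have "q \<in> E \<inter> R1" using Q_low sub by auto
      then have qc: "q \<in> cl (E \<inter> R1)" using sub_cl by blast
      have "p \<noteq> z" using E(3) False by auto
      then have "q \<in> open_segment p z" using r q' unfolding in_segment by blast
      moreover have "p \<in> Q" "z \<in> Q" using sub z E(2) by auto
      ultimately show ?thesis using face_ofD[OF cl_face _ _ _ qc] sub1_Q by blast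
    qed
  qed
qed

text \<open>The point \<open>p\<close> keeps the trace from lying in \<open>F\<close>, so the
  cardinality condition in \<open>M1\<close> is void.\<close>

lemma low_is_cl:
  assumes E: "E face_of Q" "p \<in> E" "s p < 1"
  shows "M1 (E \<inter> R1)"
proof -
  have "E \<inter> R1 face_of R1" using face_of_slice[OF E(1) convex1] sub1_Q by (metis Int_absorb1)
  moreover have "p \<in> E \<inter> R1" using E face_of_imp_subset[OF E(1)] Q_low by auto
  moreover have "p \<notin> F" using E F_iff by auto
  ultimately show ?thesis unfolding M1_def by blast
qed

text \<open>\<open>E\<close> is compared with the face \<open>T\<close> of \<open>R2\<close> whose
  relative interior contains a relative interior point \<open>x\<close> of \<open>E\<close>. If
  \<open>T\<close> avoids \<open>w\<close>, it lies in \<open>Q\<close>, so \<open>E\<close> is a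
  face of \<open>T\<close> and thus of \<open>R2\<close>. The case that \<open>T\<close> contains
  \<open>w\<close> is refuted.\<close>

lemma high_face2:
  assumes E: "E face_of Q" "\<And>x. x \<in> E \<Longrightarrow> 1 \<le> s x"
  shows "E face_of R2"
proof (cases "E = {}")
  case False
  have "convex E" using E face_of_imp_convex by blast
  then obtain x where x: "x \<in> rel_interior E" using False rel_interior_eq_empty by blast
  then have xE: "x \<in> E" using rel_interior_subset by blast
  have E2: "E \<subseteq> R2" using E face_of_imp_subset Q_sub2 by blast
  obtain T where T: "T face_of R2" "x \<in> rel_interior T"
    using face_rel_interior_exists[OF polytope_imp_polyhedron[OF poly2], of x] xE E2 by blast
  have xT: "x \<in> T" using T rel_interior_subset by blast
  have ET: "E \<subseteq> T" using subset_of_face_of[OF T(1) E2] x xT by blast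
  have "w \<notin> T"
  proof
    assume wT: "w \<in> T"
    obtain S where S: "S \<subseteq> {1..d}" "T = corner_face S" using face_at_w[OF T(1) wT] .
    \<comment> \<open>Past \<open>x\<close> on the line from \<open>w\<close> the level exceeds 1,
      so by simpliciality \<open>T\<close> satisfies fewer than \<open>i\<close> equations; hence
      \<open>T\<close> has a point of \<open>R1\<close> below \<open>F\<close>.\<close>
    obtain e where e: "0 < e" "x + e *\<^sub>R (x - w) \<in> T" using rel_interior_prolong[OF face_of_imp_convex[OF T(1)] T(2) wT] .
    have "e * 1 \<le> e * s x" using E(2)[OF xE] e(1) by (intro mult_left_mono) auto
    moreover have "s (x + e *\<^sub>R (x - w)) = s x + e * s x" by (simp add: s_line)
    ultimately have "1 < s (x + e *\<^sub>R (x - w))" using E(2)[OF xE] e(1) by linarith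
    then have "card S < i" using simplicial2[OF S(1), of "x + e *\<^sub>R (x - w)"] e S by force
    then obtain p where p: "p \<in> corner1 S" "s p < 1" using below_F[OF S(1)] by auto
    then have pT: "p \<in> T" using S by (simp add: corner1_eq)
    \<comment> \<open>Prolonging from \<open>p\<close> through \<open>x\<close> keeps
      \<open>s \<ge> 1\<close> and so stays in \<open>Q\<close>. Thus \<open>x\<close> is inside a
      segment of \<open>Q\<close> ending at \<open>p\<close>, and \<open>E\<close> would have to
      contain \<open>p\<close>.\<close>
    obtain r where r: "0 < r" "x + r *\<^sub>R (x - p) \<in> T" using rel_interior_prolong[OF face_of_imp_convex[OF T(1)] T(2) pT] .
    have "0 < r * (s x - s p)" using E(2)[OF xE] p r by simp
    then have "1 \<le> s (x + r *\<^sub>R (x - p))" using E(2)[OF xE] by (simp add: s_line)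
    then have zQ: "x + r *\<^sub>R (x - p) \<in> Q" using r face_of_imp_subset[OF T(1)] by (auto simp: Q_eq)
    have pQ: "p \<in> Q" using p sub1_Q by (auto simp: corner1_def)
    have "x \<noteq> p" using E(2)[OF xE] p by auto
    then have "p \<in> E" using face_ofD[OF E(1) open_segment_prolong[OF r(1)] pQ zQ xE] by blast
    then show False using E(2) p by force
  qed
  then have "T \<subseteq> Q" using s_ge_if_face[OF T(1)] face_of_imp_subset[OF T(1)] unfolding Q_eq by blast
  then show ?thesis using face_of_trans[OF face_of_subset[OF E(1) ET] T(1)] by blast
qed auto

lemma high_M2:
  assumes E: "E face_of Q" "\<And>x. x \<in> E \<Longrightarrow> 1 \<le> s x"
  shows "M2 E" "E = E \<inter> Q"
proof -
  have "w \<notin> E" using E(2)[of w] by auto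
  then show "M2 E" using high_face2[OF assms] by (simp add: M2_def)
  show "E = E \<inter> Q" using E face_of_imp_subset by blast
qed

lemma surj:
  assumes "E face_of Q"
  shows "(\<exists>\<sigma>. M1 \<sigma> \<and> E = cl \<sigma>) \<or> (\<exists>\<tau>. M2 \<tau> \<and> E = \<tau> \<inter> Q)"
proof (cases "\<exists>p\<in>E. s p < 1")
  case True
  then show ?thesis using cl_of_low[OF assms] low_is_cl[OF assms] by blast
next
  case False
  then have "1 \<le> s x" if "x \<in> E" for x using that by force
  then show ?thesis using high_M2[OF assms] by blast
qed

text \<open>If \<open>E\<close> does not come from a face of the second polytope, then \<open>D\<close> is a face of the
  simplex \<open>F\<close>, of dimension less than \<open>d - i\<close>.\<close>

lemma comparable_same_side:
  assumes D: "D face_of Q" "\<And>x. x \<in> D \<Longrightarrow> 1 \<le> s x"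
    and E: "E face_of Q" "p \<in> E" "s p < 1" and DE: "D \<subseteq> E"
  shows "(\<exists>\<sigma>. M1 \<sigma> \<and> D = cl \<sigma>) \<or> (\<exists>\<tau>. M2 \<tau> \<and> E = \<tau> \<inter> Q)"
proof -
  let ?E = "E \<inter> R1"
  have M1: "M1 ?E" and clE: "E = cl ?E" using low_is_cl[OF E] cl_of_low[OF E] by auto
  have EQ: "E \<subseteq> Q" using E face_of_imp_subset by blast
  have pE: "p \<in> ?E" using E EQ Q_low by auto
  have "p \<notin> F" using E F_iff by auto
  then have "\<not> ?E \<subseteq> F" using pE by blast
  then obtain n b where nb: "\<And>x. x \<in> Q \<Longrightarrow> n \<bullet> x \<le> b" "?E = R1 \<inter> {x. n \<bullet> x = b}" "b \<le> n \<bullet> w"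
    using exposed_Q M1 unfolding M1_def by metis
  let ?E' = "Q \<inter> {x. n \<bullet> x = b}"
  have faceE': "?E' face_of Q" using nb(1) convex_Q by (intro face_of_Int_supporting_hyperplane_le)
  have "?E' \<inter> R1 = ?E" using nb(2) sub1_Q by blast
  moreover have "p \<in> ?E'" using pE nb(2) sub1_Q by blast
  ultimately have E_eq: "E = ?E'" using cl_of_low[OF faceE' _ E(3)] clE by metis
  have ny: "n \<bullet> y k - b \<le> 0" if "k \<in> {1..d}" for k using nb(1) y_in1[OF that] sub1_Q by force
  \<comment> \<open>Common end of two cases below: with \<open>s \<le> 1\<close> on
    \<open>D\<close>, it is a face of the simplex \<open>F\<close>, and the bound on its number of
    vertices makes it survive in the first polytope.\<close>
  have in_F: ?thesis if small: "\<And>R. R \<subseteq> {1..d} \<Longrightarrow> D = convex hull (y ` R) \<Longrightarrow> card R \<le> d - i"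
    and le: "\<And>x. x \<in> D \<Longrightarrow> s x \<le> 1"
  proof -
    have "D \<subseteq> F"
    proof
      fix x assume x: "x \<in> D"
      then have "x \<in> R1" using Q_low D(1) face_of_imp_subset le by blast
      then show "x \<in> F" using F_iff1 D(2)[OF x] le[OF x] by simp
    qed
    moreover have "F \<subseteq> Q" using F_sub1 sub1_Q by blast
    ultimately have "D face_of F" using face_of_subset[OF D(1)] by blast
    then obtain R where R: "R \<subseteq> {1..d}" "D = convex hull (y ` R)"
      unfolding face_of_hull_image[OF affine_independent_y] by blast
    have "D face_of R1" using face_of_trans[OF \<open>D face_of F\<close> F_face1] .
    then have "M1 D" using R small[OF R] unfolding M1_def by blast
    then show ?thesis using cl_y[OF R(1) small[OF R]] R(2) by metis
  qed
  show ?thesis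
  proof (cases "n \<bullet> w = b")
    case False
    \<comment> \<open>Beyond \<open>s = 1\<close> the strict excess at \<open>w\<close> would push
      values below \<open>b\<close>, so \<open>D\<close> stays in \<open>s \<le> 1\<close>. With
      more than \<open>d - i\<close> vertices, a step from the barycenter of \<open>D\<close>
      towards \<open>w\<close> would stay in \<open>R1\<close> and exceed \<open>b\<close>.\<close>
    then have nw: "b < n \<bullet> w" using nb(3) by simp
    show ?thesis
    proof (rule in_F)
      fix x assume x: "x \<in> D"
      then have xE: "x \<in> Q" "n \<bullet> x = b" using DE E_eq by auto
      have "(\<Sum>k\<in>{1..d}. c k x * (n \<bullet> y k - b)) \<le> 0"
        using ny nonneg xE Q_sub2 by (intro sum_nonpos mult_nonneg_nonpos) auto
      then have "0 \<le> (1 - s x) * (n \<bullet> w - b)" using affine_bary[of n x b] xE by simp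
      then show "s x \<le> 1" using nw by (simp add: zero_le_mult_iff)
    next
      fix R assume R: "R \<subseteq> {1..d}" "D = convex hull (y ` R)"
      show "card R \<le> d - i"
      proof (rule ccontr)
        assume "\<not> card R \<le> d - i"
        then have card: "card ({1..d} - R) < i" using card_compl[OF R(1)] card_le_d[OF R(1)] by simp
        have RR: "{1..d} - ({1..d} - R) = R" using R by blast
        obtain x where x: "s x = 1" "\<And>k. k \<in> {1..d} - R \<Longrightarrow> c k x = 0"
          "\<And>k. k \<in> {1..d} - ({1..d} - R) \<Longrightarrow> 0 < c k x" "x \<in> convex hull (y ` ({1..d} - ({1..d} - R)))"
          using center_exists[of "{1..d} - R"] card i by (metis Diff_subset less_trans)
        have "x \<in> D" using x(4) RR R(2) by simp
        then have nx: "n \<bullet> x = b" using DE E_eq by blast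
        obtain e where e: "0 < e" "x + e *\<^sub>R (w - x) \<in> R1"
          using local_cone[of "{1..d} - R" x w] x(1-3) card by auto
        then have "n \<bullet> (x + e *\<^sub>R (w - x)) \<le> b" using nb(1) sub1_Q by blast
        then have "e * (n \<bullet> w - b) \<le> 0" using nx by (simp add: inner_add_right inner_diff_right)
        then show False using e nw by (simp add: mult_le_0_iff)
      qed
    qed
  next
    case True
    \<comment> \<open>With equality at \<open>w\<close>, the slack is a sum over the
      \<open>y k\<close> alone, so \<open>E\<close> is the trace of the corner on the indices with
      positive slack. At most \<open>i\<close> of them put \<open>E\<close> on the second side; more
      than \<open>i\<close> confine \<open>D\<close> to \<open>s \<le> 1\<close> and leave it fewer
      than \<open>d - i\<close> vertices.\<close>
    let ?S = "{k\<in>{1..d}. n \<bullet> y k < b}"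
    have S: "?S \<subseteq> {1..d}" by blast
    have E_corner: "E = corner_face ?S \<inter> Q"
    proof -
      have "n \<bullet> x = b \<longleftrightarrow> (\<forall>k\<in>?S. c k x = 0)" if "x \<in> Q" for x
      proof -
        have nn: "0 \<le> - (c k x * (n \<bullet> y k - b))" if "k \<in> {1..d}" for k
          using ny[OF that] nonneg[OF that] \<open>x \<in> Q\<close> Q_sub2 by (auto simp: mult_nonneg_nonpos)
        have "n \<bullet> x = b \<longleftrightarrow> (\<Sum>k\<in>{1..d}. - (c k x * (n \<bullet> y k - b))) = 0"
          using affine_bary[of n x b] True by (auto simp: sum_negf)
        also have "\<dots> \<longleftrightarrow> (\<forall>k\<in>{1..d}. - (c k x * (n \<bullet> y k - b)) = 0)"
          using nn by (intro sum_nonneg_eq_0_iff) auto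
        also have "\<dots> \<longleftrightarrow> (\<forall>k\<in>?S. c k x = 0)"
          using ny by fastforce
        finally show ?thesis .
      qed
      then show ?thesis using E_eq Q_sub2 by (auto simp: corner_face_def)
    qed
    show ?thesis
    proof (cases "card ?S \<le> i")
      case True
      then have "M2 (corner_face ?S)"
        using face_of_corner_face[OF S] S unfolding M2_def by blast
      then show ?thesis using E_corner by blast
    next
      case False
      have DS: "D \<subseteq> corner_face ?S" using DE E_corner by blast
      show ?thesis
      proof (rule in_F)
        show "s x \<le> 1" if "x \<in> D" for x
          using simplicial2[OF S] False DS that by force
        fix R assume R: "R \<subseteq> {1..d}" "D = convex hull (y ` R)"
        have "R \<subseteq> {1..d} - ?S"
        proof
          fix k assume k: "k \<in> R"
          then have kd: "k \<in> {1..d}" using R by blast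
          have "y k \<in> D" using k R(2) hull_inc[of "y k" "y ` R"] by simp
          then show "k \<in> {1..d} - ?S" using DS y_in_corner_face[OF kd S] kd by blast
        qed
        then have "card R \<le> d - card ?S" using card_mono[of "{1..d} - ?S" R] card_compl[OF S] by simp
        then show "card R \<le> d - i" using False by simp
      qed
    qed
  qed
qed

lemma same_side:
  assumes "D face_of Q" "E face_of Q" "D \<subseteq> E"
  shows "(\<exists>\<sigma>. M1 \<sigma> \<and> D = cl \<sigma>) \<and> (\<exists>\<sigma>. M1 \<sigma> \<and> E = cl \<sigma>) \<or>
    (\<exists>\<tau>. M2 \<tau> \<and> D = \<tau> \<inter> Q) \<and> (\<exists>\<tau>. M2 \<tau> \<and> E = \<tau> \<inter> Q)"
proof (cases "\<exists>p\<in>E. s p < 1")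
  case False
  then have "1 \<le> s x" if "x \<in> E" for x using that by force
  then show ?thesis using high_M2[OF assms(1)] high_M2[OF assms(2)] assms(3) by blast
next
  case True
  then obtain p where p: "p \<in> E" "s p < 1" by blast
  have E: "\<exists>\<sigma>. M1 \<sigma> \<and> E = cl \<sigma>" using cl_of_low[OF assms(2) p] low_is_cl[OF assms(2) p] by blast
  show ?thesis
  proof (cases "\<exists>p\<in>D. s p < 1")
    case True
    then show ?thesis using E cl_of_low[OF assms(1)] low_is_cl[OF assms(1)] by blast
  next
    case False
    then have D: "1 \<le> s x" if "x \<in> D" for x using that by force
    have "\<exists>\<tau>. M2 \<tau> \<and> D = \<tau> \<inter> Q" using high_M2[OF assms(1) D] by blast
    then show ?thesis using comparable_same_side[OF assms(1) D assms(2) p assms(3)] E by blast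
  qed
qed

end

section \<open>Order isomorphism of the quotient and projective invariance\<close>

text \<open>The classes are the fibres of the combined map: \<open>emb1\<close> and
  \<open>emb2\<close> make it injective on each summand, and \<open>glue\<close> joins elements of
  different summands with equal image. \<open>side\<close> supplies, for a comparable pair,
  representatives in one summand, as \<open>class_less\<close> requires.\<close>

lemma quotient_order_isomorphic:
  fixes f1 f2 :: "'a set \<Rightarrow> 'b set"
  assumes g: "\<And>x z. (x, z) \<in> g \<Longrightarrow> \<exists>p\<in>A1. \<exists>q\<in>A2. x = Inl p \<and> z = Inr q \<and> f1 p = f2 q"
    and glue: "\<And>p q. p \<in> A1 \<Longrightarrow> q \<in> A2 \<Longrightarrow> f1 p = f2 q \<Longrightarrow> (Inl p, Inr q) \<in> g"
    and emb1: "\<And>p q. p \<in> A1 \<Longrightarrow> q \<in> A1 \<Longrightarrow> f1 p \<subseteq> f1 q \<longleftrightarrow> p \<subseteq> q"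
    and emb2: "\<And>p q. p \<in> A2 \<Longrightarrow> q \<in> A2 \<Longrightarrow> f2 p \<subseteq> f2 q \<longleftrightarrow> p \<subseteq> q"
    and range: "f1 ` A1 \<union> f2 ` A2 = B"
    and side: "\<And>D E. D \<in> B \<Longrightarrow> E \<in> B \<Longrightarrow> D \<subseteq> E \<Longrightarrow>
      D \<in> f1 ` A1 \<and> E \<in> f1 ` A1 \<or> D \<in> f2 ` A2 \<and> E \<in> f2 ` A2"
  shows "order_isomorphic ((A1 <+> A2) // Restr ((g \<union> g\<inverse>)\<^sup>*) (A1 <+> A2)) class_less B (\<subset>)"
proof -
  define A where "A = A1 <+> A2"
  define R where "R = Restr ((g \<union> g\<inverse>)\<^sup>*) A"
  define f where "f = case_sum f1 f2"
  have inj1: "p = q" if "p \<in> A1" "q \<in> A1" "f1 p = f1 q" for p q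
    using emb1[OF that(1,2)] emb1[OF that(2,1)] that(3) by auto
  have inj2: "p = q" if "p \<in> A2" "q \<in> A2" "f2 p = f2 q" for p q
    using emb2[OF that(1,2)] emb2[OF that(2,1)] that(3) by auto
  have fg: "f x = f z" if "(x, z) \<in> g \<union> g\<inverse>" for x z
  proof -
    have "(x, z) \<in> g \<or> (z, x) \<in> g" using that by blast
    then obtain p q where "x = Inl p \<and> z = Inr q \<or> z = Inl p \<and> x = Inr q" "f1 p = f2 q"
      using g by blast
    then show ?thesis by (auto simp: f_def)
  qed
  have star: "f x = f z" if "(x, z) \<in> (g \<union> g\<inverse>)\<^sup>*" for x z
    using that
  proof (induction rule: rtrancl_induct)
    case (step b z)
    then show ?case using fg[of b z] by simp
  qed simp
  \<comment> \<open>Elements with equal image coincide or are joined by a single gluing step, in one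
    direction or the other.\<close>
  have conv: "(x, z) \<in> (g \<union> g\<inverse>)\<^sup>*" if xA: "x \<in> A" and zA: "z \<in> A" and eq: "f x = f z" for x z
  proof -
    consider p q where "x = Inl p" "z = Inl q" "p \<in> A1" "q \<in> A1"
      | p q where "x = Inr p" "z = Inr q" "p \<in> A2" "q \<in> A2"
      | p q where "x = Inl p" "z = Inr q" "p \<in> A1" "q \<in> A2"
      | p q where "x = Inr p" "z = Inl q" "p \<in> A2" "q \<in> A1"
      using xA zA unfolding A_def by (elim PlusE) blast+
    then show ?thesis
    proof cases
      case (1 p q)
      then have "p = q" using eq inj1[of p q] by (simp add: f_def)
      then show ?thesis using 1 by simp
    next
      case (2 p q)
      then have "p = q" using eq inj2[of p q] by (simp add: f_def)
      then show ?thesis using 2 by simp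
    next
      case (3 p q)
      then have "(x, z) \<in> g" using eq glue[of p q] by (simp add: f_def)
      then show ?thesis by (intro r_into_rtrancl) simp
    next
      case (4 p q)
      then have "(z, x) \<in> g" using eq glue[of q p] by (simp add: f_def)
      then show ?thesis by (intro r_into_rtrancl) simp
    qed
  qed
  have cls: "R `` {x} = {z \<in> A. f z = f x}" if "x \<in> A" for x
  proof (intro equalityI subsetI)
    fix z assume "z \<in> R `` {x}"
    then show "z \<in> {z \<in> A. f z = f x}" using star[of x z] unfolding R_def by simp
  next
    fix z assume "z \<in> {z \<in> A. f z = f x}"
    then show "z \<in> R `` {x}" using conv[of x z] that unfolding R_def by simp
  qed
  \<comment> \<open>The choice is harmless, because \<open>f\<close> is constant on each
    class.\<close>
  define h where "h X = f (SOME z. z \<in> X)" for X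
  have h: "h (R `` {x}) = f x" if "x \<in> A" for x
  proof -
    have "x \<in> R `` {x}" using that by (simp add: cls)
    then have "(SOME z. z \<in> R `` {x}) \<in> R `` {x}" by (rule someI)
    then show ?thesis using that by (simp add: h_def cls)
  qed
  have AR: "A // R = {R `` {x} | x. x \<in> A}" by (auto simp: quotient_def)
  have fA: "f ` A = B" using range by (simp add: A_def f_def Plus_def image_Un image_image)
  have "bij_betw h (A // R) B"
  proof (rule bij_betw_imageI)
    show "inj_on h (A // R)"
    proof (rule inj_onI)
      fix X Y assume "X \<in> A // R" "Y \<in> A // R" and eq: "h X = h Y"
      then obtain x z where "x \<in> A" "X = R `` {x}" "z \<in> A" "Y = R `` {z}" unfolding AR by blast
      then show "X = Y" using eq h cls by simp
    qed
    have "h ` (A // R) = f ` A"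
    proof (intro equalityI subsetI)
      fix b assume "b \<in> h ` (A // R)"
      then obtain x where "x \<in> A" "b = h (R `` {x})" unfolding AR by blast
      then show "b \<in> f ` A" using h by simp
    next
      fix b assume "b \<in> f ` A"
      then obtain x where "x \<in> A" "b = f x" by blast
      then have "R `` {x} \<in> A // R" "b = h (R `` {x})" using h unfolding AR by auto
      then show "b \<in> h ` (A // R)" by blast
    qed
    then show "h ` (A // R) = B" using fA by simp
  qed
  moreover have "class_less X Y \<longleftrightarrow> h X \<subset> h Y" if XY: "X \<in> A // R" "Y \<in> A // R" for X Y
  proof -
    obtain x z where xz: "x \<in> A" "X = R `` {x}" "z \<in> A" "Y = R `` {z}" using XY unfolding AR by blast
    have X: "X = {t \<in> A. f t = f x}" "Y = {t \<in> A. f t = f z}" using xz cls by auto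
    have hX: "h X = f x" "h Y = f z" using xz h by auto
    show ?thesis
    proof
      assume "class_less X Y"
      then obtain \<tau> \<sigma> where ts: "\<tau> \<in> X" "\<sigma> \<in> Y" "rel_sum (\<subset>) (\<subset>) \<tau> \<sigma>"
        unfolding class_less_def by blast
      from ts(3) have "f \<tau> \<subset> f \<sigma>"
      proof cases
        case (1 p q)
        then have "p \<in> A1" "q \<in> A1" using ts X by (auto simp: A_def)
        then show ?thesis using emb1[of p q] emb1[of q p] 1 by (auto simp: f_def)
      next
        case (2 p q)
        then have "p \<in> A2" "q \<in> A2" using ts X by (auto simp: A_def)
        then show ?thesis using emb2[of p q] emb2[of q p] 2 by (auto simp: f_def)
      qed
      then show "h X \<subset> h Y" using ts X hX by simp
    next
      assume less: "h X \<subset> h Y"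
      have "f x \<in> B" "f z \<in> B" using xz fA by auto
      then have "f x \<in> f1 ` A1 \<and> f z \<in> f1 ` A1 \<or> f x \<in> f2 ` A2 \<and> f z \<in> f2 ` A2"
        using side less hX by auto
      then show "class_less X Y"
      proof
        assume "f x \<in> f1 ` A1 \<and> f z \<in> f1 ` A1"
        then obtain p q where pq: "p \<in> A1" "q \<in> A1" "f1 p = f x" "f1 q = f z" by force
        then have "p \<subset> q" using less hX emb1[of p q] emb1[of q p] by auto
        then have "rel_sum (\<subset>) (\<subset>) (Inl p) (Inl q :: 'a set + 'a set)" by simp
        moreover have "Inl p \<in> X" "Inl q \<in> Y" using pq X by (auto simp: A_def f_def)
        ultimately show ?thesis unfolding class_less_def by blast
      next
        assume "f x \<in> f2 ` A2 \<and> f z \<in> f2 ` A2"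
        then obtain p q where pq: "p \<in> A2" "q \<in> A2" "f2 p = f x" "f2 q = f z" by force
        then have "p \<subset> q" using less hX emb2[of p q] emb2[of q p] by auto
        then have "rel_sum (\<subset>) (\<subset>) (Inr p) (Inr q :: 'a set + 'a set)" by simp
        moreover have "Inr p \<in> X" "Inr q \<in> Y" using pq X by (auto simp: A_def f_def)
        ultimately show ?thesis unfolding class_less_def by blast
      qed
    qed
  qed
  ultimately have "order_isomorphic (A // R) class_less B (\<subset>)"
    unfolding order_isomorphic_def by (intro exI[of _ h] conjI ballI) simp_all
  then show ?thesis by (simp only: A_def R_def)
qed

text \<open>Expresses facets by the order on faces alone, so that a map preserving faces preserves
  facets without a statement about dimensions.\<close>

lemma facet_of_iff_maximal_face:
  fixes P :: "'a::euclidean_space set"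
  assumes "polyhedron P"
  shows "G facet_of P \<longleftrightarrow> G face_of P \<and> G \<noteq> {} \<and> G \<noteq> P \<and> (\<forall>H. H face_of P \<and> G \<subseteq> H \<longrightarrow> H = G \<or> H = P)"
proof
  assume G: "G facet_of P"
  have cP: "convex P" using assms polyhedron_imp_convex by blast
  have "H = G" if H: "H face_of P" "G \<subseteq> H" "H \<noteq> P" for H
  proof (rule ccontr)
    assume "H \<noteq> G"
    have "G face_of H" using face_of_subset[OF facet_of_imp_face_of[OF G] H(2) face_of_imp_subset[OF H(1)]] .
    then have "aff_dim G < aff_dim H"
      using face_of_aff_dim_lt[OF face_of_imp_convex[OF H(1)]] \<open>H \<noteq> G\<close> by blast
    moreover have "aff_dim H < aff_dim P" using face_of_aff_dim_lt[OF cP H(1,3)] .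
    ultimately show False using G by (simp add: facet_of_def)
  qed
  then show "G face_of P \<and> G \<noteq> {} \<and> G \<noteq> P \<and> (\<forall>H. H face_of P \<and> G \<subseteq> H \<longrightarrow> H = G \<or> H = P)"
    using facet_of_imp_face_of[OF G] G facet_of_irrefl[of P] facet_of_def[of G P] by blast
next
  assume G: "G face_of P \<and> G \<noteq> {} \<and> G \<noteq> P \<and> (\<forall>H. H face_of P \<and> G \<subseteq> H \<longrightarrow> H = G \<or> H = P)"
  then obtain H where H: "H facet_of P" "G \<subseteq> H" using face_of_polyhedron_subset_facet[OF assms] by metis
  then have "H = G" using G facet_of_imp_face_of facet_of_irrefl by metis
  then show "G facet_of P" using H by simp
qed

section \<open>Projective maps in homogeneous coordinates\<close>

lemma linear_at:
  fixes L :: "'a::real_vector \<times> real \<Rightarrow> 'a \<times> real"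
  assumes "linear L"
  shows "L ((1 - t) *\<^sub>R p + t *\<^sub>R q, 1) = (1 - t) *\<^sub>R L (p, 1) + t *\<^sub>R L (q, 1)"
proof -
  have "((1 - t) *\<^sub>R p + t *\<^sub>R q, 1::real) = (1 - t) *\<^sub>R (p, 1) + t *\<^sub>R (q, 1)" by simp
  then show ?thesis by (simp only: linear_add[OF assms] linear_scale[OF assms])
qed

lemma linear_proj_map:
  assumes "snd (L (x, 1)) \<noteq> 0"
  shows "L (x, 1) = snd (L (x, 1)) *\<^sub>R (proj_map L x, 1)"
  using assms by (simp add: proj_map_def prod_eq_iff)

lemma proj_map_inverse:
  fixes L :: "'a::euclidean_space \<times> real \<Rightarrow> 'a \<times> real"
  assumes "linear L" "bij L" "snd (L (x, 1)) \<noteq> 0"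
  shows "inv L (proj_map L x, 1) = (1 / snd (L (x, 1))) *\<^sub>R (x, 1)" "proj_map (inv L) (proj_map L x) = x"
proof -
  let ?h = "snd (L (x, 1))"
  have "L ((1 / ?h) *\<^sub>R (x, 1)) = (1 / ?h) *\<^sub>R L (x, 1)" by (rule linear_scale[OF assms(1)])
  also have "\<dots> = (1 / ?h) *\<^sub>R (?h *\<^sub>R (proj_map L x, 1))" by (subst linear_proj_map[of L x]) (use assms in auto)
  also have "\<dots> = (proj_map L x, 1)" using assms(3) by (simp only: scaleR_scaleR) simp
  finally show *: "inv L (proj_map L x, 1) = (1 / ?h) *\<^sub>R (x, 1)"
    using assms(2) by (metis bij_inv_eq_iff)
  have "proj_map (inv L) (proj_map L x) = (1 / (1 / ?h)) *\<^sub>R ((1 / ?h) *\<^sub>R x)"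
    unfolding proj_map_def[of "inv L"] * by (simp add: divide_inverse)
  then show "proj_map (inv L) (proj_map L x) = x" using assms(3) by simp
qed

text \<open>The last homogeneous coordinate is affine along the segment; with equal signs at both
  ends it does not vanish in between. The image point divides the image segment with the old weights
  rescaled by the last coordinates at \<open>p\<close> and \<open>q\<close>.\<close>

lemma proj_map_open_segment_sub:
  fixes L :: "'a::euclidean_space \<times> real \<Rightarrow> 'a \<times> real"
  assumes L: "linear L" and pos: "0 < snd (L (p, 1)) * snd (L (q, 1))" and ne: "proj_map L p \<noteq> proj_map L q"
    and z: "z \<in> open_segment p q"
  shows "snd (L (z, 1)) \<noteq> 0" "proj_map L z \<in> open_segment (proj_map L p) (proj_map L q)"
proof -
  obtain t where t: "0 < t" "t < 1" "z = (1 - t) *\<^sub>R p + t *\<^sub>R q" using z by (auto simp: in_segment)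
  let ?a = "snd (L (p, 1))" and ?b = "snd (L (q, 1))"
  define N where "N = (1 - t) * ?a + t * ?b"
  have Lz: "L (z, 1) = (1 - t) *\<^sub>R L (p, 1) + t *\<^sub>R L (q, 1)" unfolding t(3) by (rule linear_at[OF L])
  then have sz: "snd (L (z, 1)) = N" by (simp add: N_def)
  have "0 < ?a \<and> 0 < ?b \<or> ?a < 0 \<and> ?b < 0" using pos by (auto simp: zero_less_mult_iff)
  then have N: "N \<noteq> 0" and r: "0 < t * ?b / N" "t * ?b / N < 1"
  proof -
    assume ab: "0 < ?a \<and> 0 < ?b \<or> ?a < 0 \<and> ?b < 0"
    then have c: "0 < (1 - t) * ?a \<and> 0 < t * ?b \<or> (1 - t) * ?a < 0 \<and> t * ?b < 0"
      using t by (auto simp: mult_pos_neg)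
    then show "N \<noteq> 0" unfolding N_def by linarith
    show "0 < t * ?b / N" using c unfolding N_def zero_less_divide_iff by linarith
    show "t * ?b / N < 1" using c unfolding N_def divide_less_eq_1 by linarith
  qed
  show "snd (L (z, 1)) \<noteq> 0" using sz N by simp
  have ab: "?a \<noteq> 0" "?b \<noteq> 0" using pos by auto
  have "fst (L (z, 1)) = (1 - t) *\<^sub>R fst (L (p, 1)) + t *\<^sub>R fst (L (q, 1))" by (simp add: Lz)
  also have "\<dots> = ((1 - t) * ?a) *\<^sub>R proj_map L p + (t * ?b) *\<^sub>R proj_map L q"
    using ab by (simp add: proj_map_def mult.assoc)
  finally have "proj_map L z = (1 / N) *\<^sub>R (((1 - t) * ?a) *\<^sub>R proj_map L p + (t * ?b) *\<^sub>R proj_map L q)"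
    by (simp add: proj_map_def[of L z] sz divide_inverse)
  also have "\<dots> = ((1 - t) * ?a / N) *\<^sub>R proj_map L p + (t * ?b / N) *\<^sub>R proj_map L q"
    by (simp add: scaleR_add_right)
  also have "(1 - t) * ?a / N = 1 - t * ?b / N"
  proof -
    have "(1 - t) * ?a / N + t * ?b / N = N / N" unfolding N_def add_divide_distrib ..
    then show ?thesis using N by simp
  qed
  finally show "proj_map L z \<in> open_segment (proj_map L p) (proj_map L q)"
    using r ne unfolding in_segment by blast
qed

text \<open>Preservation of open segments suffices to transport convexity, hulls, faces and facets.
  It covers the projective map on the first polytope and the affine map on the second alike.\<close>

definition segment_iso :: "'a::euclidean_space set \<Rightarrow> ('a \<Rightarrow> 'a) \<Rightarrow> bool" where
  "segment_iso P \<phi> \<longleftrightarrow> convex P \<and> inj_on \<phi> P \<and>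
     (\<forall>p\<in>P. \<forall>q\<in>P. \<phi> ` open_segment p q = open_segment (\<phi> p) (\<phi> q))"

lemma projective_segment_iso:
  fixes P :: "'a::euclidean_space set"
  assumes "projective_on P \<phi>" "convex P"
  shows "segment_iso P \<phi>"
proof -
  obtain L where L: "linear L" "bij L" and nz: "\<And>x. x \<in> P \<Longrightarrow> snd (L (x, 1)) \<noteq> 0" and \<phi>: "\<phi> = proj_map L"
    using assms(1) unfolding projective_on_def by blast
  have same_sign: "0 < snd (L (p, 1)) * snd (L (q, 1))" if pq: "p \<in> P" "q \<in> P" for p q
  proof (rule ccontr)
    let ?a = "snd (L (p, 1))" and ?b = "snd (L (q, 1))"
    assume "\<not> 0 < ?a * ?b"
    then have ab: "?a < 0 \<and> 0 < ?b \<or> 0 < ?a \<and> ?b < 0" using nz[OF pq(1)] nz[OF pq(2)]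
      by (metis linorder_neqE_linordered_idom mult_neg_neg mult_pos_pos)
    \<comment> \<open>The zero of the last homogeneous coordinate on the segment, which lies in
      \<open>P\<close> by convexity.\<close>
    define t where "t = ?a / (?a - ?b)"
    have t: "0 \<le> t" "t \<le> 1" using ab by (auto simp: t_def field_simps)
    have "snd (L ((1 - t) *\<^sub>R p + t *\<^sub>R q, 1)) = (1 - t) * ?a + t * ?b" by (simp add: linear_at[OF L(1)])
    also have "\<dots> = ?a - t * (?a - ?b)" by (simp add: algebra_simps)
    also have "\<dots> = 0" using ab by (auto simp: t_def)
    finally show False using nz convexD_alt[OF assms(2) pq t] by blast
  qed
  have inv: "proj_map (inv L) (\<phi> x) = x" if "x \<in> P" for x
    unfolding \<phi> using proj_map_inverse(2)[OF L nz[OF that]] .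
  then have inj: "inj_on \<phi> P" by (rule inj_on_inverseI)
  have li: "linear (inv L)" "bij (inv L)" "inv (inv L) = L"
    using L by (auto simp: bij_imp_bij_inv inv_inv_eq bij_is_inj linear_injective_left_inverse
        intro: inj_linear_imp_inv_linear)
  have "\<phi> ` open_segment p q = open_segment (\<phi> p) (\<phi> q)" if pq: "p \<in> P" "q \<in> P" for p q
  proof (cases "p = q")
    case False
    then have ne: "\<phi> p \<noteq> \<phi> q" using inj pq by (auto dest: inj_onD)
    show ?thesis
    proof (intro equalityI subsetI)
      fix z assume "z \<in> \<phi> ` open_segment p q"
      then show "z \<in> open_segment (\<phi> p) (\<phi> q)"
        using proj_map_open_segment_sub(2)[OF L(1) same_sign[OF pq]] ne unfolding \<phi> by blast
    next
      \<comment> \<open>The inverse is projective too, and its last coordinates at the images are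
        the reciprocals of those of \<open>L\<close>, so signs agree again.\<close>
      fix z assume z: "z \<in> open_segment (\<phi> p) (\<phi> q)"
      have s: "snd (inv L (\<phi> x, 1)) = 1 / snd (L (x, 1))" if "x \<in> P" for x
        unfolding \<phi> proj_map_inverse(1)[OF L nz[OF that]] by simp
      have pos: "0 < snd (inv L (\<phi> p, 1)) * snd (inv L (\<phi> q, 1))"
        using same_sign[OF pq] s pq by simp
      have ne': "proj_map (inv L) (\<phi> p) \<noteq> proj_map (inv L) (\<phi> q)" using inv pq False by simp
      note * = proj_map_open_segment_sub[OF li(1) pos ne' z]
      have "\<phi> (proj_map (inv L) z) = z"
        using proj_map_inverse(2)[OF li(1,2) *(1)] li(3) \<phi> by simp
      then show "z \<in> \<phi> ` open_segment p q" using *(2) inv pq by (metis image_eqI)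
    qed
  qed simp
  with inj assms(2) show ?thesis by (simp add: segment_iso_def)
qed

section \<open>Transport of hulls, faces and facets along segment-preserving maps\<close>

context
  fixes P :: "'a::euclidean_space set" and \<phi> :: "'a \<Rightarrow> 'a"
  assumes iso: "segment_iso P \<phi>"
begin

lemma iso_convexP: "convex P" and iso_inj: "inj_on \<phi> P"
  and iso_seg: "p \<in> P \<Longrightarrow> q \<in> P \<Longrightarrow> \<phi> ` open_segment p q = open_segment (\<phi> p) (\<phi> q)"
  using iso by (auto simp: segment_iso_def)

lemma iso_seg_sub: "p \<in> P \<Longrightarrow> q \<in> P \<Longrightarrow> open_segment p q \<subseteq> P"
  using iso_convexP by (simp add: convex_contains_open_segment)

lemma iso_mem: "x \<in> P \<Longrightarrow> C \<subseteq> P \<Longrightarrow> \<phi> x \<in> \<phi> ` C \<longleftrightarrow> x \<in> C"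
  using iso_inj by (rule inj_on_image_mem_iff)

lemma iso_seg_mem:
  assumes "p \<in> P" "q \<in> P" "x \<in> P"
  shows "\<phi> x \<in> open_segment (\<phi> p) (\<phi> q) \<longleftrightarrow> x \<in> open_segment p q"
  using iso_mem[OF assms(3) iso_seg_sub[OF assms(1,2)]] iso_seg[OF assms(1,2)] by simp

lemma iso_convex:
  assumes "C \<subseteq> P"
  shows "convex (\<phi> ` C) \<longleftrightarrow> convex C"
proof -
  have "open_segment (\<phi> p) (\<phi> q) \<subseteq> \<phi> ` C \<longleftrightarrow> open_segment p q \<subseteq> C" if "p \<in> C" "q \<in> C" for p q
  proof -
    have pq: "p \<in> P" "q \<in> P" using that assms by auto
    show ?thesis
      unfolding iso_seg[OF pq, symmetric]
      by (rule inj_on_image_subset_iff[OF iso_inj iso_seg_sub[OF pq] assms])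
  qed
  then show ?thesis by (simp add: convex_contains_open_segment)
qed

text \<open>Both inclusions come from minimality of a hull; in the second, the preimage of the image
  hull is convex because segments go to segments.\<close>

lemma iso_hull:
  assumes "V \<subseteq> P"
  shows "\<phi> ` (convex hull V) = convex hull (\<phi> ` V)"
proof (rule equalityI)
  have VP: "convex hull V \<subseteq> P" using assms iso_convexP by (rule hull_minimal)
  show "convex hull (\<phi> ` V) \<subseteq> \<phi> ` (convex hull V)"
    using iso_convex[OF VP] by (intro hull_minimal) (auto intro: hull_inc)
  let ?C = "{x\<in>P. \<phi> x \<in> convex hull (\<phi> ` V)}"
  have sub: "open_segment p q \<subseteq> ?C" if pq: "p \<in> ?C" "q \<in> ?C" for p q
  proof
    fix x assume x: "x \<in> open_segment p q"
    then have "\<phi> x \<in> open_segment (\<phi> p) (\<phi> q)" using pq iso_seg[of p q] by blast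
    moreover have "open_segment (\<phi> p) (\<phi> q) \<subseteq> convex hull (\<phi> ` V)"
      using pq convex_convex_hull unfolding convex_contains_open_segment by blast
    ultimately show "x \<in> ?C" using iso_seg_sub[of p q] pq x by blast
  qed
  then have "convex ?C" by (intro convex_contains_open_segment[THEN iffD2] ballI)
  then have "convex hull V \<subseteq> ?C" using assms by (intro hull_minimal) (auto intro: hull_inc)
  then show "\<phi> ` (convex hull V) \<subseteq> convex hull (\<phi> ` V)" by blast
qed

lemma iso_face:
  assumes "T \<subseteq> P"
  shows "\<phi> ` T face_of \<phi> ` P \<longleftrightarrow> T face_of P"
proof -
  have "(\<forall>x\<in>T. \<phi> x \<in> open_segment (\<phi> p) (\<phi> q) \<longrightarrow> \<phi> p \<in> \<phi> ` T \<and> \<phi> q \<in> \<phi> ` T) \<longleftrightarrow>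
    (\<forall>x\<in>T. x \<in> open_segment p q \<longrightarrow> p \<in> T \<and> q \<in> T)" if "p \<in> P" "q \<in> P" for p q
    using that assms iso_seg_mem[OF that] iso_mem[OF _ assms] by (simp add: subset_iff)
  then show ?thesis
    using assms iso_convex[OF assms] by (simp add: face_of_def image_mono)
qed

lemma iso_face_lattice:
  "{\<tau>. \<tau> face_of \<phi> ` P} = (\<lambda>\<sigma>. \<phi> ` \<sigma>) ` {\<sigma>. \<sigma> face_of P}"
proof (intro equalityI subsetI)
  fix \<tau> assume "\<tau> \<in> {\<tau>. \<tau> face_of \<phi> ` P}"
  then have face: "\<tau> face_of \<phi> ` P" by simp
  obtain T where T: "T \<subseteq> P" "\<tau> = \<phi> ` T" using subset_imageE[OF face_of_imp_subset[OF face]] .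
  then show "\<tau> \<in> (\<lambda>\<sigma>. \<phi> ` \<sigma>) ` {\<sigma>. \<sigma> face_of P}" using face iso_face[OF T(1)] by blast
next
  fix \<tau> assume "\<tau> \<in> (\<lambda>\<sigma>. \<phi> ` \<sigma>) ` {\<sigma>. \<sigma> face_of P}"
  then obtain T where "T face_of P" "\<tau> = \<phi> ` T" by blast
  then show "\<tau> \<in> {\<tau>. \<tau> face_of \<phi> ` P}" using iso_face face_of_imp_subset by blast
qed

lemma iso_subset: "C \<subseteq> P \<Longrightarrow> D \<subseteq> P \<Longrightarrow> \<phi> ` C \<subseteq> \<phi> ` D \<longleftrightarrow> C \<subseteq> D"
  using iso_inj by (rule inj_on_image_subset_iff)

lemma iso_eq: "C \<subseteq> P \<Longrightarrow> D \<subseteq> P \<Longrightarrow> \<phi> ` C = \<phi> ` D \<longleftrightarrow> C = D"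
  using iso_inj by (rule inj_on_image_eq_iff)

lemma iso_polytope:
  assumes "polytope P"
  shows "polytope (\<phi> ` P)"
proof -
  obtain V where V: "finite V" "P = convex hull V" using assms unfolding polytope_def by blast
  have "V \<subseteq> P" unfolding V(2) by (rule hull_subset)
  then have "\<phi> ` P = convex hull (\<phi> ` V)" using iso_hull V(2) by metis
  then show ?thesis using V(1) unfolding polytope_def by blast
qed

lemma iso_facet:
  assumes "polytope P" "T \<subseteq> P"
  shows "\<phi> ` T facet_of \<phi> ` P \<longleftrightarrow> T facet_of P"
proof -
  have ph: "polyhedron P" "polyhedron (\<phi> ` P)"
    using assms iso_polytope polytope_imp_polyhedron by auto
  have "(\<forall>H. H face_of \<phi> ` P \<and> \<phi> ` T \<subseteq> H \<longrightarrow> H = \<phi> ` T \<or> H = \<phi> ` P) \<longleftrightarrow>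
    (\<forall>H\<in>{H. H face_of \<phi> ` P}. \<phi> ` T \<subseteq> H \<longrightarrow> H = \<phi> ` T \<or> H = \<phi> ` P)" by blast
  also have "\<dots> \<longleftrightarrow> (\<forall>H. H face_of P \<longrightarrow> \<phi> ` T \<subseteq> \<phi> ` H \<longrightarrow> \<phi> ` H = \<phi> ` T \<or> \<phi> ` H = \<phi> ` P)"
    unfolding iso_face_lattice by blast
  also have "\<dots> \<longleftrightarrow> (\<forall>H. H face_of P \<longrightarrow> T \<subseteq> H \<longrightarrow> H = T \<or> H = P)"
    using iso_subset[OF assms(2)] iso_eq[OF _ assms(2)] iso_eq[OF _ order_refl] face_of_imp_subset by metis
  finally show ?thesis
    unfolding facet_of_iff_maximal_face[OF ph(1)] facet_of_iff_maximal_face[OF ph(2)]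
    using iso_face[OF assms(2)] iso_eq[OF assms(2) order_refl] by auto
qed

lemma iso_facet_lattice:
  assumes "polytope P" "G facet_of \<phi> ` P"
  obtains T where "T facet_of P" "G = \<phi> ` T"
proof -
  obtain T where T: "T \<subseteq> P" "G = \<phi> ` T" using subset_imageE[OF facet_of_imp_subset[OF assms(2)]] .
  then show ?thesis using that assms iso_facet by blast
qed

end

section \<open>Simple vertices and ridges\<close>

lemma facet_subset_eq:
  fixes P :: "'a::euclidean_space set"
  assumes "polyhedron P" "G facet_of P" "H facet_of P" "G \<subseteq> H"
  shows "G = H"
  using assms facet_of_iff_maximal_face[OF assms(1)] by metis

lemma orthogonal_span_eq_0:
  fixes z :: "'a::euclidean_space"
  assumes "span B = UNIV" "\<And>b. b \<in> B \<Longrightarrow> b \<bullet> z = 0"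
  shows "z = 0"
proof -
  have "span B \<subseteq> {x. x \<bullet> z = 0}"
    using assms(2) by (intro span_minimal) (auto simp: subspace_def inner_add_left)
  then have "z \<bullet> z = 0" using assms(1) by blast
  then show ?thesis by simp
qed

text \<open>The \<open>d\<close> facet normals at \<open>v\<close> span the space, as otherwise
  \<open>v\<close> could move both ways inside \<open>P\<close>; so they are independent and have a
  dual basis. Each dual vector points along the edge in which the other facets at \<open>v\<close>
  meet, and counting matches these edges with the given neighbours. The negative normals, rescaled,
  are the required \<open>a k\<close>.\<close>

lemma simple_vertex_frame:
  fixes P :: "'a::euclidean_space set"
  assumes poly: "polytope P" and full: "aff_dim P = DIM('a)" and dim: "DIM('a) = d"
    and simple: "simple_vertex d P v" and bij: "bij_betw u' {1..d} (neighbours P v)"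
  obtains a where "frame d v u' a" "\<And>k x. k \<in> {1..d} \<Longrightarrow> x \<in> P \<Longrightarrow> 0 \<le> a k \<bullet> (x - v)"
proof -
  have ph: "polyhedron P" using poly polytope_imp_polyhedron by blast
  have v: "v extreme_point_of P" using simple by (simp add: simple_vertex_def vertices_def)
  then have vP: "v \<in> P" by (simp add: extreme_point_of_def)
  define \<G> where "\<G> = {G. G facet_of P \<and> v \<in> G}"
  have card\<G>: "card \<G> = d" using simple by (simp add: simple_vertex_def \<G>_def)
  have "d > 0" using dim DIM_positive[where 'a='a] by simp
  then have fin: "finite \<G>" using card\<G> card.infinite by fastforce
  have "\<forall>G\<in>\<G>. \<exists>n b. n \<noteq> 0 \<and> P \<subseteq> {x. n \<bullet> x \<le> b} \<and> G = P \<inter> {x. n \<bullet> x = b}"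
    unfolding \<G>_def using facet_of_polyhedron[OF ph] by (metis mem_Collect_eq)
  from bchoice[OF this] obtain n where n: "\<forall>G\<in>\<G>. \<exists>b. n G \<noteq> 0 \<and> P \<subseteq> {x. n G \<bullet> x \<le> b} \<and> G = P \<inter> {x. n G \<bullet> x = b}"
    by blast
  from bchoice[OF this] obtain b where nb: "\<And>G. G \<in> \<G> \<Longrightarrow> n G \<noteq> 0 \<and> P \<subseteq> {x. n G \<bullet> x \<le> b G} \<and> G = P \<inter> {x. n G \<bullet> x = b G}"
    by blast
  have nv: "n G \<bullet> v = b G" if "G \<in> \<G>" for G
  proof -
    have "v \<in> G" using that by (simp add: \<G>_def)
    then show ?thesis using nb[OF that] by blast
  qed
  have nle: "n G \<bullet> x \<le> n G \<bullet> v" if "G \<in> \<G>" "x \<in> P" for G x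
    using nb[OF that(1)] that(2) nv[OF that(1)] by auto
  have loc: "\<exists>e>0. v + e *\<^sub>R m \<in> P" if m: "\<And>G. G \<in> \<G> \<Longrightarrow> n G \<bullet> m \<le> 0" for m
  proof -
    have D: "\<exists>n b. n \<noteq> 0 \<and> P \<subseteq> {x. n \<bullet> x \<le> b} \<and> G \<subseteq> {x. n \<bullet> x = b} \<and> n \<bullet> m \<le> 0"
      if "G facet_of P" "v \<in> G" for G
    proof -
      have G: "G \<in> \<G>" using that by (simp add: \<G>_def)
      then show ?thesis using nb[OF G] m[OF G] by blast
    qed
    show ?thesis by (rule facet_local[OF ph full vP D]) blast+
  qed
  have span: "span (n ` \<G>) = UNIV"
  proof (rule ccontr)
    assume "span (n ` \<G>) \<noteq> UNIV"
    then obtain m where m: "m \<noteq> 0" "\<forall>x\<in>span (n ` \<G>). m \<bullet> x = 0" using span_not_UNIV_orthogonal by blast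
    have 0: "n G \<bullet> m = 0" if "G \<in> \<G>" for G
      using m(2) span_base[of "n G" "n ` \<G>"] that inner_commute[of m "n G"] by simp
    obtain e where e: "0 < e" "v + e *\<^sub>R m \<in> P" using loc[of m] 0 by auto
    obtain f where f: "0 < f" "v + f *\<^sub>R (- m) \<in> P" using loc[of "- m"] 0 by auto
    show False using v in_open_segment_opposite[OF e(1) f(1) m(1), of v] e f
      unfolding extreme_point_of_def by blast
  qed
  have "card (n ` \<G>) \<le> d" using card_image_le[OF fin, of n] card\<G> by simp
  then have ind: "independent (n ` \<G>)"
    using card_le_dim_spanning[of "n ` \<G>" UNIV] span fin dim by simp
  have "d \<le> card (n ` \<G>)" using dim_le_card'[of "n ` \<G>"] span dim_span[of "n ` \<G>"] fin dim by simp
  then have inj: "inj_on n \<G>" using \<open>card (n ` \<G>) \<le> d\<close> card\<G> fin by (intro eq_card_imp_inj_on) auto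
  \<comment> \<open>The normals point outwards, so the value \<open>- 1\<close> makes
    \<open>e G\<close> leave \<open>G\<close> into \<open>P\<close> while staying in the other
    facets at \<open>v\<close>.\<close>
  have "\<exists>e. \<forall>H\<in>\<G>. n H \<bullet> e = (if H = G then - 1 else 0)" if G: "G \<in> \<G>" for G
  proof -
    obtain e where e: "\<And>m. m \<in> n ` \<G> \<Longrightarrow> e \<bullet> m = (if m = n G then - 1 else 0)"
      using dual_vector[OF ind, of "\<lambda>m. if m = n G then - 1 else 0"] by blast
    have "n H \<bullet> e = (if H = G then - 1 else 0)" if "H \<in> \<G>" for H
      using e[of "n H"] that inj_on_eq_iff[OF inj that G] by (simp add: inner_commute)
    then show ?thesis by blast
  qed
  then have "\<exists>e. \<forall>G\<in>\<G>. \<forall>H\<in>\<G>. n H \<bullet> e G = (if H = G then - 1 else 0)"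
    by (intro bchoice) blast
  then obtain e where e: "\<And>G H. G \<in> \<G> \<Longrightarrow> H \<in> \<G> \<Longrightarrow> n H \<bullet> e G = (if H = G then - 1 else 0)"
    by blast
  have "\<exists>q t. q \<in> neighbours P v \<and> 0 < t \<and> q = v + t *\<^sub>R e G" if G: "G \<in> \<G>" for G
  proof -
    \<comment> \<open>The edge at \<open>v\<close> off \<open>G\<close>; inserting \<open>P\<close>
      covers the case that no other facet is left.\<close>
    define E where "E = \<Inter>(insert P (\<G> - {G}))"
    have face: "E face_of P"
      unfolding E_def using face_of_refl polytope_imp_convex[OF poly] facet_of_imp_face_of
      by (intro face_of_Inter) (auto simp: \<G>_def)
    have E_iff: "x \<in> E \<longleftrightarrow> x \<in> P \<and> (\<forall>H\<in>\<G> - {G}. n H \<bullet> x = b H)" for x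
      unfolding E_def using nb by auto
    have line: "\<exists>t\<ge>0. x = v + t *\<^sub>R e G" if x: "x \<in> E" for x
    proof -
      let ?t = "n G \<bullet> v - n G \<bullet> x"
      have "x - v - ?t *\<^sub>R e G = 0"
      proof (rule orthogonal_span_eq_0[OF span])
        fix m assume "m \<in> n ` \<G>"
        then obtain H where H: "H \<in> \<G>" "m = n H" by blast
        then show "m \<bullet> (x - v - ?t *\<^sub>R e G) = 0"
          using x E_iff[of x] e[OF G H(1)] nv[OF H(1)] nv[OF G] by (simp add: inner_diff_right)
      qed
      then have "x = v + ?t *\<^sub>R e G" by (simp only: diff_diff_eq right_minus_eq)
      moreover have "0 \<le> ?t" using nle[OF G] x E_iff by simp
      ultimately show ?thesis by blast
    qed
    have vE: "v \<in> E" using E_iff vP nv by blast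
    have "n H \<bullet> e G \<le> 0" if "H \<in> \<G>" for H using e[OF G that] by simp
    then obtain r where r: "0 < r" "v + r *\<^sub>R e G \<in> P" using loc by blast
    have rE: "v + r *\<^sub>R e G \<in> E"
      using r e[OF G] nv by (auto simp: E_iff inner_add_right)
    have e0: "e G \<noteq> 0" using e[OF G G] by auto
    have "collinear E"
      unfolding collinear_alt using line by metis
    moreover have "compact E" "convex E"
      using face_of_polytope_polytope[OF poly face] polytope_imp_compact polytope_imp_convex by auto
    ultimately obtain p q where pq: "E = closed_segment p q"
      using compact_convex_collinear_segment[of E] vE by blast
    have vext: "v extreme_point_of E" using v vE extreme_point_of_face[OF face] by blast
    obtain q where q: "E = closed_segment v q"
    proof -
      from vext have "v = p \<or> v = q" unfolding pq extreme_point_of_segment .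
      then show ?thesis
      proof
        assume "v = p" then show ?thesis using that pq by blast
      next
        assume "v = q" then show ?thesis using that[of p] pq closed_segment_commute by blast
      qed
    qed
    have "q \<noteq> v"
    proof
      assume "q = v"
      then have "v + r *\<^sub>R e G = v" using rE q by simp
      then show False using r e0 by simp
    qed
    have "q extreme_point_of E" unfolding q extreme_point_of_segment by simp
    then have "q \<in> vertices P" using extreme_point_of_face[OF face] by (simp add: vertices_def)
    moreover have "aff_dim E = 1"
      using \<open>q \<noteq> v\<close> by (simp add: q segment_convex_hull aff_dim_convex_hull aff_dim_2)
    then have "closed_segment v q edge_of P" using face by (simp add: edge_of_def flip: q)
    ultimately have "q \<in> neighbours P v" by (simp add: neighbours_def)
    moreover obtain t where t: "t \<ge> 0" "q = v + t *\<^sub>R e G" using line[of q] q by auto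
    moreover have "t \<noteq> 0" using t \<open>q \<noteq> v\<close> by auto
    ultimately show ?thesis by (metis less_eq_real_def)
  qed
  then obtain q where "\<forall>G\<in>\<G>. \<exists>t. q G \<in> neighbours P v \<and> 0 < t \<and> q G = v + t *\<^sub>R e G"
    using bchoice[of \<G> "\<lambda>G q. \<exists>t. q \<in> neighbours P v \<and> 0 < t \<and> q = v + t *\<^sub>R e G"] by blast
  then obtain t where qt: "\<And>G. G \<in> \<G> \<Longrightarrow> q G \<in> neighbours P v \<and> 0 < t G \<and> q G = v + t G *\<^sub>R e G"
    using bchoice[of \<G> "\<lambda>G t. q G \<in> neighbours P v \<and> 0 < t \<and> q G = v + t *\<^sub>R e G"] by blast
  have nq: "n H \<bullet> (q G - v) = (if H = G then - t G else 0)" if "G \<in> \<G>" "H \<in> \<G>" for G H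
    using qt[OF that(1)] e[OF that] by simp
  have injq: "inj_on q \<G>"
  proof (rule inj_onI)
    fix G H assume GH: "G \<in> \<G>" "H \<in> \<G>" "q G = q H"
    show "G = H"
    proof (rule ccontr)
      assume "G \<noteq> H"
      then have "- t G = 0" using nq[OF GH(1,1)] nq[OF GH(2,1)] GH(3) by simp
      then show False using qt[OF GH(1)] by simp
    qed
  qed
  have finN: "finite (neighbours P v)" "card (neighbours P v) = d"
    using bij bij_betw_finite[OF bij] bij_betw_same_card[OF bij] by auto
  \<comment> \<open>Both sides have \<open>d\<close> elements, so every neighbour arises from
    exactly one facet at \<open>v\<close>.\<close>
  have "q ` \<G> \<subseteq> neighbours P v" using qt by blast
  moreover have "card (q ` \<G>) = card (neighbours P v)" using card_image[OF injq] card\<G> finN(2) by simp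
  ultimately have qN: "q ` \<G> = neighbours P v" using card_subset_eq[OF finN(1)] by blast
  have "\<forall>k\<in>{1..d}. \<exists>G. G \<in> \<G> \<and> u' k = q G"
  proof
    fix k assume "k \<in> {1..d}"
    then have "u' k \<in> q ` \<G>" using bij qN unfolding bij_betw_def by blast
    then show "\<exists>G. G \<in> \<G> \<and> u' k = q G" by blast
  qed
  then obtain g where g: "\<And>k. k \<in> {1..d} \<Longrightarrow> g k \<in> \<G> \<and> u' k = q (g k)"
    using bchoice[of "{1..d}" "\<lambda>k G. G \<in> \<G> \<and> u' k = q G"] by blast
  have injg: "inj_on g {1..d}"
  proof (rule inj_onI)
    fix j k assume "j \<in> {1..d}" "k \<in> {1..d}" "g j = g k"
    then have "u' j = u' k" using g by metis
    then show "j = k" using bij \<open>j \<in> {1..d}\<close> \<open>k \<in> {1..d}\<close> unfolding bij_betw_def inj_on_def by blast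
  qed
  have "g ` {1..d} \<subseteq> \<G>" using g by blast
  moreover have "card (g ` {1..d}) = card \<G>" using card_image[OF injg] card\<G> by simp
  ultimately have g\<G>: "g ` {1..d} = \<G>" using card_subset_eq[OF fin] by blast
  \<comment> \<open>\<open>t (g k)\<close> measures the edge to \<open>u' k\<close> in units of the
    dual vector; dividing by it gives \<open>a k\<close> the value 1 on
    \<open>u' k - v\<close>.\<close>
  define a where "a k = - (1 / t (g k)) *\<^sub>R n (g k)" for k
  have tpos: "0 < t (g k)" if "k \<in> {1..d}" for k using qt g[OF that] by blast
  have dual: "a j \<bullet> (u' k - v) = (if j = k then 1 else 0)" if jk: "j \<in> {1..d}" "k \<in> {1..d}" for j k
  proof -
    have "a j \<bullet> (u' k - v) = - (1 / t (g j)) * (n (g j) \<bullet> (q (g k) - v))"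
      using g[OF jk(2)] by (simp add: a_def)
    also have "\<dots> = - (1 / t (g j)) * (if g j = g k then - t (g k) else 0)"
      using nq g[OF jk(1)] g[OF jk(2)] by simp
    also have "\<dots> = (if j = k then 1 else 0)"
      using inj_on_eq_iff[OF injg jk] tpos[OF jk(1)] by auto
    finally show ?thesis .
  qed
  have "frame d v u' a"
  proof
    fix x
    let ?z = "x - v - (\<Sum>k\<in>{1..d}. (a k \<bullet> (x - v)) *\<^sub>R (u' k - v))"
    have "?z = 0"
    proof (rule orthogonal_span_eq_0[OF span])
      fix m assume "m \<in> n ` \<G>"
      then obtain j where j: "j \<in> {1..d}" "m = n (g j)" using g\<G> by blast
      have "a j \<bullet> (\<Sum>k\<in>{1..d}. (a k \<bullet> (x - v)) *\<^sub>R (u' k - v))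
          = (\<Sum>k\<in>{1..d}. (a k \<bullet> (x - v)) * (if j = k then 1 else 0))"
        using dual j by (simp add: inner_sum_right)
      also have "\<dots> = a j \<bullet> (x - v)" using j by (simp add: if_distrib cong: if_cong)
      finally have "a j \<bullet> ?z = 0" by (simp add: inner_diff_right)
      then show "m \<bullet> ?z = 0" using tpos[OF j(1)] j(2) by (simp add: a_def)
    qed
    then show "x = v + (\<Sum>k\<in>{1..d}. (a k \<bullet> (x - v)) *\<^sub>R (u' k - v))"
      by (simp only: diff_diff_eq right_minus_eq)
  qed (rule dual)
  moreover have "0 \<le> a k \<bullet> (x - v)" if k: "k \<in> {1..d}" "x \<in> P" for k x
  proof -
    have "a k \<bullet> (x - v) = (n (g k) \<bullet> v - n (g k) \<bullet> x) / t (g k)"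
      by (simp add: a_def inner_diff_right diff_divide_distrib)
    then show ?thesis using nle[of "g k" x] g[OF k(1)] tpos[OF k(1)] k(2) by simp
  qed
  ultimately show ?thesis using that by blast
qed

section \<open>Edges and facets at a simple vertex\<close>

context corner begin

lemma edge_at_w:
  assumes "e edge_of P" "w \<in> e"
  obtains l where "l \<in> {1..d}" "e = corner_face ({1..d} - {l})"
proof -
  have "e face_of P" "aff_dim e = 1" using assms by (auto simp: edge_of_def)
  then obtain S where S: "S \<subseteq> {1..d}" "e = corner_face S" using face_at_w assms(2) by blast
  then have "int d - int (card S) = 1" using aff_dim_corner_face \<open>aff_dim e = 1\<close> by simp
  moreover have "card ({1..d} - S) = d - card S" using S(1) by (simp add: card_Diff_subset finite_subset)
  ultimately have "card ({1..d} - S) = 1" by simp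
  then obtain l where "{1..d} - S = {l}" by (rule card_1_singletonE)
  then have "l \<in> {1..d}" "S = {1..d} - {l}" using S(1) by auto
  then show ?thesis using that S by blast
qed

lemma neighbour_edge:
  assumes "closed_segment w (y l) edge_of P" "l \<in> {1..d}"
  shows "closed_segment w (y l) = corner_face ({1..d} - {l})"
proof -
  obtain j where j: "j \<in> {1..d}" "closed_segment w (y l) = corner_face ({1..d} - {j})"
    using edge_at_w[OF assms(1)] by auto
  have "y l \<in> corner_face ({1..d} - {j})" unfolding j(2)[symmetric] by simp
  then have "l = j" using y_in_corner_face[OF assms(2), of "{1..d} - {j}"] assms(2) by auto
  then show ?thesis using j by simp
qed

text \<open>Faces at \<open>w\<close> are corners, so a facet at \<open>w\<close> satisfies a single
  coordinate equation, and the edges it contains determine the index.\<close>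

lemma vertex_facet_eq:
  assumes d: "2 \<le> d" and full: "aff_dim P = int d" and j: "j \<in> {1..d}"
    and edges: "\<And>k. k \<in> {1..d} \<Longrightarrow> closed_segment w (y k) edge_of P"
  shows "vertex_facet P w y j = corner_face {j}"
  unfolding vertex_facet_def
proof (rule the_equality)
  have seg_sub: "closed_segment w (y l) \<subseteq> corner_face {m} \<longleftrightarrow> l \<noteq> m"
    if "l \<in> {1..d}" "m \<in> {1..d}" for l m
  proof
    assume "closed_segment w (y l) \<subseteq> corner_face {m}"
    then have "y l \<in> corner_face {m}" by auto
    then show "l \<noteq> m" using y_in_corner_face[of l "{m}"] that by simp
  next
    assume "l \<noteq> m"
    then show "closed_segment w (y l) \<subseteq> corner_face {m}"
      using neighbour_edge[OF edges[OF that(1)] that(1)] that by (auto simp: corner_face_def)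
  qed
  have seg_eq: "closed_segment w (y l) = closed_segment w (y m) \<longleftrightarrow> l = m"
    if "l \<in> {1..d}" "m \<in> {1..d}" for l m
    using seg_sub[OF that] seg_sub[OF that(2) that(2)] by metis
  have edge: "\<exists>l\<in>{1..d}. e = closed_segment w (y l)" if e: "e edge_of P" "w \<in> e" for e
  proof -
    obtain l where "l \<in> {1..d}" "e = corner_face ({1..d} - {l})" using edge_at_w[OF e] .
    then have "e = closed_segment w (y l)" using neighbour_edge[OF edges[OF \<open>l \<in> {1..d}\<close>]] by simp
    then show ?thesis using \<open>l \<in> {1..d}\<close> by blast
  qed
  have "corner_face {j} facet_of P"
    unfolding facet_of_def using face_of_corner_face[of "{j}"] aff_dim_corner_face[of "{j}"] j full w_in_corner_face
    by auto
  moreover have "e \<subseteq> corner_face {j} \<longleftrightarrow> e \<noteq> closed_segment w (y j)" if e: "e edge_of P" "w \<in> e" for e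
  proof -
    obtain l where l: "l \<in> {1..d}" "e = closed_segment w (y l)" using edge[OF e] by blast
    then show ?thesis using seg_sub[OF l(1) j] seg_eq[OF l(1) j] by simp
  qed
  ultimately show "corner_face {j} facet_of P \<and>
    (\<forall>e. e edge_of P \<and> w \<in> e \<longrightarrow> (e \<subseteq> corner_face {j} \<longleftrightarrow> e \<noteq> closed_segment w (y j)))" by blast
next
  fix H assume H: "H facet_of P \<and> (\<forall>e. e edge_of P \<and> w \<in> e \<longrightarrow> (e \<subseteq> H \<longleftrightarrow> e \<noteq> closed_segment w (y j)))"
  have inH: "closed_segment w (y l) \<subseteq> H \<longleftrightarrow> closed_segment w (y l) \<noteq> closed_segment w (y j)" if "l \<in> {1..d}" for l
    using H edges[OF that] by simp
  have yl: "y l \<in> H" if l: "l \<in> {1..d}" "l \<noteq> j" and "w \<in> H" for l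
  proof -
    have "y l \<notin> corner_face ({1..d} - {j})" using y_in_corner_face[OF l(1), of "{1..d} - {j}"] l by blast
    then have "closed_segment w (y l) \<noteq> closed_segment w (y j)"
      using neighbour_edge[OF edges[OF j] j] by auto
    then show ?thesis using inH[OF l(1)] by auto
  qed
  \<comment> \<open>A second index, available because \<open>d \<ge> 2\<close>; the edge to
    \<open>y l\<close> lies in \<open>H\<close> and thereby puts \<open>w\<close> into
    \<open>H\<close>.\<close>
  define l where "l = (if j = 1 then 2 else 1 :: nat)"
  have l: "l \<in> {1..d}" "l \<noteq> j" using d by (auto simp: l_def)
  have "y l \<notin> corner_face ({1..d} - {j})" using y_in_corner_face[OF l(1), of "{1..d} - {j}"] l by blast
  then have "closed_segment w (y l) \<noteq> closed_segment w (y j)"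
    using neighbour_edge[OF edges[OF j] j] by auto
  then have wH: "w \<in> H" using inH[OF l(1)] by auto
  have faceH: "H face_of P" "aff_dim H = int d - 1" using H full by (auto simp: facet_of_def)
  obtain S where S: "S \<subseteq> {1..d}" "H = corner_face S" using face_at_w[OF faceH(1) wH] .
  have "card S = 1" using aff_dim_corner_face[OF S(1)] faceH S by simp
  then obtain m where m: "S = {m}" by (rule card_1_singletonE)
  have md: "m \<in> {1..d}" using S m by simp
  have "m = j"
  proof (rule ccontr)
    assume "m \<noteq> j"
    then have "y m \<in> H" using yl[OF md _ wH] by blast
    then show False using y_in_corner_face[OF md, of "{m}"] S m md by simp
  qed
  then show "H = corner_face {j}" using S m by simp
qed

end

text \<open>The vertices of the simplex are extreme points of the hull, hence among the
  \<open>u k\<close>; as there are \<open>d\<close> of them, the \<open>u k\<close> are distinct and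
  are exactly these vertices.\<close>

lemma simplex_hull_independent:
  fixes u :: "nat \<Rightarrow> 'a::euclidean_space"
  assumes "(int d - 1) simplex (convex hull (u ` {1..d}))"
  shows "\<not> affine_dependent (u ` {1..d})" "inj_on u {1..d}"
proof -
  obtain C where C: "finite C" "\<not> affine_dependent C" "int (card C) = int d"
    "convex hull (u ` {1..d}) = convex hull C"
    using assms unfolding simplex by auto
  have "C \<subseteq> u ` {1..d}"
  proof
    fix x assume "x \<in> C"
    then have "x extreme_point_of (convex hull (u ` {1..d}))"
      using extreme_point_of_convex_hull_affine_independent[OF C(2)] C(4) by simp
    then show "x \<in> u ` {1..d}" using extreme_point_of_convex_hull by blast
  qed
  moreover have le: "card (u ` {1..d}) \<le> d" using card_image_le[of "{1..d}" u] by simp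
  ultimately have eq: "C = u ` {1..d}" using C(3) by (intro card_seteq) auto
  then show "\<not> affine_dependent (u ` {1..d})" using C by simp
  show "inj_on u {1..d}" using eq C(3) by (intro eq_card_imp_inj_on) auto
qed

text \<open>Coordinates for the first polytope before the simplex \<open>\<Sigma>\<close> is
  available: any point of \<open>P\<close> off the facet completes the \<open>u k\<close> to an
  affine basis.\<close>

lemma facet_frame:
  fixes P :: "'a::euclidean_space set"
  assumes dim: "DIM('a) = d" and P: "polytope P"
    and F: "convex hull (u ` {1..d}) facet_of P" and simplex: "(int d - 1) simplex (convex hull (u ` {1..d}))"
  obtains p a where "p \<in> P" "p \<notin> convex hull (u ` {1..d})" "frame d p u a"
proof -
  let ?F = "convex hull (u ` {1..d})"
  obtain p where p: "p \<in> P" "p \<notin> ?F"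
  proof -
    have "?F \<noteq> P" using F facet_of_irrefl by metis
    then show ?thesis using that facet_of_imp_subset[OF F] by blast
  qed
  have "p \<notin> affine hull (u ` {1..d})"
  proof
    assume "p \<in> affine hull (u ` {1..d})"
    then have "p \<in> affine hull ?F \<inter> P" using p by (simp add: affine_hull_convex_hull)
    then show False
      using face_of_imp_eq_affine_Int[OF polytope_imp_convex[OF P] facet_of_imp_face_of[OF F]] p by blast
  qed
  then have "\<not> affine_dependent (insert p (u ` {1..d}))"
    using simplex_hull_independent(1)[OF simplex] affine_independent_insert by blast
  moreover have "p \<notin> u ` {1..d}" using p hull_inc by metis
  ultimately show ?thesis
    using frame_exists[OF dim _ simplex_hull_independent(2)[OF simplex]] that p by metis
qed

text \<open>Existence: the ridge is the intersection of the facets containing it, so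
  \<open>?F\<close> is not the only one. Uniqueness: a functional constant on the ridge is fixed by
  its values at \<open>p\<close> and \<open>u j\<close>, so two such facets can be compared by one
  determinant.\<close>

lemma ridge_facet_ex1:
  fixes P :: "'a::euclidean_space set"
  assumes dim: "DIM('a) = d" and d: "2 \<le> d" and P: "polytope P"
    and F: "convex hull (u ` {1..d}) facet_of P" and simplex: "(int d - 1) simplex (convex hull (u ` {1..d}))"
    and j: "j \<in> {1..d}"
  shows "\<exists>!H. H facet_of P \<and> H \<inter> convex hull (u ` {1..d}) = convex hull (u ` ({1..d} - {j}))"
proof -
  let ?F = "convex hull (u ` {1..d})" and ?R = "convex hull (u ` ({1..d} - {j}))"
  have ph: "polyhedron P" using P polytope_imp_polyhedron by blast
  obtain p a where p: "p \<in> P" "p \<notin> ?F" and fr: "frame d p u a" using facet_frame[OF dim P F simplex] .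
  interpret frame d p u a by (rule fr)
  note ind = simplex_hull_independent[OF simplex]
  have uk: "u k \<in> convex hull (u ` S) \<longleftrightarrow> k \<in> S" if "k \<in> {1..d}" "S \<subseteq> {1..d}" for k S
  proof
    assume "u k \<in> convex hull (u ` S)"
    then have 0: "\<forall>l\<in>{1..d} - S. c l (u k) = 0" using hull_y[OF that(2)] by blast
    show "k \<in> S"
    proof (rule ccontr)
      assume "k \<notin> S"
      then have "c k (u k) = 0" using 0 that(1) by blast
      then show False using c_y[OF that(1,1)] by simp
    qed
  next
    assume "k \<in> S"
    then show "u k \<in> convex hull (u ` S)" by (simp add: hull_inc)
  qed
  have RF: "?R face_of ?F" unfolding face_of_hull_image[OF ind(1)] by blast
  have RP: "?R face_of P" using face_of_trans[OF RF facet_of_imp_face_of[OF F]] .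
  have notR: "u j \<notin> ?R" using uk[OF j, of "{1..d} - {j}"] by blast
  have uF: "u k \<in> ?F" if "k \<in> {1..d}" for k using that by (simp add: hull_inc)
  define l where "l = (if j = 1 then 2 else 1 :: nat)"
  have "l \<in> {1..d} - {j}" using d by (auto simp: l_def)
  then have "u l \<in> ?R" by (simp add: hull_inc)
  then have "?R \<noteq> {}" by blast
  moreover have "?R \<noteq> P" using p RF face_of_imp_subset by blast
  ultimately have Req: "?R = \<Inter>{G. G facet_of P \<and> ?R \<subseteq> G}" using face_of_polyhedron[OF ph RP] by blast
  have "\<exists>G. G facet_of P \<and> ?R \<subseteq> G \<and> G \<noteq> ?F"
  proof (rule ccontr)
    assume "\<not> ?thesis"
    then have "?F \<subseteq> \<Inter>{G. G facet_of P \<and> ?R \<subseteq> G}" by blast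
    then show False using Req notR uF[OF j] by blast
  qed
  then obtain H where H: "H facet_of P" "?R \<subseteq> H" "H \<noteq> ?F" by blast
  have HF: "H \<inter> ?F face_of ?F"
    using face_of_subset[OF face_of_Int[OF facet_of_imp_face_of[OF H(1)] facet_of_imp_face_of[OF F]]]
      facet_of_imp_subset[OF F] by blast
  obtain S where S: "S \<subseteq> {1..d}" "H \<inter> ?F = convex hull (u ` S)"
    using HF unfolding face_of_hull_image[OF ind(1)] by blast
  have "{1..d} - {j} \<subseteq> S"
  proof
    fix k assume k: "k \<in> {1..d} - {j}"
    then have "u k \<in> ?R" by (simp add: hull_inc)
    then have "u k \<in> convex hull (u ` S)" using H(2) uF[of k] k S by blast
    then show "k \<in> S" using uk[of k S] S k by blast
  qed
  moreover have "j \<notin> S"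
  proof
    assume "j \<in> S"
    then have "S = {1..d}" using \<open>{1..d} - {j} \<subseteq> S\<close> S by blast
    then have "?F \<subseteq> H" using S by blast
    then show False using facet_subset_eq[OF ph F H(1)] H(3) by blast
  qed
  ultimately have "S = {1..d} - {j}" using S by blast
  then have ex: "H facet_of P \<and> H \<inter> ?F = ?R" using H S by simp
  obtain n0 b0 where n0: "P \<subseteq> {x. n0 \<bullet> x \<le> b0}" "?F = P \<inter> {x. n0 \<bullet> x = b0}"
    using facet_of_polyhedron[OF ph F] by metis
  have "s x \<le> 1" if x: "x \<in> P" for x
  proof -
    have "n0 \<bullet> u k - b0 = 0" if "k \<in> {1..d}" for k using uF[OF that] n0(2) by auto
    then have "(\<Sum>k\<in>{1..d}. c k x * (n0 \<bullet> u k - b0)) = 0" by simp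
    then have "n0 \<bullet> x - b0 = (1 - s x) * (n0 \<bullet> p - b0)" using affine_bary[of n0 x b0] by simp
    moreover have "n0 \<bullet> x - b0 \<le> 0" using n0(1) x by auto
    moreover have "n0 \<bullet> p - b0 \<le> 0" "n0 \<bullet> p - b0 \<noteq> 0" using n0 p by auto
    ultimately show ?thesis by (simp add: mult_le_0_iff)
  qed
  note sle = this
  \<comment> \<open>\<open>le\<close> compares the slacks of the two facets at \<open>p\<close> and
    \<open>u j\<close>. Eliminating \<open>c j x\<close> leaves a multiple of
    \<open>1 - s x\<close>, nonnegative on \<open>P\<close>, so the slack of \<open>G'\<close>
    vanishes on \<open>G\<close>. For any two candidates \<open>le\<close> holds in one order or the
    other.\<close>
  have contain: "G = G'"
    if G: "G facet_of P" "G = P \<inter> {x. n \<bullet> x = b}" "P \<subseteq> {x. n \<bullet> x \<le> b}" "G \<inter> ?F = ?R"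
      and G': "G' facet_of P" "G' = P \<inter> {x. n' \<bullet> x = b'}" "P \<subseteq> {x. n' \<bullet> x \<le> b'}" "G' \<inter> ?F = ?R"
      and le: "0 \<le> (b' - n' \<bullet> u j) * (b - n \<bullet> p) - (b - n \<bullet> u j) * (b' - n' \<bullet> p)" for G G' n n' b b'
  proof -
    have FP: "?F \<subseteq> P" using facet_of_imp_subset[OF F] .
    have jG: "u j \<notin> G" "u j \<notin> G'" using G(4) G'(4) notR uF[OF j] by blast+
    have fj: "0 < b - n \<bullet> u j" "0 < b' - n' \<bullet> u j"
      using jG G G' uF[OF j] FP by (auto simp: less_le)
    have other: "n \<bullet> u k = b" "n' \<bullet> u k = b'" if k: "k \<in> {1..d}" "k \<noteq> j" for k
    proof -
      have "u k \<in> ?R" using k by (simp add: hull_inc)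
      then have "u k \<in> G" "u k \<in> G'" using G(4) G'(4) by blast+
      then show "n \<bullet> u k = b" "n' \<bullet> u k = b'" using G(2) G'(2) by blast+
    qed
    have val: "b - n \<bullet> x = (1 - s x) * (b - n \<bullet> p) + c j x * (b - n \<bullet> u j)"
      "b' - n' \<bullet> x = (1 - s x) * (b' - n' \<bullet> p) + c j x * (b' - n' \<bullet> u j)" for x
    proof -
      have "(\<Sum>k\<in>{1..d}. c k x * (n \<bullet> u k - b)) = (\<Sum>k\<in>{j}. c k x * (n \<bullet> u k - b))"
        using j other by (intro sum.mono_neutral_right) auto
      then show "b - n \<bullet> x = (1 - s x) * (b - n \<bullet> p) + c j x * (b - n \<bullet> u j)"
        using affine_bary[of n x b] by (simp add: algebra_simps)
      have "(\<Sum>k\<in>{1..d}. c k x * (n' \<bullet> u k - b')) = (\<Sum>k\<in>{j}. c k x * (n' \<bullet> u k - b'))"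
        using j other by (intro sum.mono_neutral_right) auto
      then show "b' - n' \<bullet> x = (1 - s x) * (b' - n' \<bullet> p) + c j x * (b' - n' \<bullet> u j)"
        using affine_bary[of n' x b'] by (simp add: algebra_simps)
    qed
    have "G \<subseteq> G'"
    proof
      fix x assume x: "x \<in> G"
      then have xP: "x \<in> P" and fx: "b - n \<bullet> x = 0" using G by auto
      have "(b' - n' \<bullet> u j) * (b - n \<bullet> x) - (b - n \<bullet> u j) * (b' - n' \<bullet> x) =
        (1 - s x) * ((b' - n' \<bullet> u j) * (b - n \<bullet> p) - (b - n \<bullet> u j) * (b' - n' \<bullet> p))"
        unfolding val[of x] by (simp add: algebra_simps)
      also have "\<dots> \<ge> 0" using sle[OF xP] le by simp
      finally have "(b - n \<bullet> u j) * (b' - n' \<bullet> x) \<le> 0" using fx by simp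
      then have "b' - n' \<bullet> x \<le> 0" using fj by (simp add: mult_le_0_iff)
      then show "x \<in> G'" using G'(2,3) xP by auto
    qed
    then show ?thesis using facet_subset_eq[OF ph G(1) G'(1)] by blast
  qed
  have "G = G'" if G: "G facet_of P \<and> G \<inter> ?F = ?R" and G': "G' facet_of P \<and> G' \<inter> ?F = ?R" for G G'
  proof -
    obtain n b where nb: "P \<subseteq> {x. n \<bullet> x \<le> b}" "G = P \<inter> {x. n \<bullet> x = b}"
      using facet_of_polyhedron[OF ph] G by metis
    obtain n' b' where nb': "P \<subseteq> {x. n' \<bullet> x \<le> b'}" "G' = P \<inter> {x. n' \<bullet> x = b'}"
      using facet_of_polyhedron[OF ph] G' by metis
    show ?thesis
    proof (cases "0 \<le> (b' - n' \<bullet> u j) * (b - n \<bullet> p) - (b - n \<bullet> u j) * (b' - n' \<bullet> p)")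
      case True
      then show ?thesis using contain[of G n b G' n' b'] G G' nb nb' by blast
    next
      case False
      then have "0 \<le> (b - n \<bullet> u j) * (b' - n' \<bullet> p) - (b' - n' \<bullet> u j) * (b - n \<bullet> p)" by simp
      then show ?thesis using contain[of G' n' b' G n b] G G' nb nb' by blast
    qed
  qed
  with ex show ?thesis by blast
qed

lemma ridge_facet:
  fixes P :: "'a::euclidean_space set"
  assumes "DIM('a) = d" "2 \<le> d" "polytope P" "convex hull (u ` {1..d}) facet_of P"
    "(int d - 1) simplex (convex hull (u ` {1..d}))" "j \<in> {1..d}"
  shows "ridge_facet d P u j facet_of P"
    "ridge_facet d P u j \<inter> convex hull (u ` {1..d}) = convex hull (u ` ({1..d} - {j}))"
  using theI'[OF ridge_facet_ex1[OF assms]] unfolding ridge_facet_def by blast+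

section \<open>Existence of a merge\<close>

context frame begin

lemma simplex_coords:
  assumes "x \<in> convex hull (insert w (y ` {1..d}))"
  shows "s x \<le> 1" "k \<in> {1..d} \<Longrightarrow> 0 \<le> c k x"
proof -
  have "convex {x. s x \<le> 1 \<and> (\<forall>k\<in>{1..d}. 0 \<le> c k x)}"
  proof (rule convexI)
    fix x z and e f :: real
    assume xz: "x \<in> {x. s x \<le> 1 \<and> (\<forall>k\<in>{1..d}. 0 \<le> c k x)}" "z \<in> {x. s x \<le> 1 \<and> (\<forall>k\<in>{1..d}. 0 \<le> c k x)}"
      and ef: "0 \<le> e" "0 \<le> f" "e + f = 1"
    then have "e * s x + f * s z \<le> e * 1 + f * 1" by (intro add_mono mult_left_mono) auto
    then show "e *\<^sub>R x + f *\<^sub>R z \<in> {x. s x \<le> 1 \<and> (\<forall>k\<in>{1..d}. 0 \<le> c k x)}"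
      using xz ef by (simp add: s_convex c_convex)
  qed
  moreover have "insert w (y ` {1..d}) \<subseteq> {x. s x \<le> 1 \<and> (\<forall>k\<in>{1..d}. 0 \<le> c k x)}"
    by (auto simp: s_y c_y)
  ultimately have "convex hull (insert w (y ` {1..d})) \<subseteq> {x. s x \<le> 1 \<and> (\<forall>k\<in>{1..d}. 0 \<le> c k x)}"
    by (rule hull_minimal[rotated])
  then show "s x \<le> 1" "k \<in> {1..d} \<Longrightarrow> 0 \<le> c k x" using assms by auto
qed

end

lemma facet_affine_hulls:
  fixes C :: "'a::euclidean_space set"
  assumes "\<not> affine_dependent C" "2 \<le> card C"
  shows "{affine hull G |G. G facet_of (convex hull C)} = (\<lambda>x. affine hull (C - {x})) ` C"
proof -
  have "{G. G facet_of (convex hull C)} = (\<lambda>x. convex hull (C - {x})) ` C"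
    using assms by (auto simp: facet_of_convex_hull_affine_independent_alt)
  then have "(hull) affine ` {G. G facet_of (convex hull C)} = (\<lambda>x. affine hull (C - {x})) ` C"
    by (simp add: image_image affine_hull_convex_hull)
  moreover have "{affine hull G |G. G facet_of (convex hull C)} = (hull) affine ` {G. G facet_of (convex hull C)}"
    by blast
  ultimately show ?thesis by simp
qed

lemma affine_hull_omit_inj:
  assumes "\<not> affine_dependent C"
  shows "inj_on (\<lambda>x. affine hull (C - {x})) C"
proof (rule inj_onI)
  fix p q assume pq: "p \<in> C" "q \<in> C" "affine hull (C - {p}) = affine hull (C - {q})"
  show "p = q"
  proof (rule ccontr)
    assume "p \<noteq> q"
    then have "p \<in> affine hull (C - {q})" using pq by (intro hull_inc) simp
    then have "p \<in> affine hull (C - {p})" using pq by simp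
    then show False using assms pq unfolding affine_dependent_def by blast
  qed
qed

text \<open>The two lists of \<open>d + 1\<close> hyperplanes are matched by counting; \<open>y k\<close> lies on all
  hyperplanes except \<open>H k\<close>, so it is the vertex opposite to the facet that spans \<open>H k\<close>.\<close>

lemma merge_simplex_frame:
  fixes w :: "'a::euclidean_space" and y :: "nat \<Rightarrow> 'a"
  assumes d: "1 \<le> d" and \<Sigma>: "int d simplex \<Sigma>"
    and hulls: "{affine hull G |G. G facet_of \<Sigma>} = insert (affine hull F) {affine hull (H j) |j. j \<in> {1..d}}"
    and y\<Sigma>: "\<And>k. k \<in> {1..d} \<Longrightarrow> y k \<in> \<Sigma>" and yF: "\<And>k. k \<in> {1..d} \<Longrightarrow> y k \<in> F"
    and yH: "\<And>j k. j \<in> {1..d} \<Longrightarrow> k \<in> {1..d} \<Longrightarrow> j \<noteq> k \<Longrightarrow> y k \<in> H j"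
    and w: "w \<in> vertices \<Sigma>" "w \<notin> F" and dim: "DIM('a) = d"
  obtains a where "frame d w y a" "\<Sigma> = convex hull (insert w (y ` {1..d}))"
    "\<And>j. j \<in> {1..d} \<Longrightarrow> H j \<subseteq> {x. a j \<bullet> (x - w) = 0}"
proof -
  obtain C where C: "finite C" "\<not> affine_dependent C" "card C = d + 1" "\<Sigma> = convex hull C"
    using \<Sigma> unfolding simplex by (metis of_nat_1 of_nat_add of_nat_eq_iff)
  let ?h = "\<lambda>x. affine hull (C - {x})"
  define A where "A j = (if j = 0 then affine hull F else affine hull (H j))" for j :: nat
  have injh: "inj_on ?h C" by (rule affine_hull_omit_inj[OF C(2)])
  have "?h ` C = insert (affine hull F) {affine hull (H j) |j. j \<in> {1..d}}"
    using facet_affine_hulls[OF C(2)] hulls C(3,4) d by simp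
  also have "\<dots> = insert (A 0) (A ` {1..d})" unfolding A_def by auto
  also have "\<dots> = A ` {0..d}" by (metis atLeast0_atMost_Suc_eq_insert_0 image_insert atLeast0AtMost Icc_eq_insert_lb_nat One_nat_def le0)
  finally have hA: "?h ` C = A ` {0..d}" .
  have "card (A ` {0..d}) = card {0..d}"
    using card_image[OF injh] C(3) unfolding hA by simp
  then have injA: "inj_on A {0..d}" by (intro eq_card_imp_inj_on) auto
  have "\<forall>j\<in>{0..d}. \<exists>x. x \<in> C \<and> A j = ?h x" using hA by blast
  then obtain v where v: "\<And>j. j \<in> {0..d} \<Longrightarrow> v j \<in> C \<and> A j = ?h (v j)"
    using bchoice[of "{0..d}" "\<lambda>j x. x \<in> C \<and> A j = ?h x"] by blast
  have injv: "inj_on v {0..d}"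
  proof (rule inj_onI)
    fix j k assume jk: "j \<in> {0..d}" "k \<in> {0..d}" "v j = v k"
    then have "A j = A k" using v by metis
    then show "j = k" using injA jk by (auto dest: inj_onD)
  qed
  have "v ` {0..d} \<subseteq> C" using v by blast
  then have vC: "v ` {0..d} = C" using C card_image[OF injv] by (intro card_subset_eq) auto
  have z: "{0..d} = insert 0 {1..d}" by auto
  then have C_eq: "C = insert (v 0) (v ` {1..d})" using vC by simp
  have v0: "v 0 \<notin> v ` {1..d}"
    using injv by (auto dest!: inj_onD[of v _ 0])
  obtain a where fr: "frame d (v 0) v a"
  proof (rule frame_exists[OF dim])
    show "\<not> affine_dependent (insert (v 0) (v ` {1..d}))" using C C_eq by simp
    show "inj_on v {1..d}" using injv by (rule inj_on_subset) auto
  qed (use v0 in auto)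
  interpret V: frame d "v 0" v a by (rule fr)
  have yv: "y k = v k" if k: "k \<in> {1..d}" for k
  proof -
    have "y k \<in> A 0" using yF[OF k] by (simp add: A_def hull_inc)
    then have "y k \<in> affine hull (C - {v 0})" using v[of 0] by simp
    then have s1: "V.s (y k) = 1" using V.affine_hull_omit_w C_eq by auto
    have 0: "V.c j (y k) = 0" if j: "j \<in> {1..d}" "j \<noteq> k" for j
    proof -
      have "j \<in> {0..d}" "j \<noteq> 0" using j by auto
      have "y k \<in> A j" using yH[OF j(1) k j(2)] \<open>j \<noteq> 0\<close> by (simp add: A_def hull_inc)
      then have "y k \<in> affine hull (C - {v j})" using v[OF \<open>j \<in> {0..d}\<close>] by simp
      then show ?thesis using V.affine_hull_omit[OF j(1)] C_eq by auto
    qed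
    have "V.s (y k) = (\<Sum>j\<in>{k}. V.c j (y k))"
      unfolding V.s_def using 0 k by (intro sum.mono_neutral_right) auto
    then have "V.c k (y k) = 1" using s1 by simp
    then have "V.c j (y k) = V.c j (v k)" if "j \<in> {1..d}" for j
      using 0[OF that] V.c_y[OF that k] by (cases "j = k") auto
    then show ?thesis by (rule V.eq_if_coords)
  qed
  have "w \<in> C"
    using w C extreme_point_of_convex_hull_affine_independent[OF C(2)] by (simp add: vertices_def)
  moreover have "w \<notin> v ` {1..d}" using w(2) yF yv by force
  ultimately have w0: "w = v 0" using C_eq by blast
  have "frame d w y a"
  proof
    fix x
    have "(\<Sum>k\<in>{1..d}. (a k \<bullet> (x - w)) *\<^sub>R (y k - w)) = (\<Sum>k\<in>{1..d}. (a k \<bullet> (x - v 0)) *\<^sub>R (v k - v 0))"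
      by (rule sum.cong) (simp_all add: yv w0)
    then show "x = w + (\<Sum>k\<in>{1..d}. (a k \<bullet> (x - w)) *\<^sub>R (y k - w))"
      using V.expand[of x] w0 by simp
  next
    fix j k assume "j \<in> {1..d}" "k \<in> {1..d}"
    then show "a j \<bullet> (y k - w) = (if j = k then 1 else 0)" using V.dual yv w0 by simp
  qed
  moreover have "v ` {1..d} = y ` {1..d}" using yv by (intro image_cong) auto
  then have "\<Sigma> = convex hull (insert w (y ` {1..d}))" using C(4) C_eq w0 by simp
  moreover have "H j \<subseteq> {x. a j \<bullet> (x - w) = 0}" if j: "j \<in> {1..d}" for j
  proof -
    have "j \<in> {0..d}" "j \<noteq> 0" using j by auto
    have "H j \<subseteq> A j" using \<open>j \<noteq> 0\<close> by (simp add: A_def hull_subset)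
    also have "\<dots> = affine hull (C - {v j})" using v[OF \<open>j \<in> {0..d}\<close>] by simp
    also have "\<dots> \<subseteq> {x. V.c j x = 0}" using V.affine_hull_omit[OF j] C_eq by simp
    finally show ?thesis by (simp add: V.c_def w0)
  qed
  ultimately show ?thesis using that by blast
qed

lemma full_dim_if_proper_face:
  fixes P :: "'a::euclidean_space set"
  assumes "convex P" "G face_of P" "G \<noteq> P" "aff_dim G = int DIM('a) - 1"
  shows "aff_dim P = int DIM('a)"
  using face_of_aff_dim_lt[OF assms(1-3)] aff_dim_le_DIM[of P] assms(4) by simp

lemma (in frame) aff_dim_hull_y: "aff_dim (convex hull (y ` {1..d})) = int d - 1"
  using aff_dim_hull_image[OF affine_independent_y inj_y order_refl] by simp

lemma ridge_facet_mem:
  fixes P :: "'a::euclidean_space set"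
  assumes P: "DIM('a) = d" "2 \<le> d" "polytope P" "convex hull (u ` {1..d}) facet_of P"
    "(int d - 1) simplex (convex hull (u ` {1..d}))" and jk: "j \<in> {1..d}" "k \<in> {1..d}"
  shows "u k \<in> ridge_facet d P u j \<longleftrightarrow> k \<noteq> j"
proof -
  obtain p a where fr: "frame d p u a" using facet_frame[OF P(1,3-5)] .
  interpret frame d p u a by (rule fr)
  have "u k \<in> convex hull (u ` {1..d})" using jk by (simp add: hull_inc)
  then have "u k \<in> ridge_facet d P u j \<longleftrightarrow> u k \<in> convex hull (u ` ({1..d} - {j}))"
    using ridge_facet(2)[OF P jk(1)] by blast
  also have "\<dots> \<longleftrightarrow> k \<noteq> j"
  proof
    assume "u k \<in> convex hull (u ` ({1..d} - {j}))"
    moreover have "j \<in> {1..d} - ({1..d} - {j})" using jk by simp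
    ultimately have "c j (u k) = 0" by (subst (asm) hull_y) auto
    then show "k \<noteq> j" using c_y[OF jk] by auto
  qed (use jk in \<open>simp add: hull_inc\<close>)
  finally show ?thesis .
qed

text \<open>The homogenized slacks of the \<open>d + 1\<close> chosen facets serve as homogeneous
  barycentric coordinates of a standard simplex: they are nonnegative on \<open>P1\<close>, and each
  facet lands in a coordinate hyperplane.\<close>

lemma merge_exists:
  fixes P1 P2 :: "'a::euclidean_space set"
  assumes dim: "DIM('a) = d" and d: "2 \<le> d" and P1: "polytope P1"
    and F: "convex hull (u ` {1..d}) facet_of P1" and simplex: "(int d - 1) simplex (convex hull (u ` {1..d}))"
    and fr: "frame d v u' a'"
  shows "\<exists>Q. is_merge d P1 u P2 v u' Q"
proof -
  let ?F = "convex hull (u ` {1..d})" and ?H = "ridge_facet d P1 u"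
  have ph: "polyhedron P1" using P1 polytope_imp_polyhedron by blast
  note H = ridge_facet[OF dim d P1 F simplex]
  note uH = ridge_facet_mem[OF dim d P1 F simplex]
  define T where "T j = (if j = 0 then ?F else ?H j)" for j :: nat
  have "\<forall>j\<in>{0..d}. T j facet_of P1"
  proof
    fix j assume "j \<in> {0..d}"
    then show "T j facet_of P1" using F H(1)[of j] by (cases "j = 0") (auto simp: T_def)
  qed
  then have "\<forall>j\<in>{0..d}. \<exists>n b. P1 \<subseteq> {x. n \<bullet> x \<le> b} \<and> T j = P1 \<inter> {x. n \<bullet> x = b}"
    using facet_of_polyhedron[OF ph] by metis
  from bchoice[OF this] obtain n where "\<forall>j\<in>{0..d}. \<exists>b. P1 \<subseteq> {x. n j \<bullet> x \<le> b} \<and> T j = P1 \<inter> {x. n j \<bullet> x = b}"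
    by blast
  from bchoice[OF this] obtain b where
    nb: "\<And>j. j \<in> {0..d} \<Longrightarrow> P1 \<subseteq> {x. n j \<bullet> x \<le> b j} \<and> T j = P1 \<inter> {x. n j \<bullet> x = b j}"
    by blast
  define g where "g j z = b j * snd z - n j \<bullet> fst z" for j and z :: "'a \<times> real"
  have lin_g: "linear (g j)" for j
    unfolding g_def by (rule linearI) (simp_all add: inner_add_right algebra_simps)
  have g_nonneg: "0 \<le> g j (x, 1)" if "j \<in> {0..d}" "x \<in> P1" for j x
    using nb[OF that(1)] that(2) by (auto simp: g_def)
  have g_zero: "g j (x, 1) = 0 \<longleftrightarrow> x \<in> T j" if "j \<in> {0..d}" "x \<in> P1" for j x
    using nb[OF that(1)] that(2) by (auto simp: g_def)
  have uF: "u k \<in> ?F" if "k \<in> {1..d}" for k using that by (simp add: hull_inc)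
  have uP: "u k \<in> P1" if "k \<in> {1..d}" for k using uF[OF that] facet_of_imp_subset[OF F] by blast
  have g0u: "g 0 (u k, 1) = 0" if "k \<in> {1..d}" for k
    using g_zero[of 0 "u k"] uP[OF that] uF[OF that] by (simp add: T_def)
  have gu: "g j (u k, 1) = 0 \<longleftrightarrow> j \<noteq> k" if "j \<in> {1..d}" "k \<in> {1..d}" for j k
    using g_zero[of j "u k"] uP[OF that(2)] uH[OF that] that by (auto simp: T_def)
  have gpos: "0 < g k (u k, 1)" if "k \<in> {1..d}" for k
  proof -
    have "g k (u k, 1) \<noteq> 0" using gu[OF that that] by simp
    moreover have "0 \<le> g k (u k, 1)" using g_nonneg[of k "u k"] uP[OF that] that by simp
    ultimately show ?thesis by linarith
  qed
  obtain e where e: "bij_betw e {1..d} (Basis :: 'a set)"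
    using ex_bij_betw_nat_finite_1[OF finite_Basis[where 'a='a]] dim by auto
  have eB: "e k \<in> Basis" if "k \<in> {1..d}" for k using bij_betwE[OF e] that by blast
  have e_inner: "e j \<bullet> e k = (if j = k then 1 else 0)" if "j \<in> {1..d}" "k \<in> {1..d}" for j k
    using inner_Basis[OF eB[OF that(1)] eB[OF that(2)]] inj_on_eq_iff[OF bij_betw_imp_inj_on[OF e] that] by simp
  have e_frame: "frame d 0 e e"
  proof
    fix x :: 'a
    have "x = (\<Sum>b\<in>Basis. (x \<bullet> b) *\<^sub>R b)" by (simp add: euclidean_representation)
    also have "\<dots> = (\<Sum>k\<in>{1..d}. (x \<bullet> e k) *\<^sub>R e k)"
      by (rule sum.reindex_bij_betw[OF e, symmetric])
    finally show "x = 0 + (\<Sum>k\<in>{1..d}. (e k \<bullet> (x - 0)) *\<^sub>R (e k - 0))" by (simp add: inner_commute)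
  qed (simp add: e_inner)
  interpret E: frame d 0 e e by (rule e_frame)
  have Ec: "E.c k x = e k \<bullet> x" for k x by (simp add: E.c_def)
  \<comment> \<open>The last coordinate is the sum of all slacks, so after division
    \<open>g k\<close> becomes the weight of \<open>e k\<close> and \<open>g 0\<close> the weight of
    the vertex 0 opposite to the image of \<open>?F\<close>.\<close>
  define L where "L z = ((\<Sum>k\<in>{1..d}. g k z *\<^sub>R e k), (\<Sum>k\<in>{1..d}. g k z) + g 0 z)" for z
  have linL: "linear L"
  proof (rule linearI)
    fix x z and r :: real
    show "L (x + z) = L x + L z"
      by (simp add: L_def linear_add[OF lin_g] scaleR_add_left sum.distrib)
    show "L (r *\<^sub>R x) = r *\<^sub>R L x"
      by (simp add: L_def linear_scale[OF lin_g] scaleR_sum_right sum_distrib_left distrib_left)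
  qed
  have single: "(\<Sum>j\<in>{1..d}. g j (u k, 1) *\<^sub>R e j) = g k (u k, 1) *\<^sub>R e k"
    "(\<Sum>j\<in>{1..d}. g j (u k, 1)) = g k (u k, 1)" if k: "k \<in> {1..d}" for k
  proof -
    have "(\<Sum>j\<in>{1..d}. g j (u k, 1) *\<^sub>R e j) = (\<Sum>j\<in>{k}. g j (u k, 1) *\<^sub>R e j)"
      using gu[OF _ k] k by (intro sum.mono_neutral_right) auto
    then show "(\<Sum>j\<in>{1..d}. g j (u k, 1) *\<^sub>R e j) = g k (u k, 1) *\<^sub>R e k" by simp
    have "(\<Sum>j\<in>{1..d}. g j (u k, 1)) = (\<Sum>j\<in>{k}. g j (u k, 1))"
      using gu[OF _ k] k by (intro sum.mono_neutral_right) auto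
    then show "(\<Sum>j\<in>{1..d}. g j (u k, 1)) = g k (u k, 1)" by simp
  qed
  have Lu: "L (u k, 1) = g k (u k, 1) *\<^sub>R (e k, 1)" if k: "k \<in> {1..d}" for k
    using single[OF k] g0u[OF k] by (simp add: L_def)
  obtain p where p: "p \<in> P1" "p \<notin> ?F" using facet_frame[OF dim P1 F simplex] by blast
  have "0 \<noteq> g 0 (p, 1)" using g_zero[of 0 p] p by (auto simp: T_def)
  have sub: "subspace (range L)" using linL by (simp add: linear_subspace_image)
  have ek: "(e k, 1) \<in> range L" if k: "k \<in> {1..d}" for k
  proof -
    have "L ((1 / g k (u k, 1)) *\<^sub>R (u k, 1)) = (e k, 1)"
      using gpos[OF k] by (simp only: linear_scale[OF linL] Lu[OF k] scaleR_scaleR) simp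
    then show ?thesis by (metis rangeI)
  qed
  \<comment> \<open>What remains is the slack of \<open>?F\<close> at \<open>p\<close>, nonzero as
    \<open>p\<close> is off \<open>?F\<close>; it yields the direction missing for
    surjectivity.\<close>
  have "L (p, 1) - (\<Sum>k\<in>{1..d}. g k (p, 1) *\<^sub>R (e k, 1)) \<in> range L"
    using ek by (intro subspace_diff[OF sub] subspace_sum[OF sub] subspace_scale[OF sub]) auto
  also have "L (p, 1) - (\<Sum>k\<in>{1..d}. g k (p, 1) *\<^sub>R (e k, 1)) = (0, g 0 (p, 1))"
    by (simp add: L_def prod_eq_iff fst_sum snd_sum)
  finally have "(1 / g 0 (p, 1)) *\<^sub>R (0, g 0 (p, 1)) \<in> range L" by (rule subspace_scale[OF sub])
  then have e0: "(0, 1) \<in> range L" using \<open>0 \<noteq> g 0 (p, 1)\<close> by simp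
  have "surj L"
  proof -
    have "(x, t) \<in> range L" for x :: 'a and t :: real
    proof -
      have "(\<Sum>k\<in>{1..d}. (e k \<bullet> x) *\<^sub>R (e k, 1)) + (t - (\<Sum>k\<in>{1..d}. e k \<bullet> x)) *\<^sub>R (0, 1) \<in> range L"
        using ek e0 by (intro subspace_add[OF sub] subspace_sum[OF sub] subspace_scale[OF sub]) auto
      also have "(\<Sum>k\<in>{1..d}. (e k \<bullet> x) *\<^sub>R (e k, 1)) + (t - (\<Sum>k\<in>{1..d}. e k \<bullet> x)) *\<^sub>R (0, 1) = (x, t)"
        using E.expand[of x] by (simp add: prod_eq_iff fst_sum snd_sum)
      finally show ?thesis .
    qed
    then show ?thesis by auto
  qed
  then have "inj L" using linear_surjective_imp_injective[OF linL] by blast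
  then have bijL: "bij L" using \<open>surj L\<close> by (simp add: bij_def)
  \<comment> \<open>A vanishing sum of nonnegative slacks makes all of them vanish, so
    \<open>L (x, 1) = 0\<close> against injectivity.\<close>
  have L0: "snd (L (x, 1)) \<noteq> 0" if x: "x \<in> P1" for x
  proof
    assume "snd (L (x, 1)) = 0"
    moreover have "0 \<le> (\<Sum>k\<in>{1..d}. g k (x, 1))" "0 \<le> g 0 (x, 1)"
      using g_nonneg x by (auto intro: sum_nonneg)
    ultimately have "(\<Sum>k\<in>{1..d}. g k (x, 1)) = 0" "g 0 (x, 1) = 0" by (simp_all add: L_def)
    then have "\<forall>k\<in>{1..d}. g k (x, 1) = 0"
      using g_nonneg x by (subst (asm) sum_nonneg_eq_0_iff) auto
    then have "L (x, 1) = 0" using \<open>g 0 (x, 1) = 0\<close> by (simp add: L_def zero_prod_def)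
    then have "(x, 1::real) = 0" using \<open>inj L\<close> linear_0[OF linL] by (metis injD)
    then show False by (simp add: zero_prod_def)
  qed
  define \<phi> where "\<phi> = proj_map L"
  have proj: "projective_on P1 \<phi>" unfolding projective_on_def using linL bijL L0 \<phi>_def by blast
  have iso: "segment_iso P1 \<phi>" by (rule projective_segment_iso[OF proj polytope_imp_convex[OF P1]])
  have \<phi>u: "\<phi> (u k) = e k" if k: "k \<in> {1..d}" for k
    using gpos[OF k] by (simp add: \<phi>_def proj_map_def Lu[OF k])
  have uimg: "\<phi> ` u ` {1..d} = e ` {1..d}" unfolding image_image using \<phi>u by (intro image_cong) auto
  have "u ` {1..d} \<subseteq> P1" using uP by blast
  then have \<phi>F: "\<phi> ` ?F = convex hull (e ` {1..d})"
    using iso_hull[OF iso, of "u ` {1..d}"] uimg by simp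
  let ?C = "insert 0 (e ` {1..d})"
  have cardC: "card ?C = d + 1"
    using E.w_notin[OF order_refl] card_image[OF E.inj_y] by simp
  define \<Sigma> where "\<Sigma> = convex hull ?C"
  have snd_eq: "snd (L (x, 1)) = (\<Sum>k\<in>{1..d}. g k (x, 1)) + g 0 (x, 1)" for x by (simp add: L_def)
  have snd_pos: "0 < snd (L (x, 1))" if x: "x \<in> P1" for x
  proof -
    have "0 \<le> snd (L (x, 1))" unfolding snd_eq using g_nonneg x by (intro add_nonneg_nonneg sum_nonneg) auto
    then show ?thesis using L0[OF x] by simp
  qed
  have \<phi>c: "E.c k (\<phi> x) = g k (x, 1) / snd (L (x, 1))" if k: "k \<in> {1..d}" for k x
  proof -
    have "e k \<bullet> fst (L (x, 1)) = (\<Sum>j\<in>{1..d}. g j (x, 1) * (if k = j then 1 else 0))"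
      using k e_inner by (simp add: L_def inner_sum_right)
    also have "\<dots> = g k (x, 1)" using k by (simp add: if_distrib cong: if_cong)
    finally show ?thesis by (simp add: Ec \<phi>_def proj_map_def divide_inverse mult.commute)
  qed
  have sub\<Sigma>: "\<phi> ` P1 \<subseteq> \<Sigma>"
  proof
    fix z assume "z \<in> \<phi> ` P1"
    then obtain x where x: "x \<in> P1" "z = \<phi> x" by blast
    have "E.s (\<phi> x) = (\<Sum>k\<in>{1..d}. g k (x, 1)) / snd (L (x, 1))"
      unfolding E.s_def using \<phi>c by (simp add: sum_divide_distrib)
    also have "\<dots> \<le> 1" using snd_pos[OF x(1)] g_nonneg[of 0 x] x snd_eq[of x] by simp
    finally have "E.s z \<le> 1" using x by simp
    show "z \<in> \<Sigma>"
      unfolding \<Sigma>_def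
    proof (rule E.in_convex)
      show "0 \<le> E.c k z" if "k \<in> {1..d}" for k
        using \<phi>c[OF that, of x] x g_nonneg[of k x] snd_pos[OF x(1)] that by simp
    qed (simp_all add: hull_inc \<open>E.s z \<le> 1\<close>)
  qed
  have R1: "polytope (\<phi> ` P1)" using iso_polytope[OF iso P1] .
  have FR: "convex hull (e ` {1..d}) facet_of \<phi> ` P1"
    using iso_facet[OF iso P1 facet_of_imp_subset[OF F]] F \<phi>F by simp
  then have "convex hull (e ` {1..d}) \<noteq> \<phi> ` P1" using facet_of_irrefl by metis
  then have full: "aff_dim (\<phi> ` P1) = int d"
    using full_dim_if_proper_face[OF polytope_imp_convex[OF R1] facet_of_imp_face_of[OF FR]]
      E.aff_dim_hull_y dim by simp
  have hullH: "affine hull (\<phi> ` ?H j) = affine hull (?C - {e j})" if j: "j \<in> {1..d}" for j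
  proof -
    have e0: "e j \<noteq> 0" using eB[OF j] nonzero_Basis by blast
    have HR: "\<phi> ` ?H j facet_of \<phi> ` P1"
      using iso_facet[OF iso P1 facet_of_imp_subset[OF H(1)[OF j]]] H(1)[OF j] by simp
    have "\<phi> ` ?H j \<subseteq> {x. e j \<bullet> x = 0}"
    proof
      fix z assume "z \<in> \<phi> ` ?H j"
      then obtain x where x: "x \<in> ?H j" "z = \<phi> x" by blast
      then have "x \<in> P1" using facet_of_imp_subset[OF H(1)[OF j]] by blast
      then have "g j (x, 1) = 0" using g_zero[of j x] x j by (simp add: T_def)
      then show "z \<in> {x. e j \<bullet> x = 0}" using \<phi>c[OF j, of x] x Ec by simp
    qed
    then have "affine hull (\<phi> ` ?H j) = {x. e j \<bullet> x = 0}"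
      using HR full dim e0 by (intro affine_hull_eq_hyperplane) (auto simp: facet_of_def)
    moreover have "affine hull (?C - {e j}) = {x. e j \<bullet> x = 0}"
    proof (rule affine_hull_eq_hyperplane[OF e0])
      show "?C - {e j} \<subseteq> {x. e j \<bullet> x = 0}"
      proof -
        have "?C - {e j} \<subseteq> affine hull (?C - {e j})" by (rule hull_subset)
        also have "\<dots> \<subseteq> {x. E.c j x = 0}" by (rule E.affine_hull_omit[OF j])
        finally show ?thesis by (simp only: Ec)
      qed
      have "\<not> affine_dependent (?C - {e j})"
        by (rule affine_independent_subset[OF E.affine_independent Diff_subset])
      then have "aff_dim (?C - {e j}) = int (card (?C - {e j})) - 1" by (simp only: affine_independent_iff_card)
      also have "card (?C - {e j}) = d" using cardC j by (subst card_Diff_singleton) auto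
      finally show "aff_dim (?C - {e j}) = int DIM('a) - 1" using dim by simp
      have "0 \<in> ?C - {e j}" using e0[symmetric] by simp
      then show "?C - {e j} \<noteq> {}" by (metis empty_iff)
    qed
    ultimately show ?thesis by simp
  qed
  have "{affine hull G |G. G facet_of \<Sigma>} = (\<lambda>x. affine hull (?C - {x})) ` ?C"
    unfolding \<Sigma>_def using E.affine_independent cardC d by (intro facet_affine_hulls) auto
  also have "\<dots> = insert (affine hull (?C - {0})) ((\<lambda>j. affine hull (?C - {e j})) ` {1..d})"
    by (simp only: image_insert image_image)
  also have "?C - {0} = e ` {1..d}" using E.w_notin[OF order_refl] by auto
  also have "affine hull (e ` {1..d}) = affine hull (\<phi> ` ?F)" by (simp add: \<phi>F affine_hull_convex_hull)
  also have "(\<lambda>j. affine hull (?C - {e j})) ` {1..d} = (\<lambda>j. affine hull (\<phi> ` ?H j)) ` {1..d}"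
    using hullH by (intro image_cong) auto
  also have "\<dots> = {affine hull (\<phi> ` ?H j) |j. j \<in> {1..d}}" by blast
  finally have hulls: "{affine hull G |G. G facet_of \<Sigma>} =
    insert (affine hull (\<phi> ` ?F)) {affine hull (\<phi> ` ?H j) |j. j \<in> {1..d}}" .
  have simp\<Sigma>: "int d simplex \<Sigma>"
    unfolding \<Sigma>_def using E.affine_independent cardC by (intro simplex_convex_hull) simp
  have w: "0 \<in> vertices \<Sigma>"
    unfolding vertices_def \<Sigma>_def using extreme_point_of_convex_hull_affine_independent[OF E.affine_independent] by simp
  have wF: "0 \<notin> \<phi> ` ?F"
  proof
    assume "0 \<in> \<phi> ` ?F"
    then have "E.s 0 = 1" using \<phi>F E.hull_y[OF order_refl] by auto
    then show False by simp
  qed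
  interpret V: frame d v u' a' by (rule fr)
  \<comment> \<open>The linear map with \<open>u' k - v\<close> going to \<open>e k\<close>; the
    shift in \<open>\<alpha>\<close> sends \<open>v\<close> to 0.\<close>
  define h where "h x = (\<Sum>k\<in>{1..d}. (a' k \<bullet> x) *\<^sub>R e k)" for x
  have linh: "linear h"
    unfolding h_def by (rule linearI) (simp_all add: inner_add_right scaleR_add_left sum.distrib scaleR_sum_right)
  define \<alpha> where "\<alpha> x = h x + - h v" for x
  have "affine_map \<alpha>" unfolding affine_map_def \<alpha>_def using linh by blast
  moreover have "\<alpha> v = 0" by (simp add: \<alpha>_def)
  moreover have "\<alpha> (u' k) = \<phi> (u k)" if k: "k \<in> {1..d}" for k
  proof -
    have "\<alpha> (u' k) = h (u' k - v)" by (simp add: \<alpha>_def linear_diff[OF linh])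
    also have "\<dots> = (\<Sum>j\<in>{1..d}. (if j = k then 1 else 0) *\<^sub>R e j)"
      unfolding h_def using V.dual k by (intro sum.cong) auto
    also have "\<dots> = (\<Sum>j\<in>{k}. (if j = k then 1 else 0) *\<^sub>R e j)"
      using k by (intro sum.mono_neutral_right) auto
    also have "\<dots> = e k" by simp
    finally show ?thesis using \<phi>u[OF k] by simp
  qed
  ultimately show ?thesis
    unfolding is_merge_def using proj simp\<Sigma> hulls sub\<Sigma> w wF by blast
qed

section \<open>The face lattice of a merge\<close>

text \<open>Keeping only \<open>i\<close> of the equations gives a face of dimension
  \<open>d - i\<close>, which is a simplex. Its \<open>d - i + 1\<close> vertices are already found:
  \<open>w\<close> and the \<open>y k\<close> with \<open>k\<close> outside \<open>S0\<close>. Hence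
  it lies in the hull of \<open>w\<close> and the \<open>y k\<close>, where
  \<open>s \<le> 1\<close>.\<close>

lemma (in corner) simplicial_corner_face:
  assumes simplicial: "j_simplicial (d - i) P" and i: "i \<le> d"
    and w_ext: "w extreme_point_of P" and y_ext: "\<And>k. k \<in> {1..d} \<Longrightarrow> y k extreme_point_of P"
    and S: "S \<subseteq> {1..d}" "i \<le> card S" and x: "x \<in> corner_face S"
  shows "s x \<le> 1"
proof -
  obtain S0 where S0: "S0 \<subseteq> S" "card S0 = i" using obtain_subset_with_card_n[OF S(2)] by blast
  have S0d: "S0 \<subseteq> {1..d}" using S0 S by blast
  have face: "corner_face S0 face_of P" by (rule face_of_corner_face[OF S0d])
  have "aff_dim (corner_face S0) = int (d - i)"
    using aff_dim_corner_face[OF S0d] S0 i by (simp add: of_nat_diff)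
  then have "int (d - i) simplex corner_face S0" using simplicial face unfolding j_simplicial_def by blast
  then obtain C where C: "finite C" "\<not> affine_dependent C" "int (card C) = int (d - i) + 1" "corner_face S0 = convex hull C"
    unfolding simplex by blast
  let ?V = "insert w (y ` ({1..d} - S0))"
  have "?V \<subseteq> C"
  proof
    fix z assume z: "z \<in> ?V"
    then have "z extreme_point_of P" using w_ext y_ext by auto
    moreover have "z \<in> corner_face S0" using z w_in_corner_face y_in_corner_face[OF _ S0d] by auto
    ultimately have "z extreme_point_of (convex hull C)" using extreme_point_of_face[OF face] C(4) by simp
    then show "z \<in> C" using extreme_point_of_convex_hull_affine_independent[OF C(2)] by simp
  qed
  moreover have "card ?V = Suc (d - i)"
  proof -
    have "card ?V = Suc (card (y ` ({1..d} - S0)))"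
      using w_notin[of "{1..d} - S0"] by (subst card_insert_disjoint) auto
    also have "card (y ` ({1..d} - S0)) = card ({1..d} - S0)"
      by (rule card_image) (rule inj_on_subset[OF inj_y], blast)
    also have "\<dots> = d - i" using S0 S0d by (simp add: card_Diff_subset finite_subset)
    finally show ?thesis .
  qed
  ultimately have "?V = C" using C by (intro card_seteq) auto
  moreover have "x \<in> corner_face S0" using x S0 by (auto simp: corner_face_def)
  ultimately have "x \<in> convex hull ?V" using C by simp
  moreover have "convex hull ?V \<subseteq> convex hull (insert w (y ` {1..d}))" by (rule hull_mono) blast
  ultimately show ?thesis using simplex_coords(1) by blast
qed

lemma affine_segment_iso:
  fixes P :: "'a::euclidean_space set"
  assumes "linear h" "inj h" "convex P"
  shows "segment_iso P (\<lambda>x. h x + b)"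
proof -
  have "(\<lambda>x. h x + b) ` open_segment p q = open_segment (h p + b) (h q + b)" for p q
  proof -
    have "(\<lambda>x. h x + b) ` open_segment p q = (+) b ` h ` open_segment p q"
      by (simp add: image_image add.commute)
    also have "\<dots> = (+) b ` open_segment (h p) (h q)"
      using open_segment_linear_image[OF assms(1,2)] by simp
    also have "\<dots> = open_segment (b + h p) (b + h q)" by (simp add: open_segment_translation)
    finally show ?thesis by (simp add: add.commute)
  qed
  moreover have "inj_on (\<lambda>x. h x + b) P" using assms(2) by (auto simp: inj_on_def)
  ultimately show ?thesis using assms(3) by (simp add: segment_iso_def)
qed

text \<open>Enlarge \<open>S\<close> to a set \<open>S0\<close> of \<open>i\<close> indices. The
  remaining \<open>u k\<close> span a face of dimension \<open>d - i - 1\<close>, which is in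
  exactly \<open>i + 1\<close> facets; \<open>?F\<close> and the \<open>?H k\<close> with
  \<open>k\<close> in \<open>S0\<close> are that many distinct ones, so \<open>T\<close> is among
  them.\<close>

lemma simple_facets:
  fixes P :: "'a::euclidean_space set"
  assumes P: "DIM('a) = d" "2 \<le> d" "polytope P" "convex hull (u ` {1..d}) facet_of P"
    "(int d - 1) simplex (convex hull (u ` {1..d}))"
    and full: "aff_dim P = int d" and simple: "i_simple i P" and i: "i < d"
    and S: "S \<subseteq> {1..d}" "card S \<le> i" and T: "T facet_of P" "\<forall>k\<in>{1..d} - S. u k \<in> T"
  shows "T = convex hull (u ` {1..d}) \<or> (\<exists>k\<in>S. T = ridge_facet d P u k)"
proof -
  let ?F = "convex hull (u ` {1..d})" and ?H = "ridge_facet d P u"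
  note H = ridge_facet(1)[OF P] and uH = ridge_facet_mem[OF P]
  note ind = simplex_hull_independent[OF P(5)]
  obtain S0 where S0: "S \<subseteq> S0" "S0 \<subseteq> {1..d}" "card S0 = i"
    using exists_subset_between[of S i "{1..d}"] S i by auto
  let ?\<sigma> = "convex hull (u ` ({1..d} - S0))"
  have "?\<sigma> face_of ?F" unfolding face_of_hull_image[OF ind(1)] by blast
  then have face: "?\<sigma> face_of P" using face_of_trans facet_of_imp_face_of[OF P(4)] by blast
  have "aff_dim ?\<sigma> = int (card ({1..d} - S0)) - 1" by (rule aff_dim_hull_image[OF ind]) blast
  also have "card ({1..d} - S0) = d - i" using S0 by (simp add: card_Diff_subset finite_subset)
  finally have "aff_dim ?\<sigma> = aff_dim P - int i - 1" using full i by (simp add: of_nat_diff)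
  then have card: "card {G. G facet_of P \<and> ?\<sigma> \<subseteq> G} = i + 1"
    using simple face unfolding i_simple_def by blast
  have injH: "inj_on ?H S0"
  proof (rule inj_onI)
    fix j k assume jk: "j \<in> S0" "k \<in> S0" "?H j = ?H k"
    then have "j \<in> {1..d}" "k \<in> {1..d}" using S0 by auto
    then show "j = k" using uH[of j j] uH[of k j] jk(3) by auto
  qed
  have "u k \<in> ?F" if "k \<in> {1..d}" for k using that by (simp add: hull_inc)
  then have "?F \<notin> ?H ` S0" using uH S0(2) by blast
  moreover have "finite S0" using S0(2) finite_subset by blast
  ultimately have "card (insert ?F (?H ` S0)) = i + 1" using card_image[OF injH] S0(3) by simp
  moreover have "insert ?F (?H ` S0) \<subseteq> {G. G facet_of P \<and> ?\<sigma> \<subseteq> G}"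
  proof -
    have "?\<sigma> \<subseteq> ?F" by (rule hull_mono) blast
    moreover have "?\<sigma> \<subseteq> ?H k" if "k \<in> S0" for k
    proof (rule hull_minimal)
      have kd: "k \<in> {1..d}" using that S0(2) by blast
      show "convex (?H k)" using face_of_imp_convex[OF facet_of_imp_face_of[OF H[OF kd]]] .
      show "u ` ({1..d} - S0) \<subseteq> ?H k" using uH[OF kd] that by auto
    qed
    ultimately show ?thesis using P(4) H S0(2) by blast
  qed
  moreover have "finite {G. G facet_of P \<and> ?\<sigma> \<subseteq> G}" by (rule card_ge_0_finite) (simp add: card)
  ultimately have eq: "insert ?F (?H ` S0) = {G. G facet_of P \<and> ?\<sigma> \<subseteq> G}"
    using card by (intro card_subset_eq) auto
  have "?\<sigma> \<subseteq> T"
  proof (rule hull_minimal)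
    show "u ` ({1..d} - S0) \<subseteq> T" using T(2) S0(1) by blast
    show "convex T" using face_of_imp_convex[OF facet_of_imp_face_of[OF T(1)]] .
  qed
  then have "T \<in> insert ?F (?H ` S0)" using T(1) eq by blast
  then consider "T = ?F" | k where "k \<in> S0" "T = ?H k" by blast
  then show ?thesis
  proof cases
    case 2
    have kd: "k \<in> {1..d}" using 2 S0(2) by blast
    \<comment> \<open>Indices added in \<open>S0\<close> are excluded: \<open>T\<close> contains
      \<open>u k\<close>, but \<open>?H k\<close> does not.\<close>
    have "k \<in> S"
    proof (rule ccontr)
      assume "k \<notin> S"
      then have "u k \<in> ?H k" using T(2) kd 2 by blast
      then show False using uH[OF kd kd] by simp
    qed
    then show ?thesis using 2 by blast
  qed simp
qed

lemma merge_lattice: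
  fixes P1 P2 :: "'a::euclidean_space set"
  assumes dim: "DIM('a) = d" and d: "2 \<le> d" and i: "i < d"
    and P1: "polytope P1" "aff_dim P1 = int d" "i_simple i P1"
    and P2: "polytope P2" "aff_dim P2 = int d" "j_simplicial (d - i) P2"
    and F: "convex hull (u ` {1..d}) facet_of P1" and simplex: "(int d - 1) simplex (convex hull (u ` {1..d}))"
    and v: "simple_vertex d P2 v" and u': "bij_betw u' {1..d} (neighbours P2 v)"
    and merge: "is_merge d P1 u P2 v u' Q"
  shows "order_isomorphic (merge_poset d i P1 u P2 v u') class_less (face_lattice Q) (\<subset>)"
proof -
  let ?F = "convex hull (u ` {1..d})"
  define H where "H = ridge_facet d P1 u"
  note facetH = ridge_facet(1)[OF dim d P1(1) F simplex, folded H_def]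
  note uH = ridge_facet_mem[OF dim d P1(1) F simplex, folded H_def]
  note ind = simplex_hull_independent[OF simplex]
  obtain \<phi> \<Sigma> w \<alpha> where proj: "projective_on P1 \<phi>" and \<Sigma>: "int d simplex \<Sigma>"
    and hulls: "{affine hull G | G. G facet_of \<Sigma>} =
          insert (affine hull (\<phi> ` ?F)) {affine hull (\<phi> ` H j) | j. j \<in> {1..d}}"
    and sub\<Sigma>: "\<phi> ` P1 \<subseteq> \<Sigma>" and w: "w \<in> vertices \<Sigma>" "w \<notin> \<phi> ` ?F"
    and aff: "affine_map \<alpha>" and \<alpha>v: "\<alpha> v = w" and \<alpha>u: "\<forall>k\<in>{1..d}. \<alpha> (u' k) = \<phi> (u k)"
    and Q: "Q = \<phi> ` P1 \<union> convex hull (vertices (\<alpha> ` P2) - {w})"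
    using merge unfolding is_merge_def H_def by blast
  define y where "y k = \<phi> (u k)" for k
  have iso1: "segment_iso P1 \<phi>" by (rule projective_segment_iso[OF proj polytope_imp_convex[OF P1(1)]])
  have uF: "u k \<in> ?F" if "k \<in> {1..d}" for k using that by (simp add: hull_inc)
  have FP: "?F \<subseteq> P1" by (rule facet_of_imp_subset[OF F])
  have uP: "u ` {1..d} \<subseteq> P1" using uF FP by blast
  have \<phi>hull: "\<phi> ` (convex hull (u ` S)) = convex hull (y ` S)" if "S \<subseteq> {1..d}" for S
  proof -
    have "u ` S \<subseteq> P1" using uP that by blast
    then show ?thesis using iso_hull[OF iso1] by (simp add: image_image y_def)
  qed
  have hullP: "convex hull (u ` S) \<subseteq> P1" if "S \<subseteq> {1..d}" for S
    using hull_mono[of "u ` S" "u ` {1..d}" convex] that FP by blast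
  obtain a where fr: "frame d w y a" and \<Sigma>eq: "\<Sigma> = convex hull (insert w (y ` {1..d}))"
    and Hsub: "\<And>j. j \<in> {1..d} \<Longrightarrow> \<phi> ` H j \<subseteq> {x. a j \<bullet> (x - w) = 0}"
  proof (rule merge_simplex_frame[OF _ \<Sigma> hulls])
    show "1 \<le> d" using d by simp
    show "y k \<in> \<Sigma>" if "k \<in> {1..d}" for k using sub\<Sigma> uP that unfolding y_def by blast
    show "y k \<in> \<phi> ` ?F" if "k \<in> {1..d}" for k using uF[OF that] by (simp add: y_def)
    show "y k \<in> \<phi> ` H j" if "j \<in> {1..d}" "k \<in> {1..d}" "j \<noteq> k" for j k
      using uH[OF that(1,2)] that(3) by (simp add: y_def)
  qed (use w dim in auto)
  interpret W: frame d w y a by (rule fr)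
  obtain a' where fr': "frame d v u' a'" and nonneg': "\<And>k x. k \<in> {1..d} \<Longrightarrow> x \<in> P2 \<Longrightarrow> 0 \<le> a' k \<bullet> (x - v)"
  proof -
    have "aff_dim P2 = int DIM('a)" using P2(2) dim by simp
    from simple_vertex_frame[OF P2(1) this dim v u'] show ?thesis using that by blast
  qed
  interpret V: frame d v u' a' by (rule fr')
  have vext: "v extreme_point_of P2" using v by (simp add: simple_vertex_def vertices_def)
  have nb: "u' k \<in> neighbours P2 v" if "k \<in> {1..d}" for k using bij_betwE[OF u'] that by blast
  have u'ext: "u' k extreme_point_of P2" if "k \<in> {1..d}" for k
    using nb[OF that] by (simp add: neighbours_def vertices_def)
  have edges: "closed_segment v (u' k) edge_of P2" if "k \<in> {1..d}" for k
    using nb[OF that] by (simp add: neighbours_def)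
  interpret V: corner d v u' a' P2
  proof
    show "convex P2" using P2(1) polytope_imp_convex by blast
    show "v \<in> P2" using vext by (simp add: extreme_point_of_def)
    show "u' k \<in> P2" if "k \<in> {1..d}" for k using u'ext[OF that] by (simp add: extreme_point_of_def)
    show "0 \<le> V.c k x" if "k \<in> {1..d}" "x \<in> P2" for k x using nonneg'[OF that] by (simp add: V.c_def)
  qed
  obtain h b where h: "linear h" "\<alpha> = (\<lambda>x. h x + b)" using aff unfolding affine_map_def by blast
  \<comment> \<open>An affine map is determined by its values at \<open>v\<close> and the
    \<open>u' k\<close>, so \<open>\<alpha>\<close> carries coordinates to equal coordinates. This
    also yields injectivity, which \<open>affine_map\<close> does not include.\<close>
  have \<alpha>_eq: "\<alpha> x = w + (\<Sum>k\<in>{1..d}. V.c k x *\<^sub>R (y k - w))" for x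
  proof -
    have \<alpha>d: "\<alpha> p - \<alpha> q = h (p - q)" for p q using h by (simp add: linear_diff)
    have "x - v = (\<Sum>k\<in>{1..d}. V.c k x *\<^sub>R (u' k - v))"
      using V.expand[of x] unfolding V.c_def by (metis add_diff_cancel_left')
    then have "\<alpha> x - \<alpha> v = h (\<Sum>k\<in>{1..d}. V.c k x *\<^sub>R (u' k - v))"
      using \<alpha>d[of x v] by (simp only:)
    also have "\<dots> = (\<Sum>k\<in>{1..d}. V.c k x *\<^sub>R (\<alpha> (u' k) - \<alpha> v))"
      using h(1) by (simp add: linear_sum linear_scale \<alpha>d)
    also have "\<dots> = (\<Sum>k\<in>{1..d}. V.c k x *\<^sub>R (y k - w))"
      using \<alpha>u \<alpha>v by (intro sum.cong) (auto simp: y_def)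
    finally show ?thesis using \<alpha>v by (simp add: algebra_simps)
  qed
  have \<alpha>c: "W.c k (\<alpha> x) = V.c k x" if k: "k \<in> {1..d}" for k x
  proof -
    have "W.c k (\<alpha> x) = (\<Sum>j\<in>{1..d}. V.c j x * (if k = j then 1 else 0))"
      using k by (simp add: W.c_def \<alpha>_eq inner_sum_right W.dual)
    also have "\<dots> = V.c k x" using k by (simp add: if_distrib cong: if_cong)
    finally show ?thesis .
  qed
  have \<alpha>s: "W.s (\<alpha> x) = V.s x" for x
    unfolding W.s_def V.s_def using \<alpha>c by (intro sum.cong) auto
  have inj\<alpha>: "x = z" if "\<alpha> x = \<alpha> z" for x z
    using \<alpha>c that by (intro V.eq_if_coords) metis
  have "inj h"
  proof (rule injI)
    fix x z assume "h x = h z"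
    then show "x = z" using inj\<alpha>[of x z] h(2) by simp
  qed
  then have iso2: "segment_iso P2 \<alpha>"
    unfolding h(2) using affine_segment_iso h(1) V.convex by blast
  define R1 where "R1 = \<phi> ` P1"
  define R2 where "R2 = \<alpha> ` P2"
  have \<alpha>u': "\<alpha> (u' k) = y k" if "k \<in> {1..d}" for k using \<alpha>u that by (simp add: y_def)
  have poly1: "polytope R1" and poly2: "polytope R2"
    using iso_polytope[OF iso1 P1(1)] iso_polytope[OF iso2 P2(1)] by (simp_all add: R1_def R2_def)
  interpret W: corner d w y a R2
  proof
    show "convex R2" using poly2 polytope_imp_convex by blast
    show "w \<in> R2" using \<alpha>v V.w_in by (auto simp: R2_def)
    show "y k \<in> R2" if "k \<in> {1..d}" for k
      using \<alpha>u'[OF that] V.y_in[OF that] unfolding R2_def by (metis image_eqI)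
    show "0 \<le> W.c k x" if "k \<in> {1..d}" "x \<in> R2" for k x
      using that \<alpha>c V.nonneg unfolding R2_def by auto
  qed
  have corner\<alpha>: "\<alpha> ` V.corner_face S = W.corner_face S" if "S \<subseteq> {1..d}" for S
  proof -
    have "W.c k (\<alpha> x) = V.c k x" if "k \<in> S" for k x
      by (rule \<alpha>c) (use that \<open>S \<subseteq> {1..d}\<close> in blast)
    then show ?thesis unfolding V.corner_face_def W.corner_face_def unfolding R2_def by auto
  qed
  have FR: "convex hull (y ` {1..d}) facet_of R1"
    using iso_facet[OF iso1 P1(1) FP] F \<phi>hull[OF order_refl] by (simp add: R1_def)
  have nonneg1: "0 \<le> W.c k x" if "k \<in> {1..d}" "x \<in> R1" for k x
    using W.simplex_coords(2)[of x k] that sub\<Sigma> \<Sigma>eq unfolding R1_def by blast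
  have s_le1: "W.s x \<le> 1" if "x \<in> R1" for x
    using W.simplex_coords(1)[of x] that sub\<Sigma> \<Sigma>eq unfolding R1_def by blast
  have full1: "aff_dim R1 = int d"
  proof -
    have "convex hull (y ` {1..d}) \<noteq> R1" using FR facet_of_irrefl by metis
    then show ?thesis
      using full_dim_if_proper_face[OF polytope_imp_convex[OF poly1] facet_of_imp_face_of[OF FR]]
        W.aff_dim_hull_y dim by simp
  qed
  have FR_eq: "convex hull (y ` {1..d}) = {x \<in> R1. W.s x = 1}"
  proof -
    have "x \<in> R1" if "x \<in> convex hull (y ` {1..d})" for x using that facet_of_imp_subset[OF FR] by blast
    then show ?thesis using nonneg1 unfolding W.hull_y[OF order_refl] by auto
  qed
  \<comment> \<open>The image of \<open>H k\<close> is a facet inside the proper face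
    \<open>c k = 0\<close>; maximality gives equality.\<close>
  have H_eq: "\<phi> ` H k = {x \<in> R1. W.c k x = 0}" if k: "k \<in> {1..d}" for k
  proof -
    let ?Z = "R1 \<inter> {x. a k \<bullet> x = a k \<bullet> w}"
    have c_eq: "W.c k x = a k \<bullet> x - a k \<bullet> w" for x by (simp add: W.c_def inner_diff_right)
    have Z: "?Z face_of R1"
    proof (rule face_of_Int_supporting_hyperplane_ge[OF polytope_imp_convex[OF poly1]])
      show "a k \<bullet> w \<le> a k \<bullet> x" if "x \<in> R1" for x using nonneg1[OF k that] c_eq by simp
    qed
    have HR: "\<phi> ` H k facet_of R1"
      using iso_facet[OF iso1 P1(1) facet_of_imp_subset[OF facetH[OF k]]] facetH[OF k] by (simp add: R1_def)
    have "\<phi> ` H k \<subseteq> ?Z" using Hsub[OF k] facet_of_imp_subset[OF HR] by (auto simp: inner_diff_right)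
    moreover have "?Z \<noteq> R1"
    proof -
      have "y k \<in> R1" using uP k unfolding R1_def y_def by blast
      moreover have "y k \<notin> ?Z" using W.c_y[OF k k] c_eq[of "y k"] by simp
      ultimately show ?thesis by blast
    qed
    ultimately have "?Z = \<phi> ` H k"
      using HR Z unfolding facet_of_iff_maximal_face[OF polytope_imp_polyhedron[OF poly1]] by blast
    then show ?thesis using c_eq by auto
  qed
  interpret K: core d w y a R2 R1 i
  proof
    show "DIM('a) = d" "i < d" "polytope R2" "polytope R1" "aff_dim R1 = int d" by fact+
    show "y k extreme_point_of R2" if k: "k \<in> {1..d}" for k
    proof -
      have "{u' k} face_of P2" using u'ext[OF k] by (simp add: face_of_singleton)
      then have "\<alpha> ` {u' k} face_of R2" unfolding R2_def using iso_face[OF iso2] V.y_in[OF k] by blast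
      then show ?thesis using \<alpha>u'[OF k] by (simp add: face_of_singleton)
    qed
    show "0 \<le> W.c k x" if "k \<in> {1..d}" "x \<in> R1" for k x by (rule nonneg1[OF that])
    show "W.s x \<le> 1" if "x \<in> R1" for x by (rule s_le1[OF that])
    show "y k \<in> R1" if "k \<in> {1..d}" for k using uP that unfolding R1_def y_def by blast
    show "G = {x \<in> R1. W.s x = 1} \<or> (\<exists>k\<in>S. G = {x \<in> R1. W.c k x = 0})"
      if S: "S \<subseteq> {1..d}" "card S \<le> i" and G: "G facet_of R1" "\<forall>k\<in>{1..d} - S. y k \<in> G" for S G
    proof -
      obtain T where T: "T facet_of P1" "G = \<phi> ` T"
        using iso_facet_lattice[OF iso1 P1(1)] G(1) unfolding R1_def by blast
      have "u k \<in> T" if "k \<in> {1..d} - S" for k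
      proof -
        have "\<phi> (u k) \<in> \<phi> ` T" using G(2) that T(2) by (auto simp: y_def)
        then show ?thesis using iso_mem[OF iso1 _ facet_of_imp_subset[OF T(1)]] uP that by blast
      qed
      then have "T = ?F \<or> (\<exists>k\<in>S. T = H k)"
        using simple_facets[OF dim d P1(1) F simplex P1(2,3) i S T(1)] by (simp add: H_def)
      then show ?thesis
      proof
        assume "T = ?F"
        then show ?thesis using T(2) \<phi>hull[OF order_refl] FR_eq by simp
      next
        assume "\<exists>k\<in>S. T = H k"
        then show ?thesis using T(2) H_eq S(1) by blast
      qed
    qed
    show "W.s x \<le> 1" if S: "S \<subseteq> {1..d}" "i \<le> card S" and x: "x \<in> W.corner_face S" for S x
    proof -
      obtain z where z: "z \<in> V.corner_face S" "x = \<alpha> z" using x corner\<alpha>[OF S(1)] by blast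
      have "V.s z \<le> 1"
        using V.simplicial_corner_face[OF P2(3) less_imp_le[OF i] vext u'ext S z(1)] .
      then show ?thesis using \<alpha>s z(2) by simp
    qed
  qed
  have QK: "Q = K.Q" unfolding K.Q_def using Q by (simp add: R1_def R2_def)
  have corner1\<phi>: "\<phi> ` (P1 \<inter> (\<Inter>k\<in>S. H k)) = K.corner1 S" if S: "S \<subseteq> {1..d}" for S
  proof -
    have "x \<in> H k \<longleftrightarrow> W.c k (\<phi> x) = 0" if "x \<in> P1" "k \<in> S" for x k
    proof -
      have k: "k \<in> {1..d}" using that S by blast
      have "x \<in> H k \<longleftrightarrow> \<phi> x \<in> \<phi> ` H k"
        using iso_mem[OF iso1 that(1) facet_of_imp_subset[OF facetH[OF k]]] by simp
      then show ?thesis using H_eq[OF k] that(1) by (simp add: R1_def)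
    qed
    then show ?thesis unfolding K.corner1_def unfolding R1_def by auto
  qed
  have cornerV: "P2 \<inter> (\<Inter>k\<in>S. vertex_facet P2 v u' k) = V.corner_face S" if S: "S \<subseteq> {1..d}" for S
  proof -
    have "vertex_facet P2 v u' k = V.corner_face {k}" if "k \<in> S" for k
      using V.vertex_facet_eq[OF d P2(2)] edges that S by blast
    then show ?thesis by (auto simp: V.corner_face_def)
  qed
  have cornerP: "V.corner_face S \<subseteq> P2" for S by (auto simp: V.corner_face_def)
  note dim_hull = aff_dim_hull_image[OF ind]
  have face_hull: "convex hull (u ` S) face_of P1" if "S \<subseteq> {1..d}" for S
    using face_of_trans[OF _ facet_of_imp_face_of[OF F]] that unfolding face_of_hull_image[OF ind(1)] by blast
  define A1 where "A1 = lattice1_minus d i P1 u"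
  define A2 where "A2 = lattice2_minus d i P2 v"
  \<comment> \<open>The hull of \<open>card S\<close> of the \<open>u k\<close> has dimension
    \<open>card S - 1\<close>, so dimension below \<open>d - i\<close> means
    \<open>card S \<le> d - i\<close>.\<close>
  have A1_iff: "\<sigma> \<in> A1 \<longleftrightarrow> K.M1 (\<phi> ` \<sigma>)" if \<sigma>: "\<sigma> face_of P1" for \<sigma>
  proof -
    have \<sigma>P: "\<sigma> \<subseteq> P1" using \<sigma> face_of_imp_subset by blast
    have sub: "\<phi> ` \<sigma> \<subseteq> K.F \<longleftrightarrow> \<sigma> \<subseteq> ?F"
      using iso_subset[OF iso1 \<sigma>P FP] \<phi>hull[OF order_refl] by simp
    have face: "\<phi> ` \<sigma> face_of R1" using iso_face[OF iso1 \<sigma>P] \<sigma> by (simp add: R1_def)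
    have "(\<exists>S\<subseteq>{1..d}. card S \<le> d - i \<and> \<phi> ` \<sigma> = convex hull (y ` S)) \<longleftrightarrow> aff_dim \<sigma> < int d - int i"
      if \<sigma>F: "\<sigma> \<subseteq> ?F"
    proof
      assume "\<exists>S\<subseteq>{1..d}. card S \<le> d - i \<and> \<phi> ` \<sigma> = convex hull (y ` S)"
      then obtain S where S: "S \<subseteq> {1..d}" "card S \<le> d - i" "\<phi> ` \<sigma> = convex hull (y ` S)" by blast
      then have "\<sigma> = convex hull (u ` S)"
        using iso_eq[OF iso1 \<sigma>P hullP[OF S(1)]] \<phi>hull[OF S(1)] by simp
      then show "aff_dim \<sigma> < int d - int i" using dim_hull[OF S(1)] S(2) i by simp
    next
      assume less: "aff_dim \<sigma> < int d - int i"
      have "\<sigma> face_of ?F" using face_of_subset[OF \<sigma> \<sigma>F FP] .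
      then obtain S where S: "S \<subseteq> {1..d}" "\<sigma> = convex hull (u ` S)"
        unfolding face_of_hull_image[OF ind(1)] by blast
      have "card S \<le> d - i" using dim_hull[OF S(1)] less S(2) by simp
      then show "\<exists>S\<subseteq>{1..d}. card S \<le> d - i \<and> \<phi> ` \<sigma> = convex hull (y ` S)"
        using S \<phi>hull[OF S(1)] by blast
    qed
    then have "K.M1 (\<phi> ` \<sigma>) \<longleftrightarrow> (\<sigma> \<subseteq> ?F \<longrightarrow> aff_dim \<sigma> < int d - int i)"
      unfolding K.M1_def using face sub by blast
    also have "\<dots> \<longleftrightarrow> \<sigma> \<in> A1"
      unfolding A1_def lattice1_minus_def face_lattice_def using \<sigma> by (simp add: not_le)
    finally show ?thesis by simp
  qed
  \<comment> \<open>A corner on \<open>S\<close> has dimension \<open>d - card S\<close>, so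
    dimension at least \<open>d - i\<close> means \<open>card S \<le> i\<close>.\<close>
  have A2_iff: "\<tau> \<in> A2 \<longleftrightarrow> K.M2 (\<alpha> ` \<tau>)" if \<tau>: "\<tau> face_of P2" for \<tau>
  proof -
    have \<tau>P: "\<tau> \<subseteq> P2" using \<tau> face_of_imp_subset by blast
    have mem: "w \<in> \<alpha> ` \<tau> \<longleftrightarrow> v \<in> \<tau>"
      using iso_mem[OF iso2 V.w_in \<tau>P] \<alpha>v by simp
    have face: "\<alpha> ` \<tau> face_of R2" using iso_face[OF iso2 \<tau>P] \<tau> by (simp add: R2_def)
    have "(\<exists>S\<subseteq>{1..d}. card S \<le> i \<and> \<alpha> ` \<tau> = W.corner_face S) \<longleftrightarrow> int d - int i \<le> aff_dim \<tau>"
      if v\<tau>: "v \<in> \<tau>"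
    proof
      assume "\<exists>S\<subseteq>{1..d}. card S \<le> i \<and> \<alpha> ` \<tau> = W.corner_face S"
      then obtain S where S: "S \<subseteq> {1..d}" "card S \<le> i" "\<alpha> ` \<tau> = W.corner_face S" by blast
      have "\<tau> = V.corner_face S" using iso_eq[OF iso2 \<tau>P cornerP[of S]] corner\<alpha>[OF S(1)] S(3) by simp
      then show "int d - int i \<le> aff_dim \<tau>" using V.aff_dim_corner_face[OF S(1)] S(2) by simp
    next
      assume le: "int d - int i \<le> aff_dim \<tau>"
      obtain S where S: "S \<subseteq> {1..d}" "\<tau> = V.corner_face S" using V.face_at_w[OF \<tau> v\<tau>] .
      then have "card S \<le> i" using le V.aff_dim_corner_face[OF S(1)] by simp
      then show "\<exists>S\<subseteq>{1..d}. card S \<le> i \<and> \<alpha> ` \<tau> = W.corner_face S"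
        using S corner\<alpha>[OF S(1)] by blast
    qed
    then have "K.M2 (\<alpha> ` \<tau>) \<longleftrightarrow> (v \<in> \<tau> \<longrightarrow> int d - int i \<le> aff_dim \<tau>)"
      unfolding K.M2_def using face mem by blast
    also have "\<dots> \<longleftrightarrow> \<tau> \<in> A2"
      unfolding A2_def lattice2_minus_def face_lattice_def using \<tau> by (simp add: not_less)
    finally show ?thesis by simp
  qed
  have A1_face: "\<sigma> face_of P1" if "\<sigma> \<in> A1" for \<sigma>
    using that by (simp add: A1_def lattice1_minus_def face_lattice_def)
  have A2_face: "\<tau> face_of P2" if "\<tau> \<in> A2" for \<tau>
    using that by (simp add: A2_def lattice2_minus_def face_lattice_def)
  have A1_ex: "\<exists>\<sigma>\<in>A1. \<rho> = \<phi> ` \<sigma>" if "K.M1 \<rho>" for \<rho>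
  proof -
    have "\<rho> \<in> {\<tau>. \<tau> face_of \<phi> ` P1}" using that unfolding K.M1_def unfolding R1_def by blast
    then obtain \<sigma> where "\<sigma> face_of P1" "\<rho> = \<phi> ` \<sigma>" unfolding iso_face_lattice[OF iso1] by blast
    then show ?thesis using A1_iff that by blast
  qed
  have A2_ex: "\<exists>\<tau>\<in>A2. \<rho> = \<alpha> ` \<tau>" if "K.M2 \<rho>" for \<rho>
  proof -
    have "\<rho> \<in> {\<tau>. \<tau> face_of \<alpha> ` P2}" using that unfolding K.M2_def unfolding R2_def by blast
    then obtain \<tau> where "\<tau> face_of P2" "\<rho> = \<alpha> ` \<tau>" unfolding iso_face_lattice[OF iso2] by blast
    then show ?thesis using A2_iff that by blast
  qed
  have A1_M1: "K.M1 (\<phi> ` \<sigma>)" if "\<sigma> \<in> A1" for \<sigma> using A1_iff A1_face that by blast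
  have A2_M2: "K.M2 (\<alpha> ` \<tau>)" if "\<tau> \<in> A2" for \<tau> using A2_iff A2_face that by blast
  define f1 where "f1 \<sigma> = K.cl (\<phi> ` \<sigma>)" for \<sigma>
  define f2 where "f2 \<tau> = \<alpha> ` \<tau> \<inter> K.Q" for \<tau>
  have img1: "D \<in> f1 ` A1 \<longleftrightarrow> (\<exists>\<sigma>. K.M1 \<sigma> \<and> D = K.cl \<sigma>)" for D
    using A1_M1 A1_ex unfolding f1_def by blast
  have img2: "D \<in> f2 ` A2 \<longleftrightarrow> (\<exists>\<tau>. K.M2 \<tau> \<and> D = \<tau> \<inter> K.Q)" for D
    using A2_M2 A2_ex unfolding f2_def by blast
  have \<alpha>hull: "\<alpha> ` (convex hull (u' ` S)) = convex hull (y ` S)" if S: "S \<subseteq> {1..d}" for S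
  proof -
    have "u' ` S \<subseteq> P2" using V.y_in S by blast
    moreover have "\<alpha> ` u' ` S = y ` S" unfolding image_image using \<alpha>u' S by (intro image_cong) auto
    ultimately show ?thesis using iso_hull[OF iso2] by simp
  qed
  have hullP2: "convex hull (u' ` S) \<subseteq> P2" if S: "S \<subseteq> {1..d}" for S
    using V.y_in S V.convex by (intro hull_minimal) auto
  have "order_isomorphic ((A1 <+> A2) // Restr ((glue d i P1 u P2 v u' \<union> (glue d i P1 u P2 v u')\<inverse>)\<^sup>*) (A1 <+> A2))
    class_less (face_lattice Q) (\<subset>)"
  proof (rule quotient_order_isomorphic[where ?f1.0 = f1 and ?f2.0 = f2])
    fix x z assume "(x, z) \<in> glue d i P1 u P2 v u'"
    then consider S where "S \<subseteq> {1..d}" "card S \<le> d - i"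
        "x = Inl (convex hull (u ` S))" "z = Inr (convex hull (u' ` S))"
      | S where "S \<subseteq> {1..d}" "card S \<le> i" "x = Inl (P1 \<inter> (\<Inter>k\<in>S. H k))" "z = Inr (V.corner_face S)"
      unfolding glue_def H_def[symmetric] using cornerV by blast
    then show "\<exists>p\<in>A1. \<exists>q\<in>A2. x = Inl p \<and> z = Inr q \<and> f1 p = f2 q"
    proof cases
      case (1 S)
      have "\<phi> ` (convex hull (u ` S)) face_of R1"
        unfolding R1_def using iso_face[OF iso1 hullP[OF 1(1)]] face_hull[OF 1(1)] by blast
      then have "K.M1 (\<phi> ` (convex hull (u ` S)))"
        unfolding K.M1_def \<phi>hull[OF 1(1)] using 1 by blast
      then have p: "convex hull (u ` S) \<in> A1" using A1_iff[OF face_hull[OF 1(1)]] by simp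
      have face2: "\<alpha> ` (convex hull (u' ` S)) face_of R2"
        unfolding \<alpha>hull[OF 1(1)] by (rule K.y_face2[OF 1(1,2)])
      then have face2': "convex hull (u' ` S) face_of P2"
        using iso_face[OF iso2 hullP2[OF 1(1)]] by (simp add: R2_def)
      have "w \<notin> convex hull (y ` S)" using W.hull_y[OF 1(1)] by auto
      then have "K.M2 (\<alpha> ` (convex hull (u' ` S)))"
        unfolding K.M2_def using face2 \<alpha>hull[OF 1(1)] by simp
      then have q: "convex hull (u' ` S) \<in> A2" using A2_iff[OF face2'] by simp
      have "convex hull (y ` S) \<subseteq> K.Q" using face_of_imp_subset[OF K.y_faceQ[OF 1(1,2)]] .
      then have "f1 (convex hull (u ` S)) = f2 (convex hull (u' ` S))"
        unfolding f1_def f2_def \<phi>hull[OF 1(1)] \<alpha>hull[OF 1(1)] K.cl_y[OF 1(1,2)] by blast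
      then show ?thesis using 1 p q by blast
    next
      case (2 S)
      have face1: "P1 \<inter> (\<Inter>k\<in>S. H k) face_of P1"
      proof -
        have "\<Inter>(insert P1 (H ` S)) face_of P1"
          using face_of_refl[OF polytope_imp_convex[OF P1(1)]] facet_of_imp_face_of[OF facetH] 2(1)
          by (intro face_of_Inter) auto
        then show ?thesis by simp
      qed
      have "\<phi> ` (P1 \<inter> (\<Inter>k\<in>S. H k)) face_of R1"
        unfolding R1_def using iso_face[OF iso1] face1 by blast
      \<comment> \<open>A point below level 1 keeps the corner out of \<open>F\<close>, so the
        restriction in \<open>M1\<close> does not apply to it.\<close>
      moreover obtain p where "p \<in> K.corner1 S" "W.s p < 1" using K.below_F[OF 2(1,2)] .
      then have "\<not> K.corner1 S \<subseteq> K.F" using K.F_iff by force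
      ultimately have "K.M1 (\<phi> ` (P1 \<inter> (\<Inter>k\<in>S. H k)))"
        unfolding K.M1_def corner1\<phi>[OF 2(1)] by blast
      then have p: "P1 \<inter> (\<Inter>k\<in>S. H k) \<in> A1" using A1_iff[OF face1] by simp
      have "K.M2 (\<alpha> ` V.corner_face S)"
        unfolding K.M2_def corner\<alpha>[OF 2(1)] using W.face_of_corner_face[OF 2(1)] 2 by blast
      then have q: "V.corner_face S \<in> A2" using A2_iff[OF V.face_of_corner_face[OF 2(1)]] by simp
      have "f1 (P1 \<inter> (\<Inter>k\<in>S. H k)) = f2 (V.corner_face S)"
        unfolding f1_def f2_def corner1\<phi>[OF 2(1)] corner\<alpha>[OF 2(1)] by (rule K.cl_corner1[OF 2(1,2)])
      then show ?thesis using 2 p q by blast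
    qed
  next
    fix p q assume pq: "p \<in> A1" "q \<in> A2" and eq: "f1 p = f2 q"
    have pP: "p \<subseteq> P1" and qP: "q \<subseteq> P2"
      using A1_face[OF pq(1)] A2_face[OF pq(2)] face_of_imp_subset by auto
    from K.cl_eq_imp_glued[OF A1_M1[OF pq(1)] A2_M2[OF pq(2)] eq[unfolded f1_def f2_def]]
    consider S where "S \<subseteq> {1..d}" "card S \<le> d - i" "\<phi> ` p = convex hull (y ` S)" "\<alpha> ` q = convex hull (y ` S)"
      | S where "S \<subseteq> {1..d}" "card S \<le> i" "\<phi> ` p = K.corner1 S" "\<alpha> ` q = W.corner_face S" by blast
    then show "(Inl p, Inr q) \<in> glue d i P1 u P2 v u'"
    proof cases
      case (1 S)
      then have "p = convex hull (u ` S)"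
        using iso_eq[OF iso1 pP hullP[OF 1(1)]] \<phi>hull[OF 1(1)] by simp
      moreover have "q = convex hull (u' ` S)"
        using iso_eq[OF iso2 qP hullP2[OF 1(1)]] \<alpha>hull[OF 1(1)] 1(4) by simp
      ultimately show ?thesis unfolding glue_def using 1 by blast
    next
      case (2 S)
      then have "p = P1 \<inter> (\<Inter>k\<in>S. H k)"
        using iso_eq[OF iso1 pP, of "P1 \<inter> (\<Inter>k\<in>S. H k)"] corner1\<phi>[OF 2(1)] by simp
      moreover have "q = P2 \<inter> (\<Inter>k\<in>S. vertex_facet P2 v u' k)"
        using iso_eq[OF iso2 qP cornerP[of S]] corner\<alpha>[OF 2(1)] cornerV[OF 2(1)] 2(4) by simp
      ultimately show ?thesis unfolding glue_def H_def using 2 by blast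
    qed
  next
    fix p q assume pq: "p \<in> A1" "q \<in> A1"
    have "p \<subseteq> P1" "q \<subseteq> P1" using A1_face pq face_of_imp_subset by blast+
    then show "f1 p \<subseteq> f1 q \<longleftrightarrow> p \<subseteq> q"
      unfolding f1_def using K.cl_subset_iff[OF A1_M1[OF pq(1)] A1_M1[OF pq(2)]] iso_subset[OF iso1] by simp
  next
    fix p q assume pq: "p \<in> A2" "q \<in> A2"
    have "p \<subseteq> P2" "q \<subseteq> P2" using A2_face pq face_of_imp_subset by blast+
    then show "f2 p \<subseteq> f2 q \<longleftrightarrow> p \<subseteq> q"
      unfolding f2_def using K.face2_subset_iff[OF A2_M2[OF pq(1)] A2_M2[OF pq(2)]] iso_subset[OF iso2] by simp
  next
    show "f1 ` A1 \<union> f2 ` A2 = face_lattice Q"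
    proof (intro equalityI subsetI)
      fix D assume "D \<in> f1 ` A1 \<union> f2 ` A2"
      then show "D \<in> face_lattice Q"
      proof
        assume "D \<in> f1 ` A1"
        then obtain \<sigma> where \<sigma>: "K.M1 \<sigma>" "D = K.cl \<sigma>" unfolding img1 by blast
        have "\<sigma> \<subseteq> K.Q" using \<sigma>(1) face_of_imp_subset K.sub1_Q unfolding K.M1_def by blast
        then show ?thesis using K.cl_face \<sigma>(2) by (simp add: face_lattice_def QK)
      next
        assume "D \<in> f2 ` A2"
        then obtain \<tau> where \<tau>: "K.M2 \<tau>" "D = \<tau> \<inter> K.Q" unfolding img2 by blast
        have "\<tau> \<inter> K.Q face_of R2 \<inter> K.Q"
          using \<tau>(1) K.convex_Q unfolding K.M2_def by (intro face_of_slice) auto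
        moreover have "R2 \<inter> K.Q = K.Q" using K.Q_sub2 by blast
        ultimately show ?thesis using \<tau>(2) by (simp add: face_lattice_def QK)
      qed
    next
      fix D assume "D \<in> face_lattice Q"
      then have "D face_of K.Q" by (simp add: face_lattice_def QK)
      then show "D \<in> f1 ` A1 \<union> f2 ` A2" using K.surj unfolding Un_iff img1 img2 by blast
    qed
  next
    fix D E assume "D \<in> face_lattice Q" "E \<in> face_lattice Q" "D \<subseteq> E"
    then show "D \<in> f1 ` A1 \<and> E \<in> f1 ` A1 \<or> D \<in> f2 ` A2 \<and> E \<in> f2 ` A2"
      unfolding img1 img2 face_lattice_def QK using K.same_side by simp
  qed
  then show ?thesis by (simp add: merge_poset_def A1_def A2_def Let_def)
qed

text \<open>The merge depends on the chosen projective map, so the isomorphism is claimed for every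
  merge; the existence part keeps this from being vacuous.\<close>

theorem theorem4p12:
  fixes P1 P2 F :: "'a::euclidean_space set"
    and u u' :: "nat \<Rightarrow> 'a" and v :: 'a and d i :: nat
  assumes "DIM('a) = d" and "2 \<le> d" and "1 \<le> i" and "i \<le> d - 1"
    and "d_polytope d P1" and "j_simplicial (d - i) P1" and "i_simple i P1"
    and "d_polytope d P2" and "j_simplicial (d - i) P2" and "i_simple i P2"
    and "F facet_of P1" and "(int d - 1) simplex F" and "F = convex hull (u ` {1..d})"
    and "simple_vertex d P2 v" and "bij_betw u' {1..d} (neighbours P2 v)"
  shows "(\<exists>Q. is_merge d P1 u P2 v u' Q) \<and>
    (\<forall>Q. is_merge d P1 u P2 v u' Q \<longrightarrow>
       order_isomorphic (merge_poset d i P1 u P2 v u') class_less (face_lattice Q) (\<subset>))"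
proof -
  have P: "polytope P1" "aff_dim P1 = int d" "polytope P2" "aff_dim P2 = int d"
    using assms(5,8) by (simp_all add: d_polytope_def)
  have F: "convex hull (u ` {1..d}) facet_of P1" "(int d - 1) simplex (convex hull (u ` {1..d}))"
    using assms(11-13) by simp_all
  have i: "i < d" using assms(2,4) by simp
  obtain a' where "frame d v u' a'"
  proof -
    have "aff_dim P2 = int DIM('a)" using P(4) assms(1) by simp
    from simple_vertex_frame[OF P(3) this assms(1,14,15)] show ?thesis using that by blast
  qed
  then have "\<exists>Q. is_merge d P1 u P2 v u' Q" by (rule merge_exists[OF assms(1,2) P(1) F])
  moreover have "order_isomorphic (merge_poset d i P1 u P2 v u') class_less (face_lattice Q) (\<subset>)"
    if "is_merge d P1 u P2 v u' Q" for Q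
    by (rule merge_lattice[OF assms(1,2) i P(1,2) assms(7) P(3,4) assms(9) F assms(14,15) that])
  ultimately show ?thesis by blast
qed

end
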